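(* Let $k\ge1$. A function $u\in C^0(\mathbb{R};H^{2k})\cap C^1(\mathbb{R};H^{2k-2})$ is a solution to $$\mathrm{i}\partial_tu=(\partial_x^2+V)u\quad\text{in }\mathbb{R}\times(0,1),\qquad u(\cdot,0)=u(\cdot,1)=0\quad\text{in }\mathbb{R},$$ if and only if there exists $v^{(0)}\in H^{2k}_{\mathrm{Dir}}$ such that $$\forall t\in\mathbb{R},\qquad u(t)=e^{\mathfrak{C}_k}e^{-\mathrm{i}t(\partial_x^2+V^{\mathrm{cor}}_k)}v^{(0)}.$$
   Context: $V\in C^\infty([0,1];\mathbb{R})$ is fixed. $H^m=H^m([0,1])$ is the usual Sobolev space of complex-valued functions on $[0,1]$. For integers $a\ge0$, $H^{2a}_V=\{u\in H^{2a}:\forall\,0\le\ell<a,\ (\partial_x^2+V)^\ell u(0)=(\partial_x^2+V)^\ell u(1)=0\}$, and $H^{2a}_{\mathrm{Dir}}=\{u\in H^{2a}:\forall\,0\le\ell<a,\ \partial_x^{2\ell}u(0)=\partial_x^{2\ell}u(1)=0\}$. Fix $\varphi_{n,y}\in C^\infty([0,1];\mathbb{R})$ ($n\ge0$, $y\in\{0,1\}$) such that for all $z\in\{0,1\}$, $i\ge0$: $\partial_x^i\varphi_{n,y}(z)=1$ if $z=y$ and $i=n$, and $=0$ otherwise. For $u\in L^1([0,1])$ and $n\ge1$, $\mathcal{I}_{n,y}u(x)=\frac1{(n-1)!}\int_y^x(x-z)^{n-1}u(z)\,dz$. Fix real coefficients $\alpha_{i,n,y}$ ($i\ge1$, $1\le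 n\le2i+1$, $y\in\{0,1\}$) such that for all $k\ge1$ the corrector $\mathfrak{C}_ku=\sum_{y\in\{0,1\}}\sum_{i=1}^{k-1}\sum_{n=1}^{2i+1}\alpha_{i,n,y}\varphi_{2i+1-n,y}\mathcal{I}_{n,y}u$ satisfies $\exp(\mathfrak{C}_k)H^{2k+2}_{\mathrm{Dir}}\subset H^{2k+2}_V$ (such coefficients exist). Exponentials of $\mathfrak{C}_k$ are given by power series. The modified potential is $V^{\mathrm{cor}}_k=e^{-\mathfrak{C}_k}(\partial_x^2+V)e^{\mathfrak{C}_k}-\partial_x^2$. For $v^{(0)}\in H^{2k}_{\mathrm{Dir}}$, $v(t)=e^{-\mathrm{i}t(\partial_x^2+V^{\mathrm{cor}}_k)}v^{(0)}$ denotes the unique solution $v\in C^0(\mathbb{R};H^{2k}_{\mathrm{Dir}})\cap C^1(\mathbb{R};H^{2k-2}_{\mathrm{Dir}})$ of $\mathrm{i}\partial_tv=(\partial_x^2+V^{\mathrm{cor}}_k)v$, $v(0)=v^{(0)}$. *)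

theory Defs
  imports "HOL-Analysis.Analysis"
begin

text \<open>
  Elements of the complex Lebesgue and Sobolev spaces on \<open>[0,1]\<close> are represented by functions
  \<open>real \<Rightarrow> complex\<close>, of which only the values on \<open>[0,1]\<close> matter, and those only up to null sets:
  equality of elements is equality almost everywhere with respect to \<open>M01\<close>. Operators returning an
  element of such a space select one representative with \<open>SOME\<close>.
\<close>

abbreviation M01 :: "real measure" where
  "M01 \<equiv> restrict_space lborel {0..1}"

definition eq01 :: "(real \<Rightarrow> complex) \<Rightarrow> (real \<Rightarrow> complex) \<Rightarrow> bool" where
  "eq01 u w \<longleftrightarrow> (AE x in M01. u x = w x)"


subsection \<open>Smooth functions\<close>

text \<open>For \<open>S = {0..1}\<close> the derivatives at the end points are one-sided.\<close>

primrec nderiv :: "real set \<Rightarrow> nat \<Rightarrow> (real \<Rightarrow> 'a::real_normed_vector) \<Rightarrow> real \<Rightarrow> 'a" where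
  "nderiv S 0 f = f"
| "nderiv S (Suc n) f = (\<lambda>x. vector_derivative (nderiv S n f) (at x within S))"

definition smooth_on :: "real set \<Rightarrow> (real \<Rightarrow> 'a::real_normed_vector) \<Rightarrow> bool" where
  "smooth_on S f \<longleftrightarrow> (\<forall>n. \<forall>x\<in>S. nderiv S n f differentiable (at x within S))"

definition test_fun :: "(real \<Rightarrow> complex) \<Rightarrow> bool" where
  "test_fun \<theta> \<longleftrightarrow> smooth_on UNIV \<theta> \<and> (\<exists>a b. 0 < a \<and> b < 1 \<and> (\<forall>x. x \<notin> {a..b} \<longrightarrow> \<theta> x = 0))"


subsection \<open>Sobolev spaces on the unit interval\<close>

definition L2 :: "(real \<Rightarrow> complex) set" where
  "L2 = {u \<in> borel_measurable M01. integrable M01 (\<lambda>x. (cmod (u x))\<^sup>2)}"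

definition L2_norm :: "(real \<Rightarrow> complex) \<Rightarrow> real" where
  "L2_norm u = sqrt (\<integral>x. (cmod (u x))\<^sup>2 \<partial>M01)"

definition is_wderiv :: "nat \<Rightarrow> (real \<Rightarrow> complex) \<Rightarrow> (real \<Rightarrow> complex) \<Rightarrow> bool" where
  "is_wderiv j u g \<longleftrightarrow> (\<forall>\<theta>. test_fun \<theta> \<longrightarrow>
     (\<integral>x. u x * nderiv UNIV j \<theta> x \<partial>M01) = (-1) ^ j * (\<integral>x. g x * \<theta> x \<partial>M01))"

definition Sob :: "nat \<Rightarrow> (real \<Rightarrow> complex) set" where
  "Sob m = {u \<in> L2. \<forall>j\<le>m. \<exists>g\<in>L2. is_wderiv j u g}"

definition wderiv :: "nat \<Rightarrow> (real \<Rightarrow> complex) \<Rightarrow> real \<Rightarrow> complex" where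
  "wderiv j u = (SOME g. g \<in> L2 \<and> is_wderiv j u g)"

definition Sob_norm :: "nat \<Rightarrow> (real \<Rightarrow> complex) \<Rightarrow> real" where
  "Sob_norm m u = sqrt (\<Sum>j\<le>m. (L2_norm (wderiv j u))\<^sup>2)"

text \<open>The value at \<open>z \<in> [0,1]\<close> of the continuous representative of \<open>u\<close>.\<close>

definition point_value :: "(real \<Rightarrow> complex) \<Rightarrow> real \<Rightarrow> complex" where
  "point_value u z = (THE c. \<exists>w. continuous_on {0..1} w \<and> eq01 u w \<and> w z = c)"

text \<open>The operator \<open>\<partial>\<^sub>x\<^sup>2 + V\<close>.\<close>

definition schr_op :: "(real \<Rightarrow> real) \<Rightarrow> (real \<Rightarrow> complex) \<Rightarrow> real \<Rightarrow> complex" where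
  "schr_op V u = (\<lambda>x. wderiv 2 u x + of_real (V x) * u x)"

text \<open>The argument \<open>a\<close> of the following two spaces corresponds to Sobolev regularity \<open>2a\<close>.\<close>

definition Sob_V :: "(real \<Rightarrow> real) \<Rightarrow> nat \<Rightarrow> (real \<Rightarrow> complex) set" where
  "Sob_V V a = {u \<in> Sob (2 * a). \<forall>l<a.
     point_value ((schr_op V ^^ l) u) 0 = 0 \<and> point_value ((schr_op V ^^ l) u) 1 = 0}"

definition Sob_Dir :: "nat \<Rightarrow> (real \<Rightarrow> complex) set" where
  "Sob_Dir a = {u \<in> Sob (2 * a). \<forall>l<a.
     point_value (wderiv (2 * l) u) 0 = 0 \<and> point_value (wderiv (2 * l) u) 1 = 0}"


subsection \<open>Continuous and continuously differentiable curves\<close>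

text \<open>Here \<open>X\<close> is a subspace of \<open>Sob m\<close>, equipped with the norm of \<open>Sob m\<close>.\<close>

definition C0_curve :: "(real \<Rightarrow> complex) set \<Rightarrow> nat \<Rightarrow> (real \<Rightarrow> real \<Rightarrow> complex) \<Rightarrow> bool" where
  "C0_curve X m u \<longleftrightarrow> (\<forall>t. u t \<in> X) \<and>
     (\<forall>t. ((\<lambda>s. Sob_norm m (\<lambda>x. u s x - u t x)) \<longlongrightarrow> 0) (at t))"

definition has_time_deriv ::
  "nat \<Rightarrow> (real \<Rightarrow> real \<Rightarrow> complex) \<Rightarrow> real \<Rightarrow> (real \<Rightarrow> complex) \<Rightarrow> bool" where
  "has_time_deriv m u t g \<longleftrightarrow>
     ((\<lambda>h. Sob_norm m (\<lambda>x. (u (t + h) x - u t x) /\<^sub>R h - g x)) \<longlongrightarrow> 0) (at 0)"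

definition C1_curve :: "(real \<Rightarrow> complex) set \<Rightarrow> nat \<Rightarrow> (real \<Rightarrow> real \<Rightarrow> complex) \<Rightarrow> bool" where
  "C1_curve X m u \<longleftrightarrow> (\<forall>t. u t \<in> X) \<and>
     (\<exists>u'. C0_curve X m u' \<and> (\<forall>t. has_time_deriv m u t (u' t)))"

definition time_deriv :: "nat \<Rightarrow> (real \<Rightarrow> real \<Rightarrow> complex) \<Rightarrow> real \<Rightarrow> real \<Rightarrow> complex" where
  "time_deriv m u t = (SOME g. g \<in> Sob m \<and> has_time_deriv m u t g)"

text \<open>For \<open>u\<close> with values in \<open>H\<^sup>2\<^sup>k\<close> and differentiable in time with values in \<open>H\<^sup>2\<^sup>k\<^sup>-\<^sup>2\<close>.\<close>

definition dirichlet_schr_solution ::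
  "(real \<Rightarrow> real) \<Rightarrow> nat \<Rightarrow> (real \<Rightarrow> real \<Rightarrow> complex) \<Rightarrow> bool" where
  "dirichlet_schr_solution V k u \<longleftrightarrow>
     (\<forall>t. eq01 (\<lambda>x. \<i> * time_deriv (2 * k - 2) u t x) (schr_op V (u t))) \<and>
     (\<forall>t. point_value (u t) 0 = 0 \<and> point_value (u t) 1 = 0)"


subsection \<open>The corrector\<close>

definition boundary_cutoffs :: "(nat \<Rightarrow> real \<Rightarrow> real \<Rightarrow> real) \<Rightarrow> bool" where
  "boundary_cutoffs \<phi> \<longleftrightarrow> (\<forall>n. \<forall>y\<in>{0, 1}. smooth_on {0..1} (\<phi> n y) \<and>
     (\<forall>z\<in>{0, 1}. \<forall>i. nderiv {0..1} i (\<phi> n y) z = (if z = y \<and> i = n then 1 else 0)))"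

text \<open>The interval integral is oriented: it changes sign when \<open>x < y\<close>.\<close>

definition iter_int :: "nat \<Rightarrow> real \<Rightarrow> (real \<Rightarrow> complex) \<Rightarrow> real \<Rightarrow> complex" where
  "iter_int n y u x = (1 / fact (n - 1)) * (LBINT z=y..x. of_real ((x - z) ^ (n - 1)) * u z)"

definition corrector ::
  "(nat \<Rightarrow> real \<Rightarrow> real \<Rightarrow> real) \<Rightarrow> (nat \<Rightarrow> nat \<Rightarrow> real \<Rightarrow> real) \<Rightarrow> nat \<Rightarrow>
   (real \<Rightarrow> complex) \<Rightarrow> real \<Rightarrow> complex" where
  "corrector \<phi> \<alpha> k u x = (\<Sum>y\<in>{0, 1}. \<Sum>i=1..k-1. \<Sum>n=1..2*i+1.
     of_real (\<alpha> i n y * \<phi> (2 * i + 1 - n) y x) * iter_int n y u x)"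

text \<open>The power series of the exponential of an operator, applied to \<open>u\<close> and summed in \<open>L\<^sup>2\<close>.\<close>

definition op_exp ::
  "((real \<Rightarrow> complex) \<Rightarrow> real \<Rightarrow> complex) \<Rightarrow> (real \<Rightarrow> complex) \<Rightarrow> real \<Rightarrow> complex" where
  "op_exp T u = (SOME w. w \<in> L2 \<and>
     (\<lambda>N. L2_norm (\<lambda>x. w x - (\<Sum>n<N. (T ^^ n) u x / fact n))) \<longlonglongrightarrow> 0)"

definition exp_corr ::
  "(nat \<Rightarrow> real \<Rightarrow> real \<Rightarrow> real) \<Rightarrow> (nat \<Rightarrow> nat \<Rightarrow> real \<Rightarrow> real) \<Rightarrow> nat \<Rightarrow>
   (real \<Rightarrow> complex) \<Rightarrow> real \<Rightarrow> complex" where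
  "exp_corr \<phi> \<alpha> k = op_exp (corrector \<phi> \<alpha> k)"

definition exp_minus_corr ::
  "(nat \<Rightarrow> real \<Rightarrow> real \<Rightarrow> real) \<Rightarrow> (nat \<Rightarrow> nat \<Rightarrow> real \<Rightarrow> real) \<Rightarrow> nat \<Rightarrow>
   (real \<Rightarrow> complex) \<Rightarrow> real \<Rightarrow> complex" where
  "exp_minus_corr \<phi> \<alpha> k = op_exp (\<lambda>u x. - corrector \<phi> \<alpha> k u x)"

definition admissible_coeffs ::
  "(real \<Rightarrow> real) \<Rightarrow> (nat \<Rightarrow> real \<Rightarrow> real \<Rightarrow> real) \<Rightarrow> (nat \<Rightarrow> nat \<Rightarrow> real \<Rightarrow> real) \<Rightarrow> bool" where
  "admissible_coeffs V \<phi> \<alpha> \<longleftrightarrow> (\<forall>k\<ge>1. exp_corr \<phi> \<alpha> k ` Sob_Dir (k + 1) \<subseteq> Sob_V V (k + 1))"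

definition V_cor ::
  "(real \<Rightarrow> real) \<Rightarrow> (nat \<Rightarrow> real \<Rightarrow> real \<Rightarrow> real) \<Rightarrow> (nat \<Rightarrow> nat \<Rightarrow> real \<Rightarrow> real) \<Rightarrow> nat \<Rightarrow>
   (real \<Rightarrow> complex) \<Rightarrow> real \<Rightarrow> complex" where
  "V_cor V \<phi> \<alpha> k v =
     (\<lambda>x. exp_minus_corr \<phi> \<alpha> k (schr_op V (exp_corr \<phi> \<alpha> k v)) x - wderiv 2 v x)"


subsection \<open>The modified flow\<close>

definition modified_solution ::
  "(real \<Rightarrow> real) \<Rightarrow> (nat \<Rightarrow> real \<Rightarrow> real \<Rightarrow> real) \<Rightarrow> (nat \<Rightarrow> nat \<Rightarrow> real \<Rightarrow> real) \<Rightarrow> nat \<Rightarrow>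
   (real \<Rightarrow> complex) \<Rightarrow> (real \<Rightarrow> real \<Rightarrow> complex) \<Rightarrow> bool" where
  "modified_solution V \<phi> \<alpha> k v0 v \<longleftrightarrow>
     C0_curve (Sob_Dir k) (2 * k) v \<and>
     C1_curve (Sob_Dir (k - 1)) (2 * k - 2) v \<and>
     (\<forall>t. eq01 (\<lambda>x. \<i> * time_deriv (2 * k - 2) v t x)
               (\<lambda>x. wderiv 2 (v t) x + V_cor V \<phi> \<alpha> k (v t) x)) \<and>
     eq01 (v 0) v0"

text \<open>
  The solution is unique as a curve of classes, so the choice made by \<open>SOME\<close> only affects the
  representatives. Its existence is not built into the definition.
\<close>

definition modified_flow ::
  "(real \<Rightarrow> real) \<Rightarrow> (nat \<Rightarrow> real \<Rightarrow> real \<Rightarrow> real) \<Rightarrow> (nat \<Rightarrow> nat \<Rightarrow> real \<Rightarrow> real) \<Rightarrow> nat \<Rightarrow>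
   real \<Rightarrow> (real \<Rightarrow> complex) \<Rightarrow> real \<Rightarrow> complex" where
  "modified_flow V \<phi> \<alpha> k t v0 = (SOME v. modified_solution V \<phi> \<alpha> k v0 v) t"

end

theory Submission
  imports Defs "HOL-Analysis.Analysis"
begin

text \<open>The map \<open>v \<mapsto> e\<^sup>C v\<close> carries solutions of the modified equation to solutions of
  \<open>\<i> \<partial>\<^sub>t u = (\<partial>\<^sup>2 + V) u\<close> and back, provided that it maps \<open>H\<^sup>2\<^sup>k\<^sub>D\<^sub>i\<^sub>r\<close> onto \<open>H\<^sup>2\<^sup>k\<^sub>V\<close> and that a
  solution \<open>u\<close> with zero boundary values takes its values in \<open>H\<^sup>2\<^sup>k\<^sub>V\<close>. The latter follows by
  differentiating the boundary condition in time. For the former, the inclusion known for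
  \<open>k + 1\<close> passes to \<open>k\<close> by density and is an equality because both spaces are cut out of
  \<open>H\<^sup>2\<^sup>k\<close> by \<open>2 k\<close> independent functionals. Uniqueness is conservation of the \<open>L\<^sup>2\<close> norm.
  The modified flow is defined by a choice operator, so the existence of solutions has to be
  proved as well: \<open>-\<i> (\<partial>\<^sup>2 + V)\<close> is skew-adjoint on the range of the Dirichlet inverse \<open>G\<close> of
  \<open>\<partial>\<^sup>2\<close>, and its group is the limit of the groups of bounded skew approximations.\<close>

section \<open>The space of classes of square integrable functions\<close>

text \<open>The statement speaks of functions selected by \<open>SOME\<close> and determined only up
  to null sets. The proof moves to a Hilbert space \<open>l2\<close> of classes, on which these
  choices disappear. There a derivative is defined as an inverse of the bounded operator
  \<open>prim\<close>, which makes differentiation a closed operation and postpones the weak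
  formulation until the definitions have to be matched.

  The order k is manageable because \<open>HV W k\<close> is the domain of the k-th power of
  \<open>B\<close>, the operator -i (d^2/dx^2 + V) with Dirichlet conditions. The group commutes
  with \<open>B\<close>, hence preserves these spaces, and the graph norm controls the Sobolev norm;
  regularity in time thus reduces to strong continuity in \<open>l2\<close>.

  The time derivative of a solution exists only in regularity 2k - 2. Boundary conditions are
  therefore gained one level at a time, and the correspondence of spaces is needed at level k - 1 as
  well, where the time derivative of the modified flow has to live.\<close>

lemma space_M01: "space M01 = {0..1}"
  by (simp add: space_restrict_space)

lemma sets_M01: "sets M01 = sets (restrict_space borel {0..1})"
  by (rule sets_restrict_space_cong) simp

interpretation M01: finite_measure M01
  by (rule finite_measureI) (simp add: emeasure_restrict_space space_M01)

lemma measure_M01: "measure M01 {0..1} = 1"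
  by (simp add: measure_restrict_space)

section \<open>Linear structure and multipliers of square integrable functions\<close>

lemma L2_I: "u \<in> borel_measurable M01 \<Longrightarrow> integrable M01 (\<lambda>x. (cmod (u x))\<^sup>2) \<Longrightarrow> u \<in> L2"
  by (simp add: L2_def)

lemma L2_measurable [measurable_dest]: "u \<in> L2 \<Longrightarrow> u \<in> borel_measurable M01"
  by (simp add: L2_def)

lemma L2_square_integrable: "u \<in> L2 \<Longrightarrow> integrable M01 (\<lambda>x. (cmod (u x))\<^sup>2)"
  by (simp add: L2_def)

lemma L2_dominated:
  assumes "u \<in> borel_measurable M01" and "w \<in> L2" and "\<And>x. x \<in> {0..1} \<Longrightarrow> cmod (u x) \<le> c * cmod (w x)"
  shows "u \<in> L2"
proof (rule L2_I)
  have "integrable M01 (\<lambda>x. c\<^sup>2 * (cmod (w x))\<^sup>2)"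
    using L2_square_integrable[OF assms(2)] by simp
  then show "integrable M01 (\<lambda>x. (cmod (u x))\<^sup>2)"
  proof (rule Bochner_Integration.integrable_bound)
    show "(\<lambda>x. (cmod (u x))\<^sup>2) \<in> borel_measurable M01" using assms(1) by measurable
    show "AE x in M01. norm ((cmod (u x))\<^sup>2) \<le> norm (c\<^sup>2 * (cmod (w x))\<^sup>2)"
    proof (rule AE_I2)
      fix x assume "x \<in> space M01"
      then have "cmod (u x) \<le> c * cmod (w x)" using assms(3) by (simp add: space_M01)
      then have "(cmod (u x))\<^sup>2 \<le> (c * cmod (w x))\<^sup>2" by (intro power_mono) auto
      then show "norm ((cmod (u x))\<^sup>2) \<le> norm (c\<^sup>2 * (cmod (w x))\<^sup>2)"
        by (simp add: power_mult_distrib)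
    qed
  qed
qed (rule assms(1))

lemma L2_prod_integrable:
  assumes "u \<in> L2" "w \<in> L2"
  shows "integrable M01 (\<lambda>x. u x * w x)"
proof -
  have "integrable M01 (\<lambda>x. (cmod (u x))\<^sup>2 + (cmod (w x))\<^sup>2)"
    using assms by (simp add: L2_square_integrable)
  then show ?thesis
  proof (rule Bochner_Integration.integrable_bound)
    show "(\<lambda>x. u x * w x) \<in> borel_measurable M01" using assms[THEN L2_measurable] by measurable
    have "a * b \<le> \<bar>a\<^sup>2 + b\<^sup>2\<bar>" if "0 \<le> a" "0 \<le> b" for a b :: real
    proof -
      have "2 * (a * b) \<le> a\<^sup>2 + b\<^sup>2" using sum_squares_bound[of a b] by simp
      moreover have "0 \<le> a * b" using that by simp
      ultimately show ?thesis by linarith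
    qed
    then show "AE x in M01. norm (u x * w x) \<le> norm ((cmod (u x))\<^sup>2 + (cmod (w x))\<^sup>2)"
      by (simp add: norm_mult)
  qed
qed

lemma L2_zero: "(\<lambda>_. 0) \<in> L2"
  by (rule L2_I) auto

lemma L2_add:
  assumes "u \<in> L2" "w \<in> L2"
  shows "(\<lambda>x. u x + w x) \<in> L2"
proof (rule L2_I)
  show "(\<lambda>x. u x + w x) \<in> borel_measurable M01" using assms[THEN L2_measurable] by measurable
  have "integrable M01 (\<lambda>x. 2 * (cmod (u x))\<^sup>2 + 2 * (cmod (w x))\<^sup>2)"
    using assms by (simp add: L2_square_integrable)
  then show "integrable M01 (\<lambda>x. (cmod (u x + w x))\<^sup>2)"
  proof (rule Bochner_Integration.integrable_bound)
    show "(\<lambda>x. (cmod (u x + w x))\<^sup>2) \<in> borel_measurable M01"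
      using assms[THEN L2_measurable] by measurable
    have "(cmod (a + b))\<^sup>2 \<le> 2 * (cmod a)\<^sup>2 + 2 * (cmod b)\<^sup>2" for a b
    proof -
      have "(cmod (a + b))\<^sup>2 \<le> (cmod a + cmod b)\<^sup>2" by (intro power_mono norm_triangle_ineq) auto
      also have "\<dots> \<le> 2 * (cmod a)\<^sup>2 + 2 * (cmod b)\<^sup>2"
        using sum_squares_bound[of "cmod a" "cmod b"] by (simp add: power2_sum)
      finally show ?thesis .
    qed
    then show "AE x in M01. norm ((cmod (u x + w x))\<^sup>2) \<le> norm (2 * (cmod (u x))\<^sup>2 + 2 * (cmod (w x))\<^sup>2)"
      by simp
  qed
qed

lemma L2_mult:
  assumes "f \<in> borel_measurable M01" "\<And>x. x \<in> {0..1} \<Longrightarrow> cmod (f x) \<le> c" "u \<in> L2"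
  shows "(\<lambda>x. f x * u x) \<in> L2"
proof (rule L2_dominated[where w = u and c = c])
  show "(\<lambda>x. f x * u x) \<in> borel_measurable M01"
    using assms(1) L2_measurable[OF assms(3)] by measurable
qed (use assms(3) assms(2) in \<open>auto simp: norm_mult intro: mult_right_mono\<close>)

lemma L2_cmult: "u \<in> L2 \<Longrightarrow> (\<lambda>x. c * u x) \<in> L2"
  by (rule L2_mult[where c = "cmod c"]) auto

lemma L2_uminus: "u \<in> L2 \<Longrightarrow> (\<lambda>x. - u x) \<in> L2"
  using L2_cmult[of u "-1"] by simp

lemma L2_diff: "u \<in> L2 \<Longrightarrow> w \<in> L2 \<Longrightarrow> (\<lambda>x. u x - w x) \<in> L2"
  using L2_add[OF _ L2_uminus] by fastforce

lemma L2_scaleR: "u \<in> L2 \<Longrightarrow> (\<lambda>x. r *\<^sub>R u x) \<in> L2"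
  using L2_cmult[of u "of_real r"] by (simp add: scaleR_conv_of_real)

lemma L2_cnj: "u \<in> L2 \<Longrightarrow> (\<lambda>x. cnj (u x)) \<in> L2"
  by (rule L2_dominated[where c = 1 and w = u])
    (auto dest!: L2_measurable intro: measurable_compose[OF _ borel_measurable_continuous_onI] continuous_intros)

lemma L2_sum: "(\<And>i. i \<in> A \<Longrightarrow> u i \<in> L2) \<Longrightarrow> (\<lambda>x. \<Sum>i\<in>A. u i x) \<in> L2"
  by (induction A rule: infinite_finite_induct) (auto intro: L2_zero L2_add)

lemma L2_bounded:
  assumes "f \<in> borel_measurable M01" "\<And>x. x \<in> {0..1} \<Longrightarrow> cmod (f x) \<le> c"
  shows "f \<in> L2"
proof -
  have "(\<lambda>_. 1) \<in> L2" by (rule L2_I) auto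
  from L2_mult[OF assms this] show ?thesis by simp
qed

lemma continuous_on_measurable_M01:
  "continuous_on {0..1} f \<Longrightarrow> f \<in> borel_measurable M01"
  using borel_measurable_continuous_on_restrict[of "{0..1}" f]
  by (simp add: measurable_cong_sets[OF sets_M01 refl])

lemma L2_continuous:
  assumes "continuous_on {0..1} (f :: real \<Rightarrow> complex)"
  shows "f \<in> L2"
proof -
  have "bounded (f ` {0..1})" by (intro compact_imp_bounded compact_continuous_image assms) auto
  then obtain c where "\<forall>x\<in>{0..1}. cmod (f x) \<le> c" unfolding bounded_iff by auto
  then show ?thesis by (intro L2_bounded continuous_on_measurable_M01 assms) auto
qed

lemma L2_cont_mult: "continuous_on {0..1} f \<Longrightarrow> u \<in> L2 \<Longrightarrow> (\<lambda>x. f x * u x) \<in> L2"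
proof -
  assume f: "continuous_on {0..1} f" and w: "u \<in> L2"
  have "bounded (f ` {0..1})" by (intro compact_imp_bounded compact_continuous_image f) auto
  then obtain c where "\<forall>x\<in>{0..1}. cmod (f x) \<le> c" unfolding bounded_iff by auto
  then show ?thesis using f w by (intro L2_mult continuous_on_measurable_M01) auto
qed

section \<open>Equality almost everywhere and passage to classes\<close>

lemma eq01_refl [simp]: "eq01 u u" by (simp add: eq01_def)

lemma eq01_sym: "eq01 u w \<Longrightarrow> eq01 w u" by (auto simp: eq01_def)

lemma eq01_trans: "eq01 u v \<Longrightarrow> eq01 v w \<Longrightarrow> eq01 u w"
  unfolding eq01_def by (erule (1) eventually_elim2) simp

lemma eq01I: "(\<And>x. x \<in> {0..1} \<Longrightarrow> u x = w x) \<Longrightarrow> eq01 u w"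
  by (auto simp: eq01_def space_M01 intro!: AE_I2)

lemma eq01_comp2: "eq01 u u' \<Longrightarrow> eq01 w w' \<Longrightarrow> eq01 (\<lambda>x. f x (u x) (w x)) (\<lambda>x. f x (u' x) (w' x))"
  unfolding eq01_def by (erule (1) eventually_elim2) simp

lemma eq01_comp: "eq01 u u' \<Longrightarrow> eq01 (\<lambda>x. f x (u x)) (\<lambda>x. f x (u' x))"
  unfolding eq01_def by (erule eventually_mono) simp

lemma eq01_integral:
  assumes "eq01 u w" "u \<in> borel_measurable M01" "w \<in> borel_measurable M01"
  shows "(\<integral>x. u x \<partial>M01) = (\<integral>x. w x \<partial>M01)"
  using assms unfolding eq01_def by (intro integral_cong_AE) auto

\<comment> \<open>A type rather than a set of functions is needed to instantiate
  \<open>real_inner\<close> and \<open>banach\<close>. The relation is partial: functions outside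
  \<open>L2\<close> have no class.\<close>
quotient_type l2 = "real \<Rightarrow> complex" / partial: "\<lambda>u w. u \<in> L2 \<and> w \<in> L2 \<and> eq01 u w"
proof (rule part_equivpI)
  show "\<exists>x. x \<in> L2 \<and> x \<in> L2 \<and> eq01 x x" using L2_zero by auto
qed (auto simp: symp_def transp_def intro: eq01_sym eq01_trans)

abbreviation cl :: "(real \<Rightarrow> complex) \<Rightarrow> l2" where "cl \<equiv> abs_l2"

lemma cl_eq_iff: "u \<in> L2 \<Longrightarrow> w \<in> L2 \<Longrightarrow> cl u = cl w \<longleftrightarrow> eq01 u w"
  using Quotient3_rel[OF Quotient3_l2, of u w] by simp

lemma cl_cases: obtains u where "u \<in> L2" "x = cl u"
  by (metis Quotient3_abs_rep[OF Quotient3_l2] Quotient3_rep_reflp[OF Quotient3_l2])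

text \<open>Only the real structure enters the class: the inner product is the real part of the
  hermitian one. Complex scalars act through \<open>csc\<close>, and the complex bilinear pairing is
  \<open>pr\<close>, both defined below.\<close>

instantiation l2 :: real_inner
begin

lift_definition zero_l2 :: l2 is "\<lambda>_. 0" by (simp add: L2_zero)
lift_definition plus_l2 :: "l2 \<Rightarrow> l2 \<Rightarrow> l2" is "\<lambda>u w x. u x + w x"
  by (auto intro: L2_add eq01_comp2)
lift_definition minus_l2 :: "l2 \<Rightarrow> l2 \<Rightarrow> l2" is "\<lambda>u w x. u x - w x"
  by (auto intro: L2_diff eq01_comp2)
lift_definition uminus_l2 :: "l2 \<Rightarrow> l2" is "\<lambda>u x. - u x"
  by (auto intro: L2_uminus eq01_comp)
lift_definition scaleR_l2 :: "real \<Rightarrow> l2 \<Rightarrow> l2" is "\<lambda>r u x. r *\<^sub>R u x"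
  by (auto intro: L2_scaleR eq01_comp)
lift_definition inner_l2 :: "l2 \<Rightarrow> l2 \<Rightarrow> real" is "\<lambda>u w. Re (\<integral>x. u x * cnj (w x) \<partial>M01)"
proof (intro arg_cong[where f = Re] eq01_integral)
  fix u u' w w' assume "u \<in> L2 \<and> u' \<in> L2 \<and> eq01 u u'" "w \<in> L2 \<and> w' \<in> L2 \<and> eq01 w w'"
  then show "eq01 (\<lambda>x. u x * cnj (w x)) (\<lambda>x. u' x * cnj (w' x))"
    and "(\<lambda>x. u x * cnj (w x)) \<in> borel_measurable M01"
    and "(\<lambda>x. u' x * cnj (w' x)) \<in> borel_measurable M01"
    using L2_measurable[OF L2_cnj] L2_measurable by (auto intro: eq01_comp2)
qed

definition norm_l2 :: "l2 \<Rightarrow> real" where "norm_l2 u = sqrt (inner u u)"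
definition dist_l2 :: "l2 \<Rightarrow> l2 \<Rightarrow> real" where "dist_l2 u w = norm (u - w)"
definition sgn_l2 :: "l2 \<Rightarrow> l2" where "sgn_l2 u = inverse (norm u) *\<^sub>R u"
definition uniformity_l2 :: "(l2 \<times> l2) filter" where
  "uniformity_l2 = (INF e\<in>{0<..}. principal {(x, y). dist x y < e})"
definition open_l2 :: "l2 set \<Rightarrow> bool" where
  "open_l2 U = (\<forall>x\<in>U. eventually (\<lambda>(x', y). x' = x \<longrightarrow> y \<in> U) uniformity)"

lemma L2_inner_integrable: "u \<in> L2 \<Longrightarrow> w \<in> L2 \<Longrightarrow> integrable M01 (\<lambda>x. u x * cnj (w x))"
  by (intro L2_prod_integrable L2_cnj)

lemma inner_l2_self: "u \<in> L2 \<Longrightarrow> Re (\<integral>x. u x * cnj (u x) \<partial>M01) = (\<integral>x. (cmod (u x))\<^sup>2 \<partial>M01)"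
  using L2_inner_integrable[of u u] by (simp add: complex_norm_square[symmetric] flip: integral_Re)

instance
proof
  fix u w v :: l2 and r s :: real
  show "u + w + v = u + (w + v)" by transfer (auto intro!: L2_add eq01I)
  show "u + w = w + u" by transfer (auto intro!: L2_add eq01I)
  show "0 + u = u" by transfer auto
  show "- u + u = 0" by transfer (auto intro!: L2_zero)
  show "u - w = u + - w" by transfer (auto intro!: L2_diff)
  show "r *\<^sub>R (u + w) = r *\<^sub>R u + r *\<^sub>R w"
    by transfer (auto intro!: L2_add L2_scaleR eq01I simp: algebra_simps)
  show "(r + s) *\<^sub>R u = r *\<^sub>R u + s *\<^sub>R u"
    by transfer (auto intro!: L2_add L2_scaleR eq01I simp: algebra_simps)
  show "r *\<^sub>R s *\<^sub>R u = (r * s) *\<^sub>R u" by transfer (auto intro!: L2_scaleR)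
  show "1 *\<^sub>R u = u" by transfer auto
  show "dist u w = norm (u - w)" by (rule dist_l2_def)
  show "sgn u = inverse (norm u) *\<^sub>R u" by (rule sgn_l2_def)
  show "(uniformity :: (l2 \<times> l2) filter) = (INF e\<in>{0<..}. principal {(x, y). dist x y < e})"
    by (rule uniformity_l2_def)
  show "\<And>U. open U \<longleftrightarrow> (\<forall>x\<in>U. \<forall>\<^sub>F (x' :: l2, y) in uniformity. x' = x \<longrightarrow> y \<in> U)"
    by (rule open_l2_def)
  show "norm u = sqrt (inner u u)" by (rule norm_l2_def)
  show "inner u w = inner w u"
  proof transfer
    fix u w :: "real \<Rightarrow> complex" 
    have "(\<integral>x. w x * cnj (u x) \<partial>M01) = cnj (\<integral>x. u x * cnj (w x) \<partial>M01)"
      by (subst Bochner_Integration.integral_cnj[symmetric]) (simp add: mult.commute)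
    then show "Re (\<integral>x. u x * cnj (w x) \<partial>M01) = Re (\<integral>x. w x * cnj (u x) \<partial>M01)" by simp
  qed
  show "inner (u + w) v = inner u v + inner w v"
    by transfer (simp add: distrib_right L2_inner_integrable)
  show "inner (r *\<^sub>R u) w = r * inner u w" by transfer (simp add: L2_inner_integrable)
  show "0 \<le> inner u u" by transfer (auto simp: inner_l2_self)
  show "inner u u = 0 \<longleftrightarrow> u = 0"
  proof transfer
    fix u assume "u \<in> L2 \<and> u \<in> L2 \<and> eq01 u u"
    then show "(Re (\<integral>x. u x * cnj (u x) \<partial>M01) = 0) = (u \<in> L2 \<and> (\<lambda>_. 0) \<in> L2 \<and> eq01 u (\<lambda>_. 0))"
      using integral_nonneg_eq_0_iff_AE[OF L2_square_integrable, of u]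
      by (simp add: inner_l2_self L2_zero eq01_def)
  qed
qed

end

lemma cl_zero: "cl (\<lambda>_. 0) = 0" by (simp add: zero_l2_def)
lemma cl_add: "u \<in> L2 \<Longrightarrow> w \<in> L2 \<Longrightarrow> cl (\<lambda>x. u x + w x) = cl u + cl w"
  by (simp add: plus_l2.abs_eq)
lemma cl_diff: "u \<in> L2 \<Longrightarrow> w \<in> L2 \<Longrightarrow> cl (\<lambda>x. u x - w x) = cl u - cl w"
  by (simp add: minus_l2.abs_eq)
lemma cl_uminus: "u \<in> L2 \<Longrightarrow> cl (\<lambda>x. - u x) = - cl u"
  by (simp add: uminus_l2.abs_eq)
lemma cl_scaleR: "u \<in> L2 \<Longrightarrow> cl (\<lambda>x. r *\<^sub>R u x) = r *\<^sub>R cl u"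
  by (simp add: scaleR_l2.abs_eq)
lemma cl_sum: "(\<And>i. i \<in> A \<Longrightarrow> u i \<in> L2) \<Longrightarrow> cl (\<lambda>x. \<Sum>i\<in>A. u i x) = (\<Sum>i\<in>A. cl (u i))"
  by (induction A rule: infinite_finite_induct) (auto simp: cl_zero cl_add L2_sum)
lemma inner_cl: "u \<in> L2 \<Longrightarrow> w \<in> L2 \<Longrightarrow> inner (cl u) (cl w) = Re (\<integral>x. u x * cnj (w x) \<partial>M01)"
  by (simp add: inner_l2.abs_eq)
lemma norm_cl: "u \<in> L2 \<Longrightarrow> norm (cl u) = L2_norm u"
  by (simp add: norm_eq_sqrt_inner inner_cl inner_l2_self L2_norm_def)

lemma norm_cl_square: "u \<in> L2 \<Longrightarrow> (norm (cl u))\<^sup>2 = (\<integral>x. (cmod (u x))\<^sup>2 \<partial>M01)"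
  by (simp add: norm_cl L2_norm_def)

lemma cl_eqI: "u \<in> L2 \<Longrightarrow> (\<And>x. x \<in> {0..1} \<Longrightarrow> u x = w x) \<Longrightarrow> cl u = cl w"
proof -
  assume u: "u \<in> L2" and eq: "\<And>x. x \<in> {0..1} \<Longrightarrow> u x = w x"
  have "w \<in> borel_measurable M01"
    using L2_measurable[OF u] by (rule measurable_cong[THEN iffD1, rotated]) (simp add: space_M01 eq)
  then have "w \<in> L2" by (rule L2_dominated[OF _ u, where c = 1]) (simp add: eq)
  with u show ?thesis by (simp add: cl_eq_iff) (rule eq01I, simp add: eq)
qed

lemma norm_cl_le:
  assumes "f \<in> borel_measurable M01" "\<And>x. x \<in> {0..1} \<Longrightarrow> cmod (f x) \<le> c * cmod (w x)" "w \<in> L2" "0 \<le> c"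
  shows "norm (cl f) \<le> c * norm (cl w)"
proof -
  have f: "f \<in> L2" by (rule L2_dominated[OF assms(1,3,2)])
  have "(norm (cl f))\<^sup>2 \<le> (\<integral>x. c\<^sup>2 * (cmod (w x))\<^sup>2 \<partial>M01)"
    unfolding norm_cl_square[OF f]
  proof (rule integral_mono)
    fix x assume "x \<in> space M01"
    then have "cmod (f x) \<le> c * cmod (w x)" using assms(2) by (simp add: space_M01)
    then have "(cmod (f x))\<^sup>2 \<le> (c * cmod (w x))\<^sup>2" by (intro power_mono) auto
    then show "(cmod (f x))\<^sup>2 \<le> c\<^sup>2 * (cmod (w x))\<^sup>2" by (simp add: power_mult_distrib)
  qed (use f assms(3) in \<open>auto intro: L2_square_integrable\<close>)
  also have "\<dots> = (c * norm (cl w))\<^sup>2"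
    by (simp add: power_mult_distrib norm_cl_square[OF assms(3)])
  finally show ?thesis using assms(4) by (auto intro: power2_le_imp_le)
qed

lemma norm_cl_le_const:
  assumes "f \<in> borel_measurable M01" "\<And>x. x \<in> {0..1} \<Longrightarrow> cmod (f x) \<le> c" "0 \<le> c"
  shows "norm (cl f) \<le> c"
proof -
  have "(\<lambda>_. 1) \<in> L2" by (rule L2_continuous) auto
  moreover have "norm (cl (\<lambda>_. 1)) = 1"
    using \<open>(\<lambda>_. 1) \<in> L2\<close> by (simp add: norm_cl L2_norm_def space_M01 measure_M01)
  ultimately show ?thesis using norm_cl_le[of f c "\<lambda>_. 1"] assms by simp
qed

subsection \<open>Completeness\<close>

text \<open>Cauchy-Schwarz against the constant 1, which has norm 1 on the unit interval. It lets
  the completeness proof sum increments in L^1, where integral and series may be exchanged.\<close>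

lemma nn_integral_norm_le_norm_cl:
  assumes u: "u \<in> L2"
  shows "(\<integral>\<^sup>+x. ennreal (cmod (u x)) \<partial>M01) \<le> ennreal (norm (cl u))"
proof -
  have L: "(\<lambda>x. of_real (cmod (u x))) \<in> L2"
    using L2_measurable[OF u] by (intro L2_dominated[OF _ u, where c = 1]) auto
  have one: "(\<lambda>_. 1) \<in> L2" by (rule L2_continuous) auto
  have n1: "norm (cl (\<lambda>_. 1)) = 1"
    using one by (simp add: norm_cl L2_norm_def space_M01 measure_M01)
  have int: "integrable M01 (\<lambda>x. cmod (u x))"
    using L2_prod_integrable[OF u one] by simp
  have "(\<integral>x. cmod (u x) \<partial>M01) = inner (cl (\<lambda>x. of_real (cmod (u x)))) (cl (\<lambda>_. 1))"
    using int by (simp add: inner_cl L one)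
  also have "\<dots> \<le> norm (cl (\<lambda>x. of_real (cmod (u x)))) * norm (cl (\<lambda>_. 1))"
    by (rule norm_cauchy_schwarz)
  also have "\<dots> = norm (cl u)" by (simp add: n1 norm_cl L u L2_norm_def)
  finally show ?thesis using int by (simp add: nn_integral_eq_integral)
qed

text \<open>The Riesz-Fischer argument: along a subsequence with geometrically small increments the
  representatives converge almost everywhere, and Fatou's lemma shows that the pointwise limit is
  also the limit in norm.\<close>

instance l2 :: banach
proof
  fix X :: "nat \<Rightarrow> l2"
  assume X: "Cauchy X"
  have "\<exists>r. strict_mono r \<and> (\<forall>n. norm (X (r (Suc n)) - X (r n)) < (1/2) ^ n)"
  proof -
    from X have "\<forall>n. \<exists>M. \<forall>m\<ge>M. \<forall>k\<ge>M. norm (X m - X k) < (1/2) ^ n"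
      unfolding Cauchy_iff by simp
    then obtain M where M: "\<And>n m k. m \<ge> M n \<Longrightarrow> k \<ge> M n \<Longrightarrow> norm (X m - X k) < (1/2) ^ n"
      by metis
    \<comment> \<open>The sum dominates each \<open>M n\<close>, and the summand n makes the
      subsequence strictly increasing even where M vanishes.\<close>
    define r where "r n = (\<Sum>i\<le>n. M i) + n" for n
    have "r n < r (Suc n)" for n by (simp add: r_def)
    then have "strict_mono r" by (rule strict_mono_Suc_iff[THEN iffD2, rule_format])
    moreover have ge: "M n \<le> r n" for n
      unfolding r_def by (rule trans_le_add1) (rule member_le_sum, auto)
    have "M n \<le> r (Suc n)" for n
      using ge[of n] \<open>strict_mono r\<close> by (meson lessI less_imp_le order_trans strict_mono_def)
    ultimately show ?thesis using M ge by blast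
  qed
  then obtain r where r: "strict_mono r"
    and lt: "\<And>n. norm (X (r (Suc n)) - X (r n)) < (1/2) ^ n" by auto
  have "\<forall>n. \<exists>u. u \<in> L2 \<and> X (r n) = cl u" by (metis cl_cases)
  then obtain f where f: "\<And>n. f n \<in> L2" and Xf: "\<And>n. X (r n) = cl (f n)" by metis
  have [measurable]: "f n \<in> borel_measurable M01" for n using f by (rule L2_measurable)
  have "(\<integral>\<^sup>+x. (\<Sum>n. ennreal (cmod (f (Suc n) x - f n x))) \<partial>M01)
      = (\<Sum>n. \<integral>\<^sup>+x. ennreal (cmod (f (Suc n) x - f n x)) \<partial>M01)"
    by (rule nn_integral_suminf) measurable
  also have "\<dots> \<le> (\<Sum>n. ennreal ((1/2) ^ n))"
  proof (rule suminf_le)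
    fix n
    have "(\<integral>\<^sup>+x. ennreal (cmod (f (Suc n) x - f n x)) \<partial>M01) \<le> ennreal (norm (cl (\<lambda>x. f (Suc n) x - f n x)))"
      by (intro nn_integral_norm_le_norm_cl L2_diff f)
    also have "\<dots> \<le> ennreal ((1/2) ^ n)"
      using lt[of n] by (intro ennreal_leI) (simp add: Xf cl_diff f)
    finally show "(\<integral>\<^sup>+x. ennreal (cmod (f (Suc n) x - f n x)) \<partial>M01) \<le> ennreal ((1/2) ^ n)" .
  qed auto
  also have "\<dots> < \<infinity>"
  proof -
    have "(\<Sum>n. ennreal ((1/2) ^ n)) = ennreal (\<Sum>n. (1/2) ^ n)"
      by (rule suminf_ennreal2) (auto intro: summable_geometric)
    then show ?thesis by simp
  qed
  finally have "AE x in M01. (\<Sum>n. ennreal (cmod (f (Suc n) x - f n x))) \<noteq> \<infinity>"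
    by (intro nn_integral_PInf_AE) auto
  then have AEconv: "AE x in M01. convergent (\<lambda>n. f n x)"
  proof eventually_elim
    fix x assume "(\<Sum>n. ennreal (cmod (f (Suc n) x - f n x))) \<noteq> \<infinity>"
    then have "summable (\<lambda>n. cmod (f (Suc n) x - f n x))"
      by (intro summable_suminf_not_top) auto
    then have "summable (\<lambda>n. f (Suc n) x - f n x)" by (rule summable_norm_cancel)
    then have "convergent (\<lambda>n. \<Sum>i<n. f (Suc i) x - f i x)" by (simp add: summable_iff_convergent)
    moreover have "(\<Sum>i<n. f (Suc i) x - f i x) = f n x - f 0 x" for n by (rule sum_lessThan_telescope)
    ultimately show "convergent (\<lambda>n. f n x)" by (simp add: convergent_diff_const_right_iff)
  qed
  define g where "g x = lim (\<lambda>n. f n x)" for x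
  have [measurable]: "g \<in> borel_measurable M01" unfolding g_def by measurable
  have AElim: "AE x in M01. (\<lambda>n. f n x) \<longlonglongrightarrow> g x"
    using AEconv by eventually_elim (simp add: g_def convergent_LIMSEQ_iff)
  \<comment> \<open>Used twice: with bound 1 for the membership of the limit in \<open>L2\<close>,
    and with bound e / 3 for the convergence of the whole sequence.\<close>
  have fatou: "(\<integral>\<^sup>+x. ennreal ((cmod (g x - f n x))\<^sup>2) \<partial>M01) \<le> ennreal (e\<^sup>2)"
    if e: "\<And>m. m \<ge> n \<Longrightarrow> norm (X (r m) - X (r n)) \<le> e" for n e
  proof -
    have "(\<integral>\<^sup>+x. ennreal ((cmod (g x - f n x))\<^sup>2) \<partial>M01)
        = (\<integral>\<^sup>+x. liminf (\<lambda>m. ennreal ((cmod (f m x - f n x))\<^sup>2)) \<partial>M01)"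
    proof (rule nn_integral_cong_AE)
      show "AE x in M01. ennreal ((cmod (g x - f n x))\<^sup>2) = liminf (\<lambda>m. ennreal ((cmod (f m x - f n x))\<^sup>2))"
        using AElim
      proof eventually_elim
        fix x assume "(\<lambda>n. f n x) \<longlonglongrightarrow> g x"
        then have "(\<lambda>m. ennreal ((cmod (f m x - f n x))\<^sup>2)) \<longlonglongrightarrow> ennreal ((cmod (g x - f n x))\<^sup>2)"
          by (intro tendsto_intros)
        then show "ennreal ((cmod (g x - f n x))\<^sup>2) = liminf (\<lambda>m. ennreal ((cmod (f m x - f n x))\<^sup>2))"
          by (intro lim_imp_Liminf[symmetric]) (auto intro: tendsto_ennrealI)
      qed
    qed
    also have "\<dots> \<le> liminf (\<lambda>m. \<integral>\<^sup>+x. ennreal ((cmod (f m x - f n x))\<^sup>2) \<partial>M01)"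
      by (rule nn_integral_liminf) measurable
    also have "\<dots> \<le> ennreal (e\<^sup>2)"
    proof (rule Liminf_le)
      show "sequentially \<noteq> bot" by simp
      show "\<forall>\<^sub>F m in sequentially. (\<integral>\<^sup>+x. ennreal ((cmod (f m x - f n x))\<^sup>2) \<partial>M01) \<le> ennreal (e\<^sup>2)"
        using eventually_ge_at_top[of n]
      proof eventually_elim
        fix m assume "m \<ge> n"
        have d: "(\<lambda>x. f m x - f n x) \<in> L2" by (intro L2_diff f)
        have "(\<integral>\<^sup>+x. ennreal ((cmod (f m x - f n x))\<^sup>2) \<partial>M01) = ennreal ((norm (X (r m) - X (r n)))\<^sup>2)"
          using nn_integral_eq_integral[OF L2_square_integrable[OF d]] norm_cl_square[OF d]
          by (simp add: Xf cl_diff f)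
        also have "\<dots> \<le> ennreal (e\<^sup>2)"
          using e[OF \<open>m \<ge> n\<close>] by (intro ennreal_leI power_mono) auto
        finally show "(\<integral>\<^sup>+x. ennreal ((cmod (f m x - f n x))\<^sup>2) \<partial>M01) \<le> ennreal (e\<^sup>2)" .
      qed
    qed
    finally show ?thesis .
  qed
  have Xr: "\<exists>N. \<forall>n\<ge>N. \<forall>m\<ge>N. norm (X m - X n) \<le> e" if "e > 0" for e
    using X that unfolding Cauchy_iff by (meson less_imp_le)
  have r_ge: "n \<le> r n" for n using r by (rule seq_suble)
  obtain N1 where N1: "\<And>n m. n \<ge> N1 \<Longrightarrow> m \<ge> N1 \<Longrightarrow> norm (X m - X n) \<le> 1"
    using Xr[of 1] by auto
  have gL: "g \<in> L2"
  proof -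
    have "(\<integral>\<^sup>+x. ennreal ((cmod (g x - f N1 x))\<^sup>2) \<partial>M01) \<le> ennreal (1\<^sup>2)"
      using r_ge by (intro fatou N1) (meson order_trans)+
    then have "(\<integral>\<^sup>+x. ennreal ((cmod (g x - f N1 x))\<^sup>2) \<partial>M01) < \<infinity>"
      by (rule order_le_less_trans) simp
    then have "integrable M01 (\<lambda>x. (cmod (g x - f N1 x))\<^sup>2)"
      by (intro integrableI_nonneg) auto
    then have "(\<lambda>x. g x - f N1 x) \<in> L2" by (intro L2_I) auto
    from L2_add[OF this f[of N1]] show ?thesis by simp
  qed
  have "X \<longlonglongrightarrow> cl g"
  proof (rule LIMSEQ_I)
    fix e :: real assume "e > 0"
    then obtain N where N: "\<And>n m. n \<ge> N \<Longrightarrow> m \<ge> N \<Longrightarrow> norm (X m - X n) \<le> e / 3"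
      using Xr[of "e / 3"] by auto
    have d: "(\<lambda>x. g x - f N x) \<in> L2" by (intro L2_diff f gL)
    have "(\<integral>\<^sup>+x. ennreal ((cmod (g x - f N x))\<^sup>2) \<partial>M01) \<le> ennreal ((e / 3)\<^sup>2)"
      using r_ge by (intro fatou N) (meson order_trans)+
    then have "ennreal ((norm (cl g - X (r N)))\<^sup>2) \<le> ennreal ((e / 3)\<^sup>2)"
      using nn_integral_eq_integral[OF L2_square_integrable[OF d]] norm_cl_square[OF d]
      by (simp add: Xf cl_diff f gL)
    then have "(norm (cl g - X (r N)))\<^sup>2 \<le> (e / 3)\<^sup>2" by (simp add: ennreal_le_iff)
    then have 1: "norm (cl g - X (r N)) \<le> e / 3" using \<open>e > 0\<close> by (auto intro: power2_le_imp_le)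
    have "norm (X n - cl g) < e" if "n \<ge> N" for n
    proof -
      have "norm (X n - cl g) \<le> norm (X n - X (r N)) + norm (cl g - X (r N))"
        by (metis norm_minus_commute norm_triangle_sub diff_add_cancel norm_triangle_ineq add_diff_eq diff_diff_eq2 norm_diff_triangle_ineq norm_diff_triangle_le order_refl)
      also have "\<dots> \<le> e / 3 + e / 3" using 1 N[of "r N" n] r_ge[of N] that by (intro add_mono) auto
      finally show ?thesis using \<open>e > 0\<close> by linarith
    qed
    then show "\<exists>no. \<forall>n\<ge>no. norm (X n - cl g) < e" by blast
  qed
  then show "convergent X" by (auto simp: convergent_def)
qed

subsection \<open>Multiplication, conjugation and the bilinear pairing\<close>

text \<open>No conjugation, so that weak derivatives and integration by parts are stated without
  complex conjugates; the inner product is recovered by \<open>inner_eq_pr\<close>.\<close>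

lift_definition pr :: "l2 \<Rightarrow> l2 \<Rightarrow> complex" is "\<lambda>u w. \<integral>x. u x * w x \<partial>M01"
proof (intro eq01_integral)
  fix u u' w w' assume "u \<in> L2 \<and> u' \<in> L2 \<and> eq01 u u'" "w \<in> L2 \<and> w' \<in> L2 \<and> eq01 w w'"
  then show "eq01 (\<lambda>x. u x * w x) (\<lambda>x. u' x * w' x)"
    and "(\<lambda>x. u x * w x) \<in> borel_measurable M01"
    and "(\<lambda>x. u' x * w' x) \<in> borel_measurable M01"
    using L2_measurable by (auto intro: eq01_comp2)
qed

lift_definition cj :: "l2 \<Rightarrow> l2" is "\<lambda>u x. cnj (u x)"
  by (auto intro: L2_cnj eq01_comp)

text \<open>The value 0 for a discontinuous multiplier makes \<open>mul f\<close> a bounded linear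
  operator for every f, so that the linearity lemmas carry no side condition.\<close>

lift_definition mul :: "(real \<Rightarrow> complex) \<Rightarrow> l2 \<Rightarrow> l2"
  is "\<lambda>f u x. if continuous_on {0..1} f then f x * u x else 0"
proof -
  fix f u u' assume u: "u \<in> L2 \<and> u' \<in> L2 \<and> eq01 u u'"
  with u show "(\<lambda>x. if continuous_on {0..1} f then f x * u x else 0) \<in> L2 \<and>
     (\<lambda>x. if continuous_on {0..1} f then f x * u' x else 0) \<in> L2 \<and>
     eq01 (\<lambda>x. if continuous_on {0..1} f then f x * u x else 0)
          (\<lambda>x. if continuous_on {0..1} f then f x * u' x else 0)"
    by (cases "continuous_on {0..1} f") (auto simp: L2_zero L2_cont_mult intro: eq01_comp)
qed

abbreviation cst :: "complex \<Rightarrow> l2" where "cst c \<equiv> cl (\<lambda>_. c)"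
abbreviation csc :: "complex \<Rightarrow> l2 \<Rightarrow> l2" where "csc c \<equiv> mul (\<lambda>_. c)"

lemma L2_const: "(\<lambda>_. c) \<in> L2" by (rule L2_continuous) auto

lemma mul_cl: "continuous_on {0..1} f \<Longrightarrow> u \<in> L2 \<Longrightarrow> mul f (cl u) = cl (\<lambda>x. f x * u x)"
  by (simp add: mul.abs_eq)

lemma pr_cl: "u \<in> L2 \<Longrightarrow> w \<in> L2 \<Longrightarrow> pr (cl u) (cl w) = (\<integral>x. u x * w x \<partial>M01)"
  by (simp add: pr.abs_eq)

lemma cj_cl: "u \<in> L2 \<Longrightarrow> cj (cl u) = cl (\<lambda>x. cnj (u x))"
  by (simp add: cj.abs_eq)

lemma cj_cj [simp]: "cj (cj u) = u"
  by (cases u rule: cl_cases) (simp add: cj_cl L2_cnj)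

lemma norm_cj [simp]: "norm (cj u) = norm u"
  by (cases u rule: cl_cases) (simp add: cj_cl L2_cnj norm_cl L2_norm_def)

lemma inner_eq_pr: "inner u w = Re (pr u (cj w))"
  by (cases u rule: cl_cases, cases w rule: cl_cases) (simp add: cj_cl pr_cl L2_cnj inner_cl)

lemma pr_sym: "pr u w = pr w u"
  by (cases u rule: cl_cases, cases w rule: cl_cases) (simp add: pr_cl mult.commute)

lemma mul_mul:
  assumes "continuous_on {0..1} f" "continuous_on {0..1} g"
  shows "mul f (mul g u) = mul (\<lambda>x. f x * g x) u"
  by (cases u rule: cl_cases)
     (simp add: mul_cl assms L2_cont_mult continuous_on_mult mult.assoc)

lemma pr_mul: "pr (mul f u) w = pr u (mul f w)"
proof (cases "continuous_on {0..1} f")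
  case True
  then show ?thesis
    by (cases u rule: cl_cases, cases w rule: cl_cases)
       (simp add: mul_cl pr_cl L2_cont_mult mult.assoc mult.left_commute)
next
  case False
  then show ?thesis
    by (cases u rule: cl_cases, cases w rule: cl_cases)
       (simp add: mul.abs_eq pr_cl L2_zero)
qed

lemma mul_bound: obtains K where "K \<ge> 0" "\<And>u. norm (mul f u) \<le> K * norm u"
proof (cases "continuous_on {0..1} f")
  case True
  have "bounded (f ` {0..1})" by (intro compact_imp_bounded compact_continuous_image True) auto
  then obtain c where c: "\<forall>x\<in>{0..1}. cmod (f x) \<le> c" unfolding bounded_iff by auto
  then have "c \<ge> 0" by (metis atLeastAtMost_iff norm_ge_zero order_trans zero_le_one order_refl)
  moreover have "norm (mul f u) \<le> c * norm u" for u
  proof (cases u rule: cl_cases)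
    case (1 w)
    then show ?thesis using c \<open>c \<ge> 0\<close>
      by (auto simp: mul_cl True norm_mult L2_cont_mult intro!: norm_cl_le L2_measurable mult_right_mono)
  qed
  ultimately show thesis using that by blast
next
  case False
  have "norm (mul f u) \<le> 0 * norm u" for u
    by (cases u rule: cl_cases) (simp add: mul.abs_eq False cl_zero)
  then show thesis using that[of 0] by blast
qed

lemma bounded_linear_mul [bounded_linear]: "bounded_linear (mul f)"
proof -
  obtain K where K: "\<And>u. norm (mul f u) \<le> K * norm u" using mul_bound by blast
  show ?thesis
  proof (rule bounded_linear_intro[where K = K])
    fix u w r
    show "mul f (u + w) = mul f u + mul f w"
      by (cases "continuous_on {0..1} f"; cases u rule: cl_cases; cases w rule: cl_cases)
         (simp_all add: mul.abs_eq L2_add distrib_left L2_cont_mult cl_zero flip: cl_add)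
    show "mul f (r *\<^sub>R u) = r *\<^sub>R mul f u"
      by (cases "continuous_on {0..1} f"; cases u rule: cl_cases)
         (simp_all add: mul.abs_eq L2_scaleR L2_cont_mult cl_zero flip: cl_scaleR)
    show "norm (mul f u) \<le> norm u * K" using K[of u] by (simp add: mult.commute)
  qed
qed

lemmas mul_add = linear_add[OF bounded_linear.linear[OF bounded_linear_mul]]
lemmas mul_diff = linear_diff[OF bounded_linear.linear[OF bounded_linear_mul]]
lemmas mul_scaleR = linear_scale[OF bounded_linear.linear[OF bounded_linear_mul]]

lemma mul_eq_0 [simp]: "mul (\<lambda>_. 0) u = 0"
  by (cases u rule: cl_cases) (simp add: mul_cl cl_zero)

lemma mul_1 [simp]: "mul (\<lambda>_. 1) u = u"
  by (cases u rule: cl_cases) (simp add: mul_cl)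

lemma mul_plus: "continuous_on {0..1} f \<Longrightarrow> continuous_on {0..1} g \<Longrightarrow> mul (\<lambda>x. f x + g x) u = mul f u + mul g u"
  by (cases u rule: cl_cases)
     (simp add: mul_cl continuous_on_add distrib_right L2_cont_mult flip: cl_add)

lemma csc_of_real: "csc (of_real r) u = r *\<^sub>R u"
  by (cases u rule: cl_cases) (simp add: mul_cl scaleR_conv_of_real flip: cl_scaleR)

lemma csc_minus: "csc (- c) u = - csc c u"
  by (cases u rule: cl_cases) (simp add: mul_cl L2_cmult flip: cl_uminus)

lemma csc_add: "csc (a + b) u = csc a u + csc b u" by (simp add: mul_plus)

lemma csc_csc: "csc a (csc b u) = csc (a * b) u" by (simp add: mul_mul)

lemma mul_csc: "mul f (csc c u) = csc c (mul f u)"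
proof (cases "continuous_on {0..1} f")
  case True then show ?thesis by (simp add: mul_mul mult.commute)
next
  case False then show ?thesis
    by (cases u rule: cl_cases) (simp add: mul_cl mul.abs_eq L2_cmult L2_zero)
qed

lemma norm_csc: "norm (csc c u) = cmod c * norm u"
proof -
  have le: "norm (csc c u) \<le> cmod c * norm u" for c u
    by (cases u rule: cl_cases) (auto simp: mul_cl norm_mult L2_cmult intro!: norm_cl_le L2_measurable)
  show ?thesis
  proof (cases "c = 0")
    case False
    have "u = csc (inverse c) (csc c u)" using False by (simp add: csc_csc)
    then have "norm u \<le> cmod (inverse c) * norm (csc c u)" using le by metis
    then have "cmod c * norm u \<le> norm (csc c u)" using False by (simp add: norm_inverse norm_divide field_simps)
    with le show ?thesis by (simp add: antisym)
  qed simp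
qed

lemma csc_inverse: "c \<noteq> 0 \<Longrightarrow> csc (inverse c) (csc c u) = u"
  by (simp add: csc_csc)

lemma pr_csc: "pr (csc c u) w = c * pr u w"
  by (cases u rule: cl_cases, cases w rule: cl_cases)
     (simp add: mul_cl pr_cl L2_cmult mult.assoc)

lemma pr_add_left: "pr (u + v) w = pr u w + pr v w"
  by (cases u rule: cl_cases, cases v rule: cl_cases, cases w rule: cl_cases)
     (simp add: pr_cl L2_add distrib_right L2_prod_integrable flip: cl_add)

text \<open>Rotating u by a unimodular c makes the pairing real and nonnegative, and then the real
  Cauchy-Schwarz inequality applies to the rotated u and the conjugate of w.\<close>

lemma norm_pr_le: "cmod (pr u w) \<le> norm u * norm w"
proof (cases "pr u w = 0")
  case False
  define c where "c = cnj (pr u w) / of_real (cmod (pr u w))"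
  have c: "cmod c = 1" using False by (simp add: c_def norm_divide)
  have "c * pr u w = of_real (cmod (pr u w))"
    using False complex_norm_square[of "pr u w"]
    by (simp add: c_def power2_eq_square mult.commute del: of_real_mult) (simp add: field_simps)
  then have "cmod (pr u w) = Re (pr (csc c u) (cj (cj w)))"
    unfolding cj_cj pr_csc by simp
  also have "\<dots> = inner (csc c u) (cj w)" by (simp add: inner_eq_pr)
  also have "\<dots> \<le> norm (csc c u) * norm (cj w)" by (rule norm_cauchy_schwarz)
  finally show ?thesis by (simp add: norm_csc c)
qed simp

lemma bounded_bilinear_pr: "bounded_bilinear pr"
proof
  fix u v w :: l2 and r :: real
  show "pr (u + v) w = pr u w + pr v w" by (rule pr_add_left)
  show "pr w (u + v) = pr w u + pr w v" by (metis pr_add_left pr_sym)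
  show s: "pr (r *\<^sub>R u) w = r *\<^sub>R pr u w" for u w
    using pr_csc[of "of_real r" u w] by (simp add: csc_of_real scaleR_conv_of_real)
  show "pr u (r *\<^sub>R w) = r *\<^sub>R pr u w" by (metis s pr_sym)
  show "\<exists>K. \<forall>a b. cmod (pr a b) \<le> norm a * norm b * K"
    by (rule exI[of _ 1]) (simp add: norm_pr_le)
qed

interpretation pr: bounded_bilinear pr by (rule bounded_bilinear_pr)

lemma bounded_linear_cj [bounded_linear]: "bounded_linear cj"
  by (rule bounded_linear_intro[where K = 1]; transfer?)
     (auto simp: L2_cnj L2_add L2_scaleR norm_cj)

lemma pr_cj_self: "pr u (cj u) = of_real ((norm u)\<^sup>2)"
proof (cases u rule: cl_cases)
  case (1 f)
  have "pr u (cj u) = (\<integral>x. of_real ((cmod (f x))\<^sup>2) \<partial>M01)"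
    unfolding 1 by (simp only: cj_cl[OF 1(1)] pr_cl[OF 1(1) L2_cnj[OF 1(1)]] complex_norm_square)
  then show ?thesis using 1 norm_cl_square[OF 1(1)] by (simp del: of_real_power)
qed

lemma cj_mul: "continuous_on {0..1} f \<Longrightarrow> cj (mul f u) = mul (\<lambda>x. cnj (f x)) (cj u)"
  by (cases u rule: cl_cases) (simp add: mul_cl cj_cl L2_cont_mult L2_cnj continuous_on_cnj)

subsection \<open>Density of continuous functions\<close>

text \<open>Dominated convergence for classes; the squared difference is bounded by 4 |w|^2,
  integrable since w lies in \<open>L2\<close>.\<close>

lemma cl_tendsto_dominated:
  assumes "\<And>n. f n \<in> borel_measurable M01" "g \<in> borel_measurable M01" "w \<in> L2"
    and "\<And>n x. x \<in> {0..1} \<Longrightarrow> cmod (f n x) \<le> cmod (w x)"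
    and "AE x in M01. (\<lambda>n. f n x) \<longlonglongrightarrow> g x"
  shows "(\<lambda>n. cl (f n)) \<longlonglongrightarrow> cl g"
proof -
  have [measurable]: "f n \<in> borel_measurable M01" "g \<in> borel_measurable M01" for n by fact+
  have AEg: "AE x in M01. cmod (g x) \<le> cmod (w x)"
    using assms(5) AE_space
  proof eventually_elim
    fix x assume "(\<lambda>n. f n x) \<longlonglongrightarrow> g x" "x \<in> space M01"
    then show "cmod (g x) \<le> cmod (w x)"
      by (intro Lim_bounded[OF tendsto_norm, where M = 0]) (auto simp: assms(4) space_M01)
  qed
  have f: "f n \<in> L2" for n by (rule L2_dominated[OF _ assms(3), where c = 1]) (simp_all add: assms(4))
  have intw: "integrable M01 (\<lambda>x. 4 * (cmod (w x))\<^sup>2)" using L2_square_integrable[OF assms(3)] by simp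
  have g: "g \<in> L2"
  proof (rule L2_I)
    show "integrable M01 (\<lambda>x. (cmod (g x))\<^sup>2)"
    proof (rule Bochner_Integration.integrable_bound[OF L2_square_integrable[OF assms(3)]])
      show "AE x in M01. norm ((cmod (g x))\<^sup>2) \<le> norm ((cmod (w x))\<^sup>2)"
        using AEg by eventually_elim (auto intro: power_mono)
    qed measurable
  qed fact
  have "(\<lambda>n. \<integral>x. (cmod (f n x - g x))\<^sup>2 \<partial>M01) \<longlonglongrightarrow> (\<integral>x. 0 \<partial>M01)"
  proof (rule integral_dominated_convergence[OF _ _ intw])
    show "AE x in M01. (\<lambda>n. (cmod (f n x - g x))\<^sup>2) \<longlonglongrightarrow> 0"
      using assms(5)
    proof eventually_elim
      fix x assume "(\<lambda>n. f n x) \<longlonglongrightarrow> g x"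
      then have "(\<lambda>n. (cmod (f n x - g x))\<^sup>2) \<longlonglongrightarrow> (cmod (g x - g x))\<^sup>2" by (intro tendsto_intros)
      then show "(\<lambda>n. (cmod (f n x - g x))\<^sup>2) \<longlonglongrightarrow> 0" by simp
    qed
    show "AE x in M01. norm ((cmod (f n x - g x))\<^sup>2) \<le> 4 * (cmod (w x))\<^sup>2" for n
      using AEg AE_space
    proof eventually_elim
      fix x assume "cmod (g x) \<le> cmod (w x)" "x \<in> space M01"
      then have "cmod (f n x - g x) \<le> 2 * cmod (w x)"
        using norm_triangle_ineq4[of "f n x" "g x"] assms(4)[of x n] by (simp add: space_M01)
      then have "(cmod (f n x - g x))\<^sup>2 \<le> (2 * cmod (w x))\<^sup>2" by (intro power_mono) auto
      then show "norm ((cmod (f n x - g x))\<^sup>2) \<le> 4 * (cmod (w x))\<^sup>2" by (simp add: power_mult_distrib)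
    qed
  qed measurable
  then have "(\<lambda>n. (norm (cl (f n) - cl g))\<^sup>2) \<longlonglongrightarrow> 0"
    by (simp add: norm_cl_square L2_diff f g flip: cl_diff)
  then have "(\<lambda>n. sqrt ((norm (cl (f n) - cl g))\<^sup>2)) \<longlonglongrightarrow> sqrt 0" by (rule tendsto_real_sqrt)
  then show ?thesis by (simp add: LIM_zero_cancel tendsto_norm_zero_iff)
qed

text \<open>A Lebesgue measurable function is an almost everywhere limit of continuous functions.
  For bounded u, projecting these to a ball keeps them continuous and gives the uniform bound needed
  for dominated convergence. Unbounded functions are reached by truncation.\<close>

lemma closure_continuous: "closure (cl ` {f. continuous_on UNIV f}) = UNIV"
proof -
  let ?C = "closure (cl ` {f. continuous_on UNIV f})"
  have bdd: "cl u \<in> ?C" if u: "u \<in> borel_measurable M01" and bound: "\<And>x. x \<in> {0..1} \<Longrightarrow> cmod (u x) \<le> K" for u K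
  proof -
    have K: "K \<ge> 0" using order_trans[OF norm_ge_zero bound[of 0]] by simp
    \<comment> \<open>Extension by zero turns measurability on the interval into measurability on
      the line.\<close>
    define w where "w x = indicator {0..1} x *\<^sub>R u x" for x :: real
    have "w \<in> borel_measurable lborel"
      using u unfolding w_def by (subst (asm) borel_measurable_restrict_space_iff) auto
    then have "w \<in> borel_measurable lebesgue" by (rule measurable_completion)
    then have "w measurable_on UNIV"
      by (intro lebesgue_measurable_imp_measurable_on) (simp_all add: lebesgue_on_UNIV_eq)
    then obtain N g where N: "negligible N" and g: "\<And>n. continuous_on UNIV (g n)"
      and lim: "\<And>x. x \<notin> N \<Longrightarrow> (\<lambda>n. g n x) \<longlonglongrightarrow> (if x \<in> UNIV then w x else 0)"
      unfolding measurable_on_def by metis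
    define h where "h n x = closest_point (cball 0 K) (g n x)" for n x
    have clo: "continuous_on UNIV (closest_point (cball (0 :: complex) K))"
      using K by (intro continuous_on_closest_point) auto
    have h: "continuous_on UNIV (h n)" for n
      unfolding h_def by (rule continuous_on_compose2[OF clo g]) auto
    have hK: "cmod (h n x) \<le> K" for n x
      using closest_point_in_set[of "cball (0 :: complex) K" "g n x"] K by (simp add: h_def)
    have "AE x in lebesgue. x \<notin> N" using N by (simp add: negligible_iff_null_sets AE_not_in)
    then have "AE x in lborel. x \<notin> N" by (simp add: AE_completion_iff)
    then have AEN: "AE x in M01. x \<notin> N" by (subst AE_restrict_space_iff) auto
    have "(\<lambda>n. cl (h n)) \<longlonglongrightarrow> cl u"
    proof (rule cl_tendsto_dominated[where w = "\<lambda>_. of_real K"])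
      show "h n \<in> borel_measurable M01" for n
        by (intro continuous_on_measurable_M01 continuous_on_subset[OF h]) auto
      show "(\<lambda>_. complex_of_real K) \<in> L2" by (rule L2_const)
      show "cmod (h n x) \<le> cmod (complex_of_real K)" for n x using hK K by simp
      show "AE x in M01. (\<lambda>n. h n x) \<longlonglongrightarrow> u x"
        using AEN AE_space
      proof eventually_elim
        fix x assume "x \<notin> N" "x \<in> space M01"
        then have "(\<lambda>n. g n x) \<longlonglongrightarrow> u x" "cmod (u x) \<le> K"
          using lim[of x] bound[of x] by (auto simp: w_def space_M01)
        from this(1) have "(\<lambda>n. h n x) \<longlonglongrightarrow> closest_point (cball 0 K) (u x)"
          unfolding h_def
        proof (rule isCont_tendsto_compose[rotated])
          show "isCont (closest_point (cball (0 :: complex) K)) (u x)"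
            using clo by (simp add: continuous_on_eq_continuous_at)
        qed
        then show "(\<lambda>n. h n x) \<longlonglongrightarrow> u x" using \<open>cmod (u x) \<le> K\<close> by (simp add: closest_point_self)
      qed
    qed (rule u)
    then show ?thesis using h unfolding closure_sequential by (intro exI[of _ "\<lambda>n. cl (h n)"]) auto
  qed
  have "x \<in> ?C" for x
  proof (cases x rule: cl_cases)
    case (1 u)
    have [measurable]: "u \<in> borel_measurable M01" using 1(1) by (rule L2_measurable)
    define f where "f n x = (if cmod (u x) \<le> real n then u x else 0)" for n x
    have fm: "f n \<in> borel_measurable M01" for n unfolding f_def by measurable
    have "(\<lambda>n. cl (f n)) \<longlonglongrightarrow> cl u"
    proof (rule cl_tendsto_dominated[where w = u])
      show "AE x in M01. (\<lambda>n. f n x) \<longlonglongrightarrow> u x"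
      proof (rule AE_I2)
        fix x
        have "\<forall>\<^sub>F n in sequentially. f n x = u x"
          using eventually_ge_at_top[of "nat \<lceil>cmod (u x)\<rceil>"]
          by eventually_elim (auto simp: f_def nat_le_iff ceiling_le_iff)
        then show "(\<lambda>n. f n x) \<longlonglongrightarrow> u x" by (rule tendsto_eventually)
      qed
    qed (auto simp: 1 fm f_def)
    moreover have "cl (f n) \<in> ?C" for n
      by (rule bdd[OF fm, of _ "real n"]) (simp add: f_def)
    ultimately show ?thesis unfolding 1 by (metis closed_closure closed_sequentially)
  qed
  then show ?thesis by auto
qed

lemma continuous_dense_eq:
  fixes f g :: "l2 \<Rightarrow> 'b::t2_space"
  assumes "continuous_on UNIV f" "continuous_on UNIV g"
    and "\<And>u. continuous_on UNIV u \<Longrightarrow> f (cl u) = g (cl u)"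
  shows "f w = g w"
proof -
  have "closed {w. f w = g w}" using assms(1,2) by (rule closed_Collect_eq)
  then have "closure (cl ` {f. continuous_on UNIV f}) \<subseteq> {w. f w = g w}"
    by (intro closure_minimal) (auto simp: assms(3))
  then show ?thesis by (auto simp: closure_continuous)
qed

subsection \<open>The primitive vanishing at the origin\<close>

definition ind :: "real \<Rightarrow> l2" where "ind x = cl (\<lambda>z. if z \<le> x then 1 else 0)"

lemma L2_ind: "(\<lambda>z. if z \<le> x then 1 else 0) \<in> L2"
  by (rule L2_bounded[where c = 1]) (auto simp: measurable_cong_sets[OF sets_M01 refl] intro!: measurable_restrict_space1)

lemma ind_1: "ind 1 = cst 1"
  unfolding ind_def by (rule cl_eqI[OF L2_ind]) auto

text \<open>The square root makes every primitive Hoelder continuous of exponent 1/2, which is how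
  \<open>continuous_on_integ\<close> is obtained.\<close>

lemma norm_ind_diff:
  assumes "0 \<le> x" "x \<le> y" "y \<le> 1"
  shows "norm (ind y - ind x) = sqrt (y - x)"
proof -
  have "(norm (ind y - ind x))\<^sup>2 = (\<integral>z. (cmod ((if z \<le> y then 1 else 0) - (if z \<le> x then 1 else 0)))\<^sup>2 \<partial>M01)"
    by (simp only: ind_def cl_diff[OF L2_ind L2_ind, symmetric] norm_cl_square[OF L2_diff[OF L2_ind L2_ind]])
  also have "\<dots> = (\<integral>z. indicator {x<..y} z \<partial>M01)"
    using assms(2) by (intro Bochner_Integration.integral_cong) (auto simp: indicator_def)
  also have "\<dots> = y - x"
  proof -
    have "{x<..y} \<inter> {0..1} = {x<..y}" using assms by auto
    then have "{x<..y} \<subseteq> {0..1}" by blast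
    then show ?thesis using assms by (simp add: measure_restrict_space Int_absorb2)
  qed
  finally show ?thesis by (simp add: real_sqrt_unique)
qed

text \<open>As a pairing with an indicator, the value of a primitive is well defined on classes,
  linear and bounded in g, with no choice of representative. The lower limit 0 is implicit in
  \<open>M01\<close>.\<close>

definition integ :: "l2 \<Rightarrow> real \<Rightarrow> complex" where "integ g x = pr g (ind x)"

lemma norm_ind_le: "norm (ind x) \<le> 1"
  unfolding ind_def by (rule norm_cl_le_const) (auto intro: L2_measurable L2_ind)

lemma norm_integ_le: "cmod (integ g x) \<le> norm g"
  using norm_pr_le[of g "ind x"] mult_left_mono[OF norm_ind_le[of x], of "norm g"]
  by (simp add: integ_def)

lemma integ_add: "integ (g + h) x = integ g x + integ h x" by (simp add: integ_def pr.add_left)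
lemma integ_diff: "integ (g - h) x = integ g x - integ h x" by (simp add: integ_def pr.diff_left)
lemma integ_scaleR: "integ (r *\<^sub>R g) x = r *\<^sub>R integ g x" by (simp add: integ_def pr.scaleR_left)
lemma integ_csc: "integ (csc c g) x = c * integ g x" by (simp add: integ_def pr_csc)

lemma continuous_on_integ: "continuous_on {0..1} (integ g)"
proof -
  have "cmod (integ g y - integ g x) \<le> norm g * sqrt \<bar>y - x\<bar>" if "x \<in> {0..1}" "y \<in> {0..1}" for x y
  proof -
    have "norm (ind y - ind x) = sqrt \<bar>y - x\<bar>"
      using that norm_ind_diff[of x y] norm_ind_diff[of y x]
      by (cases "x \<le> y") (auto simp: norm_minus_commute)
    then show ?thesis using norm_pr_le[of g "ind y - ind x"] by (simp add: integ_def pr.diff_right)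
  qed
  note le = this
  show ?thesis
    unfolding continuous_on_def
  proof
    fix x :: real assume x: "x \<in> {0..1}"
    have "((\<lambda>y. norm g * sqrt \<bar>y - x\<bar>) \<longlongrightarrow> norm g * sqrt \<bar>x - x\<bar>) (at x within {0..1})"
      by (intro tendsto_intros)
    then have "((\<lambda>y. norm g * sqrt \<bar>y - x\<bar>) \<longlongrightarrow> 0) (at x within {0..1})" by simp
    then have "((\<lambda>y. integ g y - integ g x) \<longlongrightarrow> 0) (at x within {0..1})"
    proof (rule Lim_null_comparison[rotated])
      show "\<forall>\<^sub>F y in at x within {0..1}. norm (integ g y - integ g x) \<le> norm g * sqrt \<bar>y - x\<bar>"
        using x le by (auto simp: eventually_at_filter)
    qed
    then show "(integ g \<longlongrightarrow> integ g x) (at x within {0..1})" by (rule LIM_zero_cancel)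
  qed
qed

definition prim :: "l2 \<Rightarrow> l2" where "prim g = cl (integ g)"

lemma L2_integ: "integ g \<in> L2" by (rule L2_continuous[OF continuous_on_integ])

lemma bounded_linear_prim [bounded_linear]: "bounded_linear prim"
proof (rule bounded_linear_intro[where K = 1])
  fix g h r
  show "prim (g + h) = prim g + prim h"
    by (simp add: prim_def integ_add[abs_def] L2_integ flip: cl_add)
  show "prim (r *\<^sub>R g) = r *\<^sub>R prim g"
    by (simp add: prim_def integ_scaleR[abs_def] L2_integ flip: cl_scaleR)
  show "norm (prim g) \<le> norm g * 1"
    unfolding prim_def by (simp add: norm_cl_le_const norm_integ_le L2_measurable L2_integ)
qed

lemmas prim_add = linear_add[OF bounded_linear.linear[OF bounded_linear_prim]]
lemmas prim_diff = linear_diff[OF bounded_linear.linear[OF bounded_linear_prim]]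
lemmas prim_zero = linear_0[OF bounded_linear.linear[OF bounded_linear_prim]]

lemma norm_prim_le: "norm (prim g) \<le> norm g"
  unfolding prim_def by (simp add: norm_cl_le_const norm_integ_le L2_measurable L2_integ)

lemma prim_csc: "prim (csc c g) = csc c (prim g)"
  by (simp add: prim_def integ_csc[abs_def] L2_integ mul_cl)

section \<open>Continuously differentiable functions and the fundamental theorem of calculus on
  classes\<close>

definition C1d :: "(real \<Rightarrow> complex) \<Rightarrow> (real \<Rightarrow> complex) \<Rightarrow> bool" where
  "C1d f f' \<longleftrightarrow> continuous_on {0..1} f' \<and>
     (\<forall>x\<in>{0..1}. (f has_vector_derivative f' x) (at x within {0..1}))"

lemma C1d_continuous: "C1d f f' \<Longrightarrow> continuous_on {0..1} f"
  unfolding C1d_def by (meson continuous_on_vector_derivative)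

lemma C1d_continuous': "C1d f f' \<Longrightarrow> continuous_on {0..1} f'"
  by (simp add: C1d_def)

lemma integ_C1d:
  assumes "C1d F f" "x \<in> {0..1}"
  shows "integ (cl f) x = F x - F 0"
proof -
  have f: "continuous_on {0..1} f" using assms(1) by (simp add: C1d_def)
  have "integ (cl f) x = (\<integral>z. f z * (if z \<le> x then 1 else 0) \<partial>M01)"
    unfolding integ_def ind_def by (rule pr_cl[OF L2_continuous[OF f] L2_ind])
  also have "\<dots> = (\<integral>z. indicator {0..x} z *\<^sub>R f z \<partial>lborel)"
    using assms(2)
    by (subst integral_restrict_space) (auto intro!: Bochner_Integration.integral_cong simp: indicator_def)
  also have "\<dots> = F x - F 0"
  proof (rule integral_FTC_Icc)
    show "(F has_vector_derivative f z) (at z within {0..x})" if "0 \<le> z" "z \<le> x" for z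
    proof (rule has_vector_derivative_within_subset)
      show "(F has_vector_derivative f z) (at z within {0..1})"
        using assms that by (simp add: C1d_def)
    qed (use assms(2) in auto)
    show "continuous_on {0..x} f" using f assms(2) by (auto intro: continuous_on_subset)
  qed (use assms(2) in auto)
  finally show ?thesis .
qed

lemma prim_C1d:
  assumes "C1d F f"
  shows "cl F = cst (F 0) + prim (cl f)"
proof -
  have "cst (F 0) + prim (cl f) = cl (\<lambda>x. F 0 + integ (cl f) x)"
    by (simp add: prim_def L2_const L2_integ flip: cl_add)
  also have "\<dots> = cl F"
    by (rule cl_eqI) (auto intro!: L2_add L2_const L2_integ simp: integ_C1d[OF assms])
  finally show ?thesis ..
qed

lemma C1d_antiderivative:
  assumes "continuous_on UNIV f"
  obtains F where "C1d F f" "F 0 = 0"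
proof
  have f: "continuous_on {0..1} f" using assms by (auto intro: continuous_on_subset)
  show "C1d (\<lambda>x. integral {0..x} f) f"
    unfolding C1d_def by (auto intro: f integral_has_vector_derivative)
qed simp

lemma C1d_mult:
  assumes "C1d f f'" "C1d g g'"
  shows "C1d (\<lambda>x. f x * g x) (\<lambda>x. f' x * g x + f x * g' x)"
proof -
  have "((\<lambda>x. f x * g x) has_vector_derivative f' x * g x + f x * g' x) (at x within {0..1})"
    if "x \<in> {0..1}" for x
    using has_vector_derivative_mult[of f "f' x" x "{0..1}" g "g' x"] assms that
    by (simp add: C1d_def add.commute)
  then show ?thesis using assms C1d_continuous
    unfolding C1d_def by (auto intro!: continuous_intros simp: C1d_continuous[unfolded C1d_def])
qed

lemma prim_antiderivative: "C1d F f \<Longrightarrow> F 0 = 0 \<Longrightarrow> prim (cl f) = cl F"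
  using prim_C1d[of F f] by (simp add: cl_zero)

lemmas continuous_on_l2_ops [continuous_intros] = pr.continuous_on
  bounded_linear.continuous_on[OF bounded_linear_prim]
  bounded_linear.continuous_on[OF bounded_linear_mul]
  bounded_linear.continuous_on[OF bounded_linear_cj]

text \<open>Integration by parts. Identities for \<open>prim\<close> are checked on continuous functions with the
  fundamental theorem of calculus and extended by density.\<close>

lemma pr_prim: "pr g (prim h) + pr (prim g) h = pr g (cst 1) * pr h (cst 1)"
proof -
  have base: "pr (cl f) (prim (cl k)) + pr (prim (cl f)) (cl k) = pr (cl f) (cst 1) * pr (cl k) (cst 1)"
    if f: "continuous_on UNIV f" and k: "continuous_on UNIV k" for f k
  proof -
    obtain F where F: "C1d F f" "F 0 = 0" using C1d_antiderivative[OF f] .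
    obtain H where H: "C1d H k" "H 0 = 0" using C1d_antiderivative[OF k] .
    have c: "continuous_on {0..1} f" "continuous_on {0..1} k" "continuous_on {0..1} F" "continuous_on {0..1} H"
      using F H by (auto dest: C1d_continuous C1d_continuous')
    note L = c[THEN L2_continuous]
    have M: "cl (\<lambda>x. f x * H x + F x * k x) = cl (\<lambda>x. f x * H x) + cl (\<lambda>x. F x * k x)"
      by (intro cl_add L2_continuous continuous_intros c)
    have one: "pr (cl w) (cst 1) = integ (cl w) 1" for w by (simp add: integ_def ind_1)
    have p1: "pr (cl (\<lambda>x. a x * b x)) (cst 1) = pr (cl a) (cl b)"
      if "continuous_on {0..1} a" "continuous_on {0..1} b" for a b
      using that by (subst (1 2) pr_cl) (auto intro!: L2_const L2_continuous continuous_intros)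
    have "F 1 * H 1 = integ (cl (\<lambda>x. f x * H x + F x * k x)) 1"
      using integ_C1d[OF C1d_mult[OF F(1) H(1)], of 1] F(2) by simp
    also have "\<dots> = pr (cl f) (cl H) + pr (cl F) (cl k)"
      by (simp add: integ_def ind_1 M pr.add_left p1 c)
    finally show ?thesis
      using integ_C1d[OF F(1), of 1] integ_C1d[OF H(1), of 1] F(2) H(2)
      by (simp add: one prim_antiderivative[OF F] prim_antiderivative[OF H])
  qed
  have "pr (cl f) (prim h) + pr (prim (cl f)) h = pr (cl f) (cst 1) * pr h (cst 1)"
    if f: "continuous_on UNIV f" for f h
  proof (rule continuous_dense_eq[where w = h])
    show "continuous_on UNIV (\<lambda>h. pr (cl f) (prim h) + pr (prim (cl f)) h)"
      and "continuous_on UNIV (\<lambda>h. pr (cl f) (cst 1) * pr h (cst 1))"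
      by (intro continuous_intros)+
  qed (rule base[OF f])
  note base' = this
  show ?thesis
  proof (rule continuous_dense_eq[where w = g])
    show "continuous_on UNIV (\<lambda>g. pr g (prim h) + pr (prim g) h)"
      and "continuous_on UNIV (\<lambda>g. pr g (cst 1) * pr h (cst 1))"
      by (intro continuous_intros)+
  qed (rule base')
qed

lemma polynomial_function_C1d:
  assumes "polynomial_function (p :: real \<Rightarrow> complex)"
  obtains p' where "polynomial_function p'" "C1d p p'"
proof -
  obtain p' where "polynomial_function p'" "\<And>x. (p has_vector_derivative p' x) (at x)"
    using has_vector_derivative_polynomial_function[OF assms] by blast
  then have "C1d p p'"
    unfolding C1d_def by (auto intro: has_vector_derivative_at_within continuous_on_polymonial_function)
  with \<open>polynomial_function p'\<close> show thesis by (rule that)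
qed

text \<open>Stone-Weierstrass gives uniform approximation of continuous functions. Polynomials are
  the dense family for arguments that differentiate, since their derivatives are again
  polynomials.\<close>

lemma closure_polynomial: "closure (cl ` {f. polynomial_function f}) = UNIV"
proof -
  have "cl f \<in> closure (cl ` {f. polynomial_function f})" if f: "continuous_on UNIV f" for f
    unfolding closure_approachable
  proof (intro allI impI)
    fix e :: real assume "e > 0"
    have c: "continuous_on {0..1} f" using f by (auto intro: continuous_on_subset)
    obtain p where p: "polynomial_function p" "\<And>x. x \<in> {0..1} \<Longrightarrow> cmod (f x - p x) < e / 2"
      using Stone_Weierstrass_polynomial_function[OF _ c, of "e / 2"] \<open>e > 0\<close> by auto
    have cp: "continuous_on {0..1} p" using p(1) by (rule continuous_on_polymonial_function)
    have "norm (cl (\<lambda>x. p x - f x)) \<le> e / 2"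
      using p(2) \<open>e > 0\<close>
      by (intro norm_cl_le_const continuous_on_measurable_M01 continuous_intros c cp)
         (auto simp: norm_minus_commute less_imp_le)
    then have "dist (cl p) (cl f) < e"
      using \<open>e > 0\<close> by (simp add: dist_norm cl_diff L2_continuous c cp)
    then show "\<exists>y\<in>cl ` {f. polynomial_function f}. dist y (cl f) < e" using p(1) by blast
  qed
  then have "closure (cl ` {f. continuous_on UNIV f}) \<subseteq> closure (cl ` {f. polynomial_function f})"
    by (intro closure_minimal) auto
  then show ?thesis by (auto simp: closure_continuous)
qed

lemma pr_eq_0_imp:
  assumes "\<And>w. pr g w = 0"
  shows "g = 0"
  using pr_cj_self[of g] by (simp add: assms)

lemma eq01_continuous_imp_eq:
  assumes "continuous_on {0..1} f" "continuous_on {0..1} g" "eq01 f g" "x \<in> {0..1}"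
  shows "f x = (g x :: complex)"
proof (rule ccontr)
  assume "f x \<noteq> g x"
  define h where "h z = cmod (f z - g z)" for z
  have h: "continuous_on {0..1} h" unfolding h_def by (intro continuous_intros assms)
  have "h x > 0" using \<open>f x \<noteq> g x\<close> by (simp add: h_def)
  have "AE z in M01. h z = 0" using assms(3) unfolding eq01_def by eventually_elim (simp add: h_def)
  then have ae: "AE z in lborel. z \<in> {0..1} \<longrightarrow> h z = 0" by (simp add: AE_restrict_space_iff)
  obtain d where d: "d > 0" "\<And>z. z \<in> {0..1} \<Longrightarrow> \<bar>z - x\<bar> < d \<Longrightarrow> \<bar>h z - h x\<bar> < h x"
    using h assms(4) \<open>h x > 0\<close> unfolding continuous_on_iff dist_real_def by blast
  define a b where "a = max 0 (x - d / 2)" and "b = min 1 (x + d / 2)"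
  have "a < b" using assms(4) d(1) by (auto simp: a_def b_def)
  have "h z \<noteq> 0 \<and> z \<in> {0..1}" if "z \<in> {a..b}" for z
  proof -
    have "z \<in> {0..1}" "\<bar>z - x\<bar> < d" using that d(1) assms(4) by (auto simp: a_def b_def abs_if)
    then show ?thesis using d(2)[of z] by auto
  qed
  then have "AE z in lborel. z \<notin> {a..b}" using ae by (auto elim: eventually_mono)
  then have "emeasure lborel {a..b} = 0" by (simp add: AE_iff_null_sets null_setsD1)
  then show False using \<open>a < b\<close> by simp
qed

lemma integ_0 [simp]: "integ g 0 = 0"
proof -
  have "ind 0 = 0"
  proof -
    have "(norm (ind 0))\<^sup>2 = (\<integral>z. indicator {0} z \<partial>M01)"
      unfolding ind_def norm_cl_square[OF L2_ind]
      by (intro Bochner_Integration.integral_cong) (auto simp: indicator_def space_M01)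
    also have "\<dots> = 0" by (simp add: measure_restrict_space)
    finally show ?thesis by simp
  qed
  then show ?thesis by (simp add: integ_def pr.zero_right)
qed

lemma integ_1: "integ g 1 = pr g (cst 1)" by (simp add: integ_def ind_1)

lemma cst_add: "cst (a + b) = cst a + cst b" by (simp add: L2_const flip: cl_add)

lemma pr_cst: "pr (cst c) (cst 1) = c"
  by (simp add: pr_cl L2_const space_M01 measure_M01)

text \<open>Continuity turns the equality of classes into an equality at every point, and the values
  at 0 and 1 give c = 0 and mean zero for g. A polynomial is a constant plus a primitive, so in the
  pairing with g integration by parts moves the primitive onto g, where it vanishes. This is the
  uniqueness of the derivative.\<close>

lemma cst_prim_eq_0:
  assumes "cst c + prim g = 0"
  shows "c = 0" "g = 0"
proof -
  have "cl (\<lambda>x. c + integ g x) = cl (\<lambda>_. 0)"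
    using assms by (simp add: prim_def cl_add L2_const L2_integ cl_zero)
  then have "eq01 (\<lambda>x. c + integ g x) (\<lambda>_. 0)"
    by (simp add: cl_eq_iff L2_const L2_integ L2_add)
  then have eq: "c + integ g x = 0" if "x \<in> {0..1}" for x
    using that by (rule eq01_continuous_imp_eq[rotated 2]) (intro continuous_intros continuous_on_integ)+
  from eq[of 0] show c: "c = 0" by simp
  have 1: "pr g (cst 1) = 0" using eq[of 1] c by (simp add: integ_1)
  have 2: "prim g = 0" using assms c by (simp add: cl_zero)
  have "pr g w = 0" for w
  proof -
    have "closed {w. pr g w = 0}"
      by (intro closed_Collect_eq pr.continuous_on continuous_intros)
    moreover have "pr g (cl p) = 0" if p: "polynomial_function p" for p
    proof -
      obtain p' where "C1d p p'" using polynomial_function_C1d[OF p] .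
      then have "cl p = csc (p 0) (cst 1) + prim (cl p')"
        by (simp add: prim_C1d mul_cl L2_const)
      then have "pr g (cl p) = p 0 * pr g (cst 1) + pr g (prim (cl p'))"
        by (simp add: pr.add_right) (metis pr_csc pr_sym)
      then show ?thesis using pr_prim[of g "cl p'"] 1 2 by (simp add: pr.zero_left)
    qed
    ultimately have "closure (cl ` {f. polynomial_function f}) \<subseteq> {w. pr g w = 0}"
      by (intro closure_minimal) auto
    then show ?thesis by (auto simp: closure_polynomial)
  qed
  then show "g = 0" by (rule pr_eq_0_imp)
qed

lemma mul_prim:
  assumes "C1d f f'"
  shows "mul f (prim g) = prim (mul f' (prim g) + mul f g)"
proof (rule continuous_dense_eq[where w = g])
  show "continuous_on UNIV (\<lambda>g. mul f (prim g))"
    by (intro continuous_intros)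
  show "continuous_on UNIV (\<lambda>g. prim (mul f' (prim g) + mul f g))"
    by (intro continuous_intros)
  fix u :: "real \<Rightarrow> complex" assume u: "continuous_on UNIV u"
  obtain U where U: "C1d U u" "U 0 = 0" using C1d_antiderivative[OF u] .
  have c: "continuous_on {0..1} u" "continuous_on {0..1} U" "continuous_on {0..1} f" "continuous_on {0..1} f'"
    using U assms by (auto dest: C1d_continuous C1d_continuous')
  have "prim (cl (\<lambda>x. f' x * U x + f x * u x)) = cl (\<lambda>x. f x * U x)"
    by (rule prim_antiderivative[OF C1d_mult[OF assms U(1)]]) (simp add: U)
  also have "cl (\<lambda>x. f' x * U x + f x * u x) = mul f' (cl U) + mul f (cl u)"
    by (simp add: mul_cl c L2_continuous cl_add continuous_on_mult)
  finally show "mul f (prim (cl u)) = prim (mul f' (prim (cl u)) + mul f (cl u))"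
    by (simp add: prim_antiderivative[OF U] mul_cl c L2_continuous)
qed

lemma mul_cst:
  assumes "C1d f f'"
  shows "mul f (cst c) = cst (f 0 * c) + prim (mul f' (cst c))"
proof -
  have "C1d (\<lambda>x. f x * c) (\<lambda>x. f' x * c)"
    using assms unfolding C1d_def by (auto intro!: derivative_eq_intros continuous_intros)
  from prim_C1d[OF this] show ?thesis
    using C1d_continuous[OF assms] C1d_continuous'[OF assms] by (simp add: mul_cl L2_const)
qed

section \<open>Sobolev spaces of classes\<close>

text \<open>Differentiability is membership in the range of \<open>prim\<close> modulo constants; \<open>Sob_iff\<close> below
  identifies the resulting spaces \<open>HS m\<close> with the classes of \<open>Sob m\<close>. The norm \<open>HS_norm m\<close> is
  equivalent to \<open>Sob_norm m\<close>, a sum being easier to handle by recursion on \<open>m\<close>.\<close>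

definition has_D :: "l2 \<Rightarrow> l2 \<Rightarrow> bool" where "has_D u g \<longleftrightarrow> (\<exists>c. u = cst c + prim g)"

definition D :: "l2 \<Rightarrow> l2" where "D u = (THE g. has_D u g)"

primrec HS :: "nat \<Rightarrow> l2 set" where
  "HS 0 = UNIV"
| "HS (Suc m) = {u. \<exists>g. has_D u g \<and> g \<in> HS m}"

primrec HS_norm :: "nat \<Rightarrow> l2 \<Rightarrow> real" where
  "HS_norm 0 u = norm u"
| "HS_norm (Suc m) u = norm u + HS_norm m (D u)"

lemma cst_eq_csc: "cst c = csc c (cst 1)" by (simp add: mul_cl L2_const)

lemma cst_diff: "cst (a - b) = cst a - cst b" by (simp add: L2_const flip: cl_diff)

lemma has_D_unique: "has_D u g \<Longrightarrow> has_D u h \<Longrightarrow> g = h"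
proof -
  assume "has_D u g" "has_D u h"
  then obtain c d where "u = cst c + prim g" "u = cst d + prim h" unfolding has_D_def by blast
  then have "cst (c - d) + prim (g - h) = 0"
    by (simp add: cst_diff prim_diff algebra_simps)
  then show "g = h" using cst_prim_eq_0(2) by fastforce
qed

lemma D_eq: "has_D u g \<Longrightarrow> D u = g"
  unfolding D_def by (rule the_equality) (auto intro: has_D_unique)

lemma has_D_D: "has_D u g \<Longrightarrow> has_D u (D u)" by (simp add: D_eq)

lemma HS_Suc_iff: "u \<in> HS (Suc m) \<longleftrightarrow> has_D u (D u) \<and> D u \<in> HS m"
  using D_eq has_D_D by auto

lemma HS_SucI: "has_D u g \<Longrightarrow> g \<in> HS m \<Longrightarrow> u \<in> HS (Suc m)" by auto

lemma HS_has_D: "u \<in> HS (Suc m) \<Longrightarrow> has_D u (D u)" by (simp only: HS_Suc_iff)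

lemma HS_D: "u \<in> HS (Suc m) \<Longrightarrow> D u \<in> HS m" by (simp only: HS_Suc_iff)

declare HS.simps(2) [simp del]

lemma has_D_add: "has_D u g \<Longrightarrow> has_D w h \<Longrightarrow> has_D (u + w) (g + h)"
  unfolding has_D_def
proof (elim exE)
  fix c d assume "u = cst c + prim g" "w = cst d + prim h"
  then have "u + w = cst (c + d) + prim (g + h)"
    by (simp add: cst_add prim_add)
  then show "\<exists>c. u + w = cst c + prim (g + h)" ..
qed

lemma has_D_csc: "has_D u g \<Longrightarrow> has_D (csc a u) (csc a g)"
  unfolding has_D_def
proof (elim exE)
  fix c assume "u = cst c + prim g"
  then have "csc a u = cst (a * c) + prim (csc a g)"
    by (simp add: prim_csc mul_cl L2_const mul_add)
  then show "\<exists>c. csc a u = cst c + prim (csc a g)" ..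
qed

lemma has_D_scaleR: "has_D u g \<Longrightarrow> has_D (r *\<^sub>R u) (r *\<^sub>R g)"
  using has_D_csc[of u g "of_real r"] by (simp add: csc_of_real)

lemma has_D_minus: "has_D u g \<Longrightarrow> has_D (- u) (- g)"
  using has_D_scaleR[of u g "-1"] by simp

lemma has_D_diff: "has_D u g \<Longrightarrow> has_D w h \<Longrightarrow> has_D (u - w) (g - h)"
  using has_D_add[OF _ has_D_minus, of u g w h] by simp

lemma has_D_prim: "has_D (prim g) g"
  unfolding has_D_def by (rule exI[of _ 0]) (simp add: cl_zero)

lemma has_D_cst: "has_D (cst c) 0"
  unfolding has_D_def
  by (rule exI[of _ c]) (simp add: prim_zero)

lemma has_D_C1d: "C1d F f \<Longrightarrow> has_D (cl F) (cl f)"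
  unfolding has_D_def using prim_C1d by blast

lemma has_D_mul:
  assumes "C1d f f'" "has_D u g"
  shows "has_D (mul f u) (mul f' u + mul f g)"
proof -
  obtain c where c: "u = cst c + prim g" using assms(2) unfolding has_D_def by blast
  note add = mul_add
    prim_add
  have "mul f u = cst (f 0 * c) + prim (mul f' u + mul f g)"
    unfolding c by (simp only: add mul_cst[OF assms(1)] mul_prim[OF assms(1)] add_ac)
  then show ?thesis unfolding has_D_def by blast
qed

lemma D_prim [simp]: "D (prim g) = g" by (rule D_eq[OF has_D_prim])
lemma D_cst [simp]: "D (cst c) = 0" by (rule D_eq[OF has_D_cst])
lemma D_0 [simp]: "D 0 = 0" using D_cst[of 0] by (simp add: cl_zero)
lemma D_add: "u \<in> HS (Suc m) \<Longrightarrow> w \<in> HS (Suc n) \<Longrightarrow> D (u + w) = D u + D w"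
  by (intro D_eq has_D_add HS_has_D)
lemma D_diff: "u \<in> HS (Suc m) \<Longrightarrow> w \<in> HS (Suc n) \<Longrightarrow> D (u - w) = D u - D w"
  by (intro D_eq has_D_diff HS_has_D)
lemma D_csc: "u \<in> HS (Suc m) \<Longrightarrow> D (csc a u) = csc a (D u)"
  by (intro D_eq has_D_csc HS_has_D)
lemma D_minus: "u \<in> HS (Suc m) \<Longrightarrow> D (- u) = - D u"
  by (intro D_eq has_D_minus HS_has_D)
lemma D_mul: "C1d f f' \<Longrightarrow> u \<in> HS (Suc m) \<Longrightarrow> D (mul f u) = mul f' u + mul f (D u)"
  by (intro D_eq has_D_mul HS_has_D)

lemma HS_0 [simp]: "0 \<in> HS m"
  by (induction m) (use has_D_cst[of 0] in \<open>auto simp: cl_zero intro: HS_SucI\<close>)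

lemma HS_add: "u \<in> HS m \<Longrightarrow> w \<in> HS m \<Longrightarrow> u + w \<in> HS m"
  by (induction m arbitrary: u w) (auto simp: HS.simps(2) intro: has_D_add)

lemma HS_csc: "u \<in> HS m \<Longrightarrow> csc a u \<in> HS m"
  by (induction m arbitrary: u) (auto simp: HS.simps(2) intro: has_D_csc)

lemma HS_scaleR: "u \<in> HS m \<Longrightarrow> r *\<^sub>R u \<in> HS m"
  using HS_csc[of u m "of_real r"] by (simp add: csc_of_real)

lemma HS_minus: "u \<in> HS m \<Longrightarrow> - u \<in> HS m" using HS_scaleR[of u m "-1"] by simp

lemma HS_diff: "u \<in> HS m \<Longrightarrow> w \<in> HS m \<Longrightarrow> u - w \<in> HS m"
  using HS_add[OF _ HS_minus, of u m w] by simp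

lemma HS_sum: "(\<And>i. i \<in> A \<Longrightarrow> f i \<in> HS m) \<Longrightarrow> sum f A \<in> HS m"
  by (induction A rule: infinite_finite_induct) (auto intro: HS_add)

lemma HS_prim: "u \<in> HS m \<Longrightarrow> prim u \<in> HS (Suc m)" by (rule HS_SucI[OF has_D_prim])

lemma HS_cst: "cst c \<in> HS m" by (cases m) (auto intro: HS_SucI[OF has_D_cst])

lemma HS_Suc_subset: "u \<in> HS (Suc m) \<Longrightarrow> u \<in> HS m"
  by (induction m arbitrary: u) (auto simp: HS.simps(2))

lemma HS_mono: "u \<in> HS n \<Longrightarrow> m \<le> n \<Longrightarrow> u \<in> HS m"
  by (induction n rule: nat_induct) (auto simp: le_Suc_eq dest: HS_Suc_subset)

lemma HS_funpow_D: "u \<in> HS (j + m) \<Longrightarrow> (D ^^ j) u \<in> HS m"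
  by (induction j arbitrary: u) (auto simp: funpow_swap1 dest: HS_D)

lemma HS_SucSuc_iff: "u \<in> HS (Suc (Suc m)) \<longleftrightarrow> has_D u (D u) \<and> has_D (D u) (D (D u)) \<and> D (D u) \<in> HS m"
  by (simp add: HS_Suc_iff)

lemma funpow_D_add: "u \<in> HS m \<Longrightarrow> w \<in> HS m \<Longrightarrow> j \<le> m \<Longrightarrow> (D ^^ j) (u + w) = (D ^^ j) u + (D ^^ j) w"
proof (induction j arbitrary: u w m)
  case (Suc j)
  then obtain n where m: "m = Suc n" by (cases m) auto
  show ?case using Suc.IH[of "D u" n "D w"] Suc.prems unfolding m
    by (simp add: funpow_swap1 D_add HS_D)
qed simp

lemma funpow_D_csc: "u \<in> HS m \<Longrightarrow> j \<le> m \<Longrightarrow> (D ^^ j) (csc a u) = csc a ((D ^^ j) u)"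
proof (induction j arbitrary: u m)
  case (Suc j)
  then obtain n where m: "m = Suc n" by (cases m) auto
  show ?case using Suc.IH[of "D u" n] Suc.prems unfolding m
    by (simp add: funpow_swap1 D_csc HS_D)
qed simp

lemma funpow_D_scaleR: "u \<in> HS m \<Longrightarrow> j \<le> m \<Longrightarrow> (D ^^ j) (r *\<^sub>R u) = r *\<^sub>R ((D ^^ j) u)"
  using funpow_D_csc[of u m j "of_real r"] by (simp add: csc_of_real)

lemma funpow_D_diff: "u \<in> HS m \<Longrightarrow> w \<in> HS m \<Longrightarrow> j \<le> m \<Longrightarrow> (D ^^ j) (u - w) = (D ^^ j) u - (D ^^ j) w"
  using funpow_D_add[of u m "- w" j] funpow_D_scaleR[of w m j "-1"] HS_minus[of w m] by simp

lemma funpow_D_sum: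
  "(\<And>i. i \<in> A \<Longrightarrow> f i \<in> HS m) \<Longrightarrow> j \<le> m \<Longrightarrow> (D ^^ j) (sum f A) = (\<Sum>i\<in>A. (D ^^ j) (f i))"
proof (induction A rule: infinite_finite_induct)
  case (insert x F)
  then show ?case by (simp add: funpow_D_add[where m = m] HS_sum)
qed (use funpow_D_scaleR[of 0 m j 0] in auto)

lemma HS_norm_eq_sum: "HS_norm m u = (\<Sum>j\<le>m. norm ((D ^^ j) u))"
proof (induction m arbitrary: u)
  case (Suc m)
  show ?case
    by (simp only: HS_norm.simps Suc sum.atMost_Suc_shift) (simp add: funpow_swap1)
qed simp

lemma HS_norm_nonneg [simp]: "0 \<le> HS_norm m u" by (simp add: HS_norm_eq_sum sum_nonneg)

lemma norm_le_HS_norm: "norm u \<le> HS_norm m u" by (cases m) auto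

lemma norm_funpow_D_le_HS_norm: "j \<le> m \<Longrightarrow> norm ((D ^^ j) u) \<le> HS_norm m u"
  unfolding HS_norm_eq_sum by (rule member_le_sum) auto

lemma HS_norm_mono: "m \<le> n \<Longrightarrow> HS_norm m u \<le> HS_norm n u"
  unfolding HS_norm_eq_sum by (rule sum_mono2) auto

lemma HS_norm_add: "u \<in> HS m \<Longrightarrow> w \<in> HS m \<Longrightarrow> HS_norm m (u + w) \<le> HS_norm m u + HS_norm m w"
proof (induction m arbitrary: u w)
  case (Suc m)
  then show ?case using Suc.IH[OF HS_D[of u] HS_D[of w]] norm_triangle_ineq[of u w]
    by (simp add: D_add[of u m w m])
qed (simp add: norm_triangle_ineq)

lemma HS_norm_csc: "u \<in> HS m \<Longrightarrow> HS_norm m (csc a u) = cmod a * HS_norm m u"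
  by (induction m arbitrary: u) (simp_all add: norm_csc D_csc HS_D algebra_simps)

lemma HS_norm_scaleR: "u \<in> HS m \<Longrightarrow> HS_norm m (r *\<^sub>R u) = \<bar>r\<bar> * HS_norm m u"
  using HS_norm_csc[of u m "of_real r"] by (simp add: csc_of_real)

lemma HS_norm_minus: "u \<in> HS m \<Longrightarrow> HS_norm m (- u) = HS_norm m u"
  using HS_norm_scaleR[of u m "-1"] by simp

lemma HS_norm_diff: "u \<in> HS m \<Longrightarrow> w \<in> HS m \<Longrightarrow> HS_norm m (u - w) \<le> HS_norm m u + HS_norm m w"
  using HS_norm_add[of u m "- w"] by (simp add: HS_norm_minus HS_minus)

lemma HS_norm_0 [simp]: "HS_norm m 0 = 0" using HS_norm_scaleR[of 0 m 0] by simp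

lemma HS_norm_cst: "HS_norm m (cst c) = cmod c"
proof -
  have "norm (cst c) = cmod c"
    by (simp add: norm_cl L2_const L2_norm_def space_M01 measure_M01)
  then show ?thesis by (cases m) auto
qed

lemma HS_norm_sum: "(\<And>i. i \<in> A \<Longrightarrow> f i \<in> HS m) \<Longrightarrow> HS_norm m (sum f A) \<le> (\<Sum>i\<in>A. HS_norm m (f i))"
proof (induction A rule: infinite_finite_induct)
  case (insert x F)
  have "HS_norm m (f x + sum f F) \<le> HS_norm m (f x) + HS_norm m (sum f F)"
    using insert by (intro HS_norm_add HS_sum) auto
  also have "\<dots> \<le> HS_norm m (f x) + (\<Sum>i\<in>F. HS_norm m (f i))" using insert by simp
  finally show ?case using insert by simp
qed auto

subsection \<open>Closedness of differentiation\<close>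

text \<open>The constant is recovered as the mean of \<open>u - prim g\<close>. Differentiability
  thereby becomes an equation between bounded operators, which passes to limits.\<close>

lemma has_D_iff: "has_D u g \<longleftrightarrow> u - prim g = cst (pr (u - prim g) (cst 1))"
  unfolding has_D_def
proof
  assume "\<exists>c. u = cst c + prim g"
  then obtain c where "u - prim g = cst c" by auto
  then show "u - prim g = cst (pr (u - prim g) (cst 1))" by (simp add: pr_cst)
next
  assume "u - prim g = cst (pr (u - prim g) (cst 1))"
  then show "\<exists>c. u = cst c + prim g" by (metis diff_add_cancel)
qed

lemma bounded_linear_cst: "bounded_linear cst"
proof (rule bounded_linear_intro[where K = 1])
  show "cst (r *\<^sub>R c) = r *\<^sub>R cst c" for r c by (simp add: L2_const flip: cl_scaleR)
  show "norm (cst c) \<le> cmod c * 1" for c using HS_norm_cst[of 0 c] by simp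
qed (rule cst_add)


lemma has_D_closed:
  assumes "\<And>n. has_D (p n) (g n)" "p \<longlonglongrightarrow> u" "g \<longlonglongrightarrow> h"
  shows "has_D u h"
proof -
  have l: "(\<lambda>n. p n - prim (g n)) \<longlonglongrightarrow> u - prim h"
    by (intro tendsto_intros assms bounded_linear.tendsto[OF bounded_linear_prim])
  have "(\<lambda>n. cst (pr (p n - prim (g n)) (cst 1))) \<longlonglongrightarrow> cst (pr (u - prim h) (cst 1))"
    by (intro bounded_linear.tendsto[OF bounded_linear_cst] pr.tendsto l tendsto_const)
  moreover have "cst (pr (p n - prim (g n)) (cst 1)) = p n - prim (g n)" for n
    using assms(1)[of n] by (simp only: has_D_iff)
  ultimately have "(\<lambda>n. p n - prim (g n)) \<longlonglongrightarrow> cst (pr (u - prim h) (cst 1))" by simp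
  with l have "u - prim h = cst (pr (u - prim h) (cst 1))" by (rule LIMSEQ_unique)
  then show ?thesis by (simp only: has_D_iff)
qed

lemma HS_closed:
  assumes "\<And>n. p n \<in> HS m" "\<And>j. j \<le> m \<Longrightarrow> (\<lambda>n. (D ^^ j) (p n)) \<longlonglongrightarrow> q j"
  shows "q 0 \<in> HS m \<and> (\<forall>j\<le>m. (D ^^ j) (q 0) = q j)"
  using assms
proof (induction m arbitrary: p q)
  case (Suc m)
  have IH: "q (Suc 0) \<in> HS m \<and> (\<forall>j\<le>m. (D ^^ j) (q (Suc 0)) = q (Suc j))"
  proof (rule Suc.IH[of "\<lambda>n. D (p n)"])
    show "D (p n) \<in> HS m" for n using Suc.prems(1) by (rule HS_D)
    show "(\<lambda>n. (D ^^ j) (D (p n))) \<longlonglongrightarrow> q (Suc j)" if "j \<le> m" for j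
      using Suc.prems(2)[of "Suc j"] that by (simp add: funpow_swap1)
  qed
  have "has_D (q 0) (q (Suc 0))"
  proof (rule has_D_closed)
    show "has_D (p n) (D (p n))" for n using Suc.prems(1) by (rule HS_has_D)
    show "p \<longlonglongrightarrow> q 0" using Suc.prems(2)[of 0] by simp
    show "(\<lambda>n. D (p n)) \<longlonglongrightarrow> q (Suc 0)" using Suc.prems(2)[of "Suc 0"] by simp
  qed
  then have "q 0 \<in> HS (Suc m)" "D (q 0) = q (Suc 0)" using IH D_eq HS_SucI by blast+
  moreover have "(D ^^ j) (q 0) = q j" if "j \<le> Suc m" for j
    using that IH \<open>D (q 0) = q (Suc 0)\<close> by (cases j) (auto simp: funpow_swap1)
  ultimately show ?case by blast
qed auto

text \<open>Completeness of \<open>HS m\<close> in the form required for series: convergence is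
  tested for each derivative separately, while the limit need only be identified in
  \<open>l2\<close>.\<close>

lemma HS_closed_HS_norm:
  assumes "\<And>n. p n \<in> HS m" "\<And>j. j \<le> m \<Longrightarrow> convergent (\<lambda>n. (D ^^ j) (p n))" "p \<longlonglongrightarrow> u"
  shows "u \<in> HS m" "(\<lambda>n. HS_norm m (p n - u)) \<longlonglongrightarrow> 0"
proof -
  define q where "q j = lim (\<lambda>n. (D ^^ j) (p n))" for j
  have q: "(\<lambda>n. (D ^^ j) (p n)) \<longlonglongrightarrow> q j" if "j \<le> m" for j
    using assms(2)[OF that] by (simp add: q_def convergent_LIMSEQ_iff)
  have q0: "q 0 = u" using q[of 0] assms(3) by (auto intro: LIMSEQ_unique)
  note c = HS_closed[OF assms(1) q, unfolded q0]
  then show u: "u \<in> HS m" by blast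
  have "(\<lambda>n. \<Sum>j\<le>m. norm ((D ^^ j) (p n) - q j)) \<longlonglongrightarrow> (\<Sum>j\<le>m. norm (q j - q j))"
    by (intro tendsto_intros q) auto
  then show "(\<lambda>n. HS_norm m (p n - u)) \<longlonglongrightarrow> 0"
    using c u by (simp add: HS_norm_eq_sum funpow_D_diff[where m = m] assms(1))
qed

subsection \<open>Multiplication by smooth functions\<close>

text \<open>With existentially quantified derivatives, stability under sums and products needs no
  formula for higher derivatives.\<close>

primrec smooth_upto :: "nat \<Rightarrow> (real \<Rightarrow> complex) \<Rightarrow> bool" where
  "smooth_upto 0 f \<longleftrightarrow> continuous_on {0..1} f"
| "smooth_upto (Suc m) f \<longleftrightarrow> (\<exists>f'. C1d f f' \<and> smooth_upto m f')"

lemma smooth_upto_Suc: "smooth_upto (Suc m) f \<Longrightarrow> smooth_upto m f"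
  by (induction m arbitrary: f) (auto dest: C1d_continuous)

lemma smooth_upto_continuous: "smooth_upto m f \<Longrightarrow> continuous_on {0..1} f"
  by (cases m) (auto dest: C1d_continuous)

lemma C1d_add: "C1d f f' \<Longrightarrow> C1d g g' \<Longrightarrow> C1d (\<lambda>x. f x + g x) (\<lambda>x. f' x + g' x)"
  by (auto simp: C1d_def intro!: continuous_intros derivative_intros)

lemma C1d_const: "C1d (\<lambda>_. c) (\<lambda>_. 0)"
  by (auto simp: C1d_def intro!: continuous_intros derivative_intros)

lemma C1d_of_real: "C1d of_real (\<lambda>_. 1)"
  unfolding C1d_def by (auto intro!: derivative_eq_intros has_vector_derivative_of_real)

lemma smooth_upto_add: "smooth_upto m f \<Longrightarrow> smooth_upto m g \<Longrightarrow> smooth_upto m (\<lambda>x. f x + g x)"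
proof (induction m arbitrary: f g)
  case (Suc m)
  then obtain f' g' where "C1d f f'" "smooth_upto m f'" "C1d g g'" "smooth_upto m g'" by auto
  then have "C1d (\<lambda>x. f x + g x) (\<lambda>x. f' x + g' x)" "smooth_upto m (\<lambda>x. f' x + g' x)"
    using Suc.IH C1d_add by blast+
  then show ?case by auto
qed (simp add: continuous_on_add)

lemma smooth_upto_const: "smooth_upto m (\<lambda>_. c)"
  by (induction m arbitrary: c) (auto intro!: C1d_const exI[of _ "\<lambda>_. 0"])

lemma smooth_upto_of_real: "smooth_upto m of_real"
proof (cases m)
  case 0
  then show ?thesis by (simp add: continuous_intros)
next
  case (Suc n)
  then show ?thesis using C1d_of_real smooth_upto_const by auto
qed

lemma smooth_upto_mult: "smooth_upto m f \<Longrightarrow> smooth_upto m g \<Longrightarrow> smooth_upto m (\<lambda>x. f x * g x)"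
proof (induction m arbitrary: f g)
  case (Suc m)
  then obtain f' g' where *: "C1d f f'" "smooth_upto m f'" "C1d g g'" "smooth_upto m g'" by auto
  have "smooth_upto m (\<lambda>x. f' x * g x + f x * g' x)"
    using * Suc.prems by (intro smooth_upto_add Suc.IH) (auto dest: smooth_upto_Suc simp del: smooth_upto.simps)
  then show ?case using C1d_mult[OF *(1,3)] by auto
qed (simp add: continuous_on_mult)

lemma smooth_upto_power: "smooth_upto m f \<Longrightarrow> smooth_upto m (\<lambda>x. f x ^ n)"
  by (induction n) (auto intro: smooth_upto_const smooth_upto_mult)

text \<open>Membership and estimate together, for each order separately. This is the property that
  passes from the corrector to its exponential; linearity is established on its own.\<close>

definition sob_bounded :: "nat \<Rightarrow> (l2 \<Rightarrow> l2) \<Rightarrow> bool" where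
  "sob_bounded m T \<longleftrightarrow> (\<exists>K\<ge>0. \<forall>u\<in>HS m. T u \<in> HS m \<and> HS_norm m (T u) \<le> K * HS_norm m u)"

lemma bndI: "0 \<le> K \<Longrightarrow> (\<And>u. u \<in> HS m \<Longrightarrow> T u \<in> HS m) \<Longrightarrow>
    (\<And>u. u \<in> HS m \<Longrightarrow> HS_norm m (T u) \<le> K * HS_norm m u) \<Longrightarrow> sob_bounded m T"
  unfolding sob_bounded_def by blast

lemma sob_bounded_HS: "sob_bounded m T \<Longrightarrow> u \<in> HS m \<Longrightarrow> T u \<in> HS m"
  unfolding sob_bounded_def by blast

lemma bndE:
  assumes "sob_bounded m T"
  obtains K where "0 \<le> K" "\<And>u. u \<in> HS m \<Longrightarrow> HS_norm m (T u) \<le> K * HS_norm m u"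
  using assms unfolding sob_bounded_def by blast

lemma sob_bounded_comp:
  assumes "sob_bounded m T" "sob_bounded m U"
  shows "sob_bounded m (\<lambda>u. T (U u))"
proof -
  obtain K where K: "0 \<le> K" "\<And>u. u \<in> HS m \<Longrightarrow> HS_norm m (T u) \<le> K * HS_norm m u" by (rule bndE[OF assms(1)]) blast
  obtain L where L: "0 \<le> L" "\<And>u. u \<in> HS m \<Longrightarrow> HS_norm m (U u) \<le> L * HS_norm m u" by (rule bndE[OF assms(2)]) blast
  show ?thesis
  proof (rule bndI[of "K * L"])
    fix u assume u: "u \<in> HS m"
    have "HS_norm m (T (U u)) \<le> K * HS_norm m (U u)" by (intro K sob_bounded_HS[OF assms(2)] u)
    also have "\<dots> \<le> K * (L * HS_norm m u)" by (intro mult_left_mono L u K)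
    finally show "HS_norm m (T (U u)) \<le> K * L * HS_norm m u" by (simp add: mult.assoc)
  qed (use K L assms sob_bounded_HS in auto)
qed

lemma sob_bounded_add:
  assumes "sob_bounded m T" "sob_bounded m U"
  shows "sob_bounded m (\<lambda>u. T u + U u)"
proof -
  obtain K where K: "0 \<le> K" "\<And>u. u \<in> HS m \<Longrightarrow> HS_norm m (T u) \<le> K * HS_norm m u" by (rule bndE[OF assms(1)]) blast
  obtain L where L: "0 \<le> L" "\<And>u. u \<in> HS m \<Longrightarrow> HS_norm m (U u) \<le> L * HS_norm m u" by (rule bndE[OF assms(2)]) blast
  show ?thesis
  proof (rule bndI[of "K + L"])
    fix u assume u: "u \<in> HS m"
    show "T u + U u \<in> HS m" by (intro HS_add sob_bounded_HS[OF assms(1) u] sob_bounded_HS[OF assms(2) u])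
    have "HS_norm m (T u + U u) \<le> HS_norm m (T u) + HS_norm m (U u)"
      by (intro HS_norm_add sob_bounded_HS[OF assms(1) u] sob_bounded_HS[OF assms(2) u])
    then show "HS_norm m (T u + U u) \<le> (K + L) * HS_norm m u" using K(2)[OF u] L(2)[OF u]
      by (simp add: distrib_right)
  qed (use K L in auto)
qed

lemma sob_bounded_zero: "sob_bounded m (\<lambda>_. 0)" by (rule bndI[of 0]) auto

lemma sob_bounded_sum: "(\<And>i. i \<in> A \<Longrightarrow> sob_bounded m (T i)) \<Longrightarrow> sob_bounded m (\<lambda>u. \<Sum>i\<in>A. T i u)"
  by (induction A rule: infinite_finite_induct) (auto intro: sob_bounded_zero sob_bounded_add)

lemma sob_bounded_csc: "sob_bounded m (csc c)"
  by (rule bndI[of "cmod c"]) (auto simp: HS_norm_csc HS_csc)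

text \<open>One derivative of f u leaves f' u + f u', and both terms are covered by the induction
  hypothesis at order m, applied to f' and to f.\<close>

lemma sob_bounded_mul: "smooth_upto m f \<Longrightarrow> sob_bounded m (mul f)"
proof (induction m arbitrary: f)
  case 0
  obtain K where "K \<ge> 0" "\<And>u. norm (mul f u) \<le> K * norm u" using mul_bound by blast
  then show ?case by (intro bndI[of K]) auto
next
  case (Suc m)
  then obtain f' where f': "C1d f f'" "smooth_upto m f'" by auto
  obtain K where K: "K \<ge> 0" "\<And>u. norm (mul f u) \<le> K * norm u" using mul_bound by blast
  have b: "sob_bounded m (mul f)" "sob_bounded m (mul f')" using Suc.IH f'(2) smooth_upto_Suc[OF Suc.prems] by blast+
  obtain L where L: "0 \<le> L" "\<And>u. u \<in> HS m \<Longrightarrow> HS_norm m (mul f u) \<le> L * HS_norm m u" by (rule bndE[OF b(1)]) blast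
  obtain M where M: "0 \<le> M" "\<And>u. u \<in> HS m \<Longrightarrow> HS_norm m (mul f' u) \<le> M * HS_norm m u" by (rule bndE[OF b(2)]) blast
  show ?case
  proof (rule bndI[of "K + L + M"])
    fix u assume u: "u \<in> HS (Suc m)"
    note u' = HS_Suc_subset[OF u] HS_D[OF u]
    have d: "D (mul f u) = mul f' u + mul f (D u)" by (rule D_mul[OF f'(1) u])
    show "mul f u \<in> HS (Suc m)"
      by (intro HS_SucI[OF has_D_mul[OF f'(1) HS_has_D[OF u]]] HS_add sob_bounded_HS[OF b(1)] sob_bounded_HS[OF b(2)] u')
    have "HS_norm (Suc m) (mul f u) \<le> K * norm u + (HS_norm m (mul f' u) + HS_norm m (mul f (D u)))"
      unfolding HS_norm.simps d by (intro add_mono K HS_norm_add sob_bounded_HS[OF b(1)] sob_bounded_HS[OF b(2)] u')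
    also have "\<dots> \<le> K * HS_norm (Suc m) u + (M * HS_norm (Suc m) u + L * HS_norm (Suc m) u)"
    proof (intro add_mono)
      show "K * norm u \<le> K * HS_norm (Suc m) u" using K norm_le_HS_norm by (intro mult_left_mono) auto
      show "HS_norm m (mul f' u) \<le> M * HS_norm (Suc m) u"
        using M(2)[OF u'(1)] mult_left_mono[OF HS_norm_mono[of m "Suc m" u] M(1)] by simp
      show "HS_norm m (mul f (D u)) \<le> L * HS_norm (Suc m) u"
        using L(2)[OF u'(2)] mult_left_mono[OF _ L(1), of "HS_norm m (D u)" "HS_norm (Suc m) u"] by simp
    qed
    finally show "HS_norm (Suc m) (mul f u) \<le> (K + L + M) * HS_norm (Suc m) u" by (simp add: algebra_simps)
  qed (use K L M in auto)
qed

lemma sob_bounded_prim: "sob_bounded m prim"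
proof (rule bndI[of 2])
  fix u assume u: "u \<in> HS m"
  show "prim u \<in> HS m" by (rule HS_Suc_subset[OF HS_prim[OF u]])
  have "HS_norm m (prim u) \<le> HS_norm (Suc m) (prim u)" by (rule HS_norm_mono) simp
  then show "HS_norm m (prim u) \<le> 2 * HS_norm m u" using norm_prim_le[of u] norm_le_HS_norm[of u m] by simp
qed simp

subsection \<open>Traces\<close>

text \<open>The value at \<open>x\<close> of the continuous representative.\<close>

definition ev :: "l2 \<Rightarrow> real \<Rightarrow> complex" where
  "ev u x = pr (u - prim (D u)) (cst 1) + integ (D u) x"

lemma ev_eq: "u = cst c + prim g \<Longrightarrow> ev u x = c + integ g x"
proof -
  assume u: "u = cst c + prim g"
  then have "D u = g" by (intro D_eq) (auto simp: has_D_def)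
  with u show ?thesis by (simp add: ev_def pr_cst)
qed

lemma continuous_on_ev: "continuous_on {0..1} (ev u)"
  unfolding ev_def by (intro continuous_intros continuous_on_integ)

lemma L2_ev: "ev u \<in> L2" by (rule L2_continuous[OF continuous_on_ev])

lemma cl_ev:
  assumes "u \<in> HS (Suc m)"
  shows "cl (ev u) = u"
proof -
  obtain c where c: "u = cst c + prim (D u)" using HS_has_D[OF assms] by (auto simp: has_D_def)
  have "ev u = (\<lambda>x. c + integ (D u) x)" using ev_eq[OF c] by auto
  then show ?thesis by (subst (2) c) (simp add: prim_def cl_add L2_const L2_integ)
qed

lemma ev_unique:
  assumes "u \<in> HS (Suc m)" "continuous_on {0..1} f" "cl f = u" "x \<in> {0..1}"
  shows "ev u x = f x"
proof -
  have "eq01 (ev u) f"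
    using cl_ev[OF assms(1)] assms(2,3) by (simp add: L2_ev L2_continuous flip: cl_eq_iff)
  then show ?thesis using assms by (intro eq01_continuous_imp_eq continuous_on_ev)
qed

lemma ev_add: "u \<in> HS (Suc m) \<Longrightarrow> w \<in> HS (Suc n) \<Longrightarrow> ev (u + w) x = ev u x + ev w x"
  by (simp add: ev_def D_add integ_add pr.add_left pr.diff_left
      prim_add)

lemma ev_csc: "u \<in> HS (Suc m) \<Longrightarrow> ev (csc a u) x = a * ev u x"
  by (simp add: ev_def D_csc integ_csc pr.diff_left prim_csc pr_csc algebra_simps)

lemma ev_diff: "u \<in> HS (Suc m) \<Longrightarrow> w \<in> HS (Suc n) \<Longrightarrow> ev (u - w) x = ev u x - ev w x"
  by (simp add: ev_def D_diff integ_diff pr.diff_left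
      prim_diff)

lemma ev_0 [simp]: "ev 0 x = 0" using ev_csc[of 0 0 0 x] by simp

lemma ev_sum: "(\<And>i. i \<in> A \<Longrightarrow> f i \<in> HS (Suc m)) \<Longrightarrow> ev (sum f A) x = (\<Sum>i\<in>A. ev (f i) x)"
  by (induction A rule: infinite_finite_induct) (auto simp: ev_add[of _ m _ m] HS_sum)

lemma ev_cst [simp]: "ev (cst c) x = c"
  by (subst ev_eq[of _ c 0]) (auto simp: integ_def pr.zero_left prim_zero)

lemma ev_prim [simp]: "ev (prim g) x = integ g x"
  by (subst ev_eq[of _ 0 g]) (auto simp: cl_zero)

lemma ev_mul:
  assumes "C1d f f'" "u \<in> HS (Suc m)" "x \<in> {0..1}"
  shows "ev (mul f u) x = f x * ev u x"
proof (rule ev_unique[of _ 0])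
  have f: "continuous_on {0..1} f" using assms(1) by (rule C1d_continuous)
  show "mul f u \<in> HS (Suc 0)"
    by (rule HS_SucI[OF has_D_mul[OF assms(1) HS_has_D[OF assms(2)]]]) simp
  show "continuous_on {0..1} (\<lambda>x. f x * ev u x)" by (intro continuous_intros f continuous_on_ev)
  show "cl (\<lambda>x. f x * ev u x) = mul f u"
    using cl_ev[OF assms(2)] by (metis mul_cl[OF f L2_ev])
qed fact

lemma ev_C1d: "C1d F f \<Longrightarrow> x \<in> {0..1} \<Longrightarrow> ev (cl F) x = F x"
  by (rule ev_unique[of _ 0]) (auto intro: HS_SucI[OF has_D_C1d] C1d_continuous)

text \<open>The embedding of H^1 into the continuous functions: u is the mean of
  \<open>u - prim (D u)\<close> plus a primitive, and both are bounded by norms of u and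
  \<open>D u\<close>.\<close>

lemma norm_ev_le: "cmod (ev u x) \<le> 2 * HS_norm (Suc m) u"
proof -
  have "cmod (ev u x) \<le> cmod (pr (u - prim (D u)) (cst 1)) + cmod (integ (D u) x)"
    unfolding ev_def by (rule norm_triangle_ineq)
  also have "\<dots> \<le> norm (u - prim (D u)) + norm (D u)"
    using norm_pr_le[of "u - prim (D u)" "cst 1"] norm_integ_le[of "D u" x] HS_norm_cst[of 0 1]
    by (intro add_mono) auto
  also have "\<dots> \<le> norm u + norm (D u) + norm (D u)"
    using norm_triangle_ineq4[of u "prim (D u)"] norm_prim_le[of "D u"] by linarith
  also have "\<dots> \<le> 2 * HS_norm (Suc m) u"
    using norm_le_HS_norm[of "D u" m] norm_ge_zero[of u] unfolding HS_norm.simps distrib_left by linarith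
  finally show ?thesis .
qed

lemma ev_tendsto:
  assumes "\<And>n. p n \<in> HS (Suc m)" "u \<in> HS (Suc m)" "((\<lambda>n. HS_norm (Suc m) (p n - u)) \<longlongrightarrow> 0) F"
  shows "((\<lambda>n. ev (p n) x) \<longlongrightarrow> ev u x) F"
proof -
  have "((\<lambda>n. ev (p n) x - ev u x) \<longlongrightarrow> 0) F"
  proof (rule Lim_null_comparison)
    show "\<forall>\<^sub>F n in F. norm (ev (p n) x - ev u x) \<le> 2 * HS_norm (Suc m) (p n - u)"
      using norm_ev_le[of "p n - u" x m for n] by (simp add: ev_diff[OF assms(1,2)])
    show "((\<lambda>n. 2 * HS_norm (Suc m) (p n - u)) \<longlongrightarrow> 0) F" using tendsto_mult_right_zero[OF assms(3)] .
  qed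
  then show ?thesis by (rule LIM_zero_cancel)
qed

subsection \<open>The Dirichlet inverse of the second derivative\<close>

text \<open>The Green operator with Dirichlet conditions. Subtracting the mean of the inner
  primitive makes the outer one vanish at 1; at 0 it vanishes anyway.\<close>

definition G :: "l2 \<Rightarrow> l2" where "G g = prim (prim g - cst (pr (prim g) (cst 1)))"

lemma bounded_linear_G: "bounded_linear G"
  unfolding G_def
  by (intro bounded_linear_compose[OF bounded_linear_prim] bounded_linear_sub bounded_linear_prim
      bounded_linear_compose[OF bounded_linear_cst] bounded_linear_compose[OF pr.bounded_linear_left])

lemmas G_diff = linear_diff[OF bounded_linear.linear[OF bounded_linear_G]]

lemma D_G: "D (G g) = prim g - cst (pr (prim g) (cst 1))" by (simp add: G_def)

lemma has_D_D_G: "has_D (prim g - cst (pr (prim g) (cst 1))) g"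
  using has_D_diff[OF has_D_prim has_D_cst] by simp

lemma D_D_G [simp]: "D (D (G g)) = g" by (simp add: D_G D_eq[OF has_D_D_G])

lemma HS_G: "g \<in> HS m \<Longrightarrow> G g \<in> HS (Suc (Suc m))"
  unfolding G_def by (intro HS_prim HS_SucI[OF has_D_D_G])

lemma ev_G [simp]: "ev (G g) 0 = 0" "ev (G g) 1 = 0"
  by (simp_all add: G_def integ_1 pr.diff_left pr_cst)

lemma eq_G_D_D:
  assumes "u \<in> HS (Suc (Suc m))" "ev u 0 = 0" "ev u 1 = 0"
  shows "u = G (D (D u))"
proof -
  obtain c where c: "u = cst c + prim (D u)" using HS_has_D[OF assms(1)] by (auto simp: has_D_def)
  obtain d where d: "D u = cst d + prim (D (D u))"
    using HS_has_D[OF HS_D[OF assms(1)]] by (auto simp: has_D_def)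
  have "c = 0" using assms(2) ev_eq[OF c, of 0] by simp
  have "pr (D u) (cst 1) = 0" using assms(3) ev_eq[OF c, of 1] \<open>c = 0\<close> by (simp add: integ_1)
  then have "d + pr (prim (D (D u))) (cst 1) = 0"
    by (subst (asm) d) (simp add: pr.add_left pr_cst)
  then have d': "d = - pr (prim (D (D u))) (cst 1)" by (simp add: add_eq_0_iff2)
  have "D u = prim (D (D u)) - cst (pr (prim (D (D u))) (cst 1))"
    using d unfolding d' by (simp add: cl_uminus L2_const)
  then have "G (D (D u)) = prim (D u)" by (simp add: G_def)
  then show ?thesis using c \<open>c = 0\<close> by (simp add: cl_zero)
qed

lemma cj_prim: "cj (prim g) = prim (cj g)"
proof -
  have "integ (cj g) x = cnj (integ g x)" for x
    by (cases g rule: cl_cases) (simp add: integ_def ind_def cj_cl pr_cl L2_ind L2_cnj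
        flip: Bochner_Integration.integral_cnj, auto intro!: Bochner_Integration.integral_cong)
  then have "integ (cj g) = (\<lambda>x. cnj (integ g x))" by blast
  then show ?thesis by (simp add: prim_def cj_cl L2_integ)
qed

text \<open>Integration by parts has no boundary term since b, the derivative of \<open>G g\<close>,
  has mean zero. As the value is real, multiplication by i makes g orthogonal to \<open>G g\<close>,
  which is the skewness of the free operator.\<close>

lemma pr_cj_G: "pr g (cj (G g)) = - of_real ((norm (D (G g)))\<^sup>2)"
proof -
  define b where "b = D (G g)"
  define m where "m = pr (prim g) (cst 1)"
  have b: "b = prim g - cst m" by (simp add: b_def D_G m_def)
  have Gg: "G g = prim b" by (simp add: G_def b m_def)
  have b1: "pr b (cst 1) = 0" by (simp add: b m_def pr.diff_left pr_cst)
  have "cj (cst 1) = cst 1" by (simp add: cj_cl L2_const)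
  have "pr (cj b) (cst 1) = cnj (pr b (cst 1))"
    by (cases b rule: cl_cases) (simp add: cj_cl pr_cl L2_cnj L2_const)
  then have b2: "pr (cj b) (cst 1) = 0" by (simp add: b1)
  have "pr g (cj (G g)) = pr g (prim (cj b))" by (simp add: Gg cj_prim)
  also have "\<dots> = - pr (prim g) (cj b)" using pr_prim[of g "cj b"] b2 by (simp add: add_eq_0_iff2)
  also have "prim g = b + csc m (cst 1)" by (simp add: b flip: cst_eq_csc)
  also have "pr (b + csc m (cst 1)) (cj b) = pr b (cj b)"
    using b2 by (simp add: pr.add_left pr_csc pr_sym[of "cst 1"])
  finally show ?thesis by (simp add: pr_cj_self b_def)
qed

lemma inner_G: "inner (csc \<i> g) (G g) = 0"
  by (simp add: inner_eq_pr pr_csc pr_cj_G)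

lemma norm_D_G_le: "norm (D (G g)) \<le> 2 * norm g"
proof -
  have "norm (cst (pr (prim g) (cst 1))) \<le> norm (prim g)"
    using HS_norm_cst[of 0 "pr (prim g) (cst 1)"] norm_pr_le[of "prim g" "cst 1"] HS_norm_cst[of 0 1] by simp
  then show ?thesis
    using norm_triangle_ineq4[of "prim g" "cst (pr (prim g) (cst 1))"] norm_prim_le[of g]
    unfolding D_G by linarith
qed

lemma norm_G_le: "norm (G g) \<le> 2 * norm g"
  using norm_prim_le[of "prim g - cst (pr (prim g) (cst 1))"] norm_D_G_le[of g]
  by (simp add: D_G) (simp add: G_def)

text \<open>The constant is 2 + 2 + 1, for \<open>G g\<close>, its first derivative and the
  remaining g.\<close>

lemma HS_norm_G: "HS_norm (Suc (Suc m)) (G g) \<le> 5 * HS_norm m g"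
  using norm_G_le[of g] norm_D_G_le[of g] norm_le_HS_norm[of g m] by simp

lemma HS_funpow_G: "g \<in> HS m \<Longrightarrow> (G ^^ a) g \<in> HS (2 * a + m)"
  by (induction a) (auto dest: HS_G)

lemma HS_norm_funpow_G: "HS_norm (2 * a + m) ((G ^^ a) g) \<le> 5 ^ a * HS_norm m g"
proof (induction a)
  case (Suc a)
  have "HS_norm (2 * Suc a + m) ((G ^^ Suc a) g) \<le> 5 * HS_norm (2 * a + m) ((G ^^ a) g)"
    using HS_norm_G[of "2 * a + m" "(G ^^ a) g"] by simp
  with Suc show ?case by simp
qed simp

text \<open>A class with zero end values is \<open>G\<close> of its second derivative, so the
  conditions on the even derivatives peel off one \<open>G\<close> each. The conditions are thus
  replaced by a free parameter in \<open>l2\<close>, which is convenient for density.\<close>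

lemma Dirichlet_iff_range_G:
  "u \<in> HS (2 * a) \<and> (\<forall>l<a. ev ((D ^^ (2 * l)) u) 0 = 0 \<and> ev ((D ^^ (2 * l)) u) 1 = 0)
    \<longleftrightarrow> u \<in> range (G ^^ a)"
proof (induction a arbitrary: u)
  case (Suc a)
  have shift: "(D ^^ (2 * Suc l)) u = (D ^^ (2 * l)) (D (D u))" for l u
    by (simp add: funpow_swap1)
  show ?case
  proof
    assume A: "u \<in> HS (2 * Suc a) \<and> (\<forall>l<Suc a. ev ((D ^^ (2 * l)) u) 0 = 0 \<and> ev ((D ^^ (2 * l)) u) 1 = 0)"
    then have u: "u \<in> HS (Suc (Suc (2 * a)))" by simp
    have "ev u 0 = 0" "ev u 1 = 0" using A by (auto dest: spec[of _ 0])
    with u have eq: "u = G (D (D u))" by (rule eq_G_D_D)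
    have "D (D u) \<in> range (G ^^ a)"
      unfolding Suc.IH[symmetric]
    proof (intro conjI allI impI)
      show "D (D u) \<in> HS (2 * a)" using u by (intro HS_D)
      fix l assume "l < a"
      then have "Suc l < Suc a" by simp
      with A show "ev ((D ^^ (2 * l)) (D (D u))) 0 = 0" "ev ((D ^^ (2 * l)) (D (D u))) 1 = 0"
        by (metis shift)+
    qed
    then show "u \<in> range (G ^^ Suc a)" using eq by auto
  next
    assume "u \<in> range (G ^^ Suc a)"
    then obtain w where w: "w \<in> range (G ^^ a)" "u = G w" by auto
    then have w': "w \<in> HS (2 * a)" "\<forall>l<a. ev ((D ^^ (2 * l)) w) 0 = 0 \<and> ev ((D ^^ (2 * l)) w) 1 = 0"
      using Suc.IH by blast+
    have "ev ((D ^^ (2 * l)) u) 0 = 0 \<and> ev ((D ^^ (2 * l)) u) 1 = 0" if "l < Suc a" for l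
      using that w' by (cases l) (auto simp: w(2) shift simp del: funpow.simps mult_Suc_right)
    then show "u \<in> HS (2 * Suc a) \<and> (\<forall>l<Suc a. ev ((D ^^ (2 * l)) u) 0 = 0 \<and> ev ((D ^^ (2 * l)) u) 1 = 0)"
      using HS_G[OF w'(1)] w(2) by simp
  qed
qed simp

section \<open>Test functions\<close>

lemma nderiv_shift: "nderiv S n (nderiv S (Suc 0) f) = nderiv S (Suc n) f"
  by (induction n) auto

text \<open>Counterpart of \<open>smooth_upto\<close> on the line. No continuity is asked at level
  0: when the property holds at all levels, every derivative is differentiable anyway.\<close>

primrec smooth_upto_UNIV :: "nat \<Rightarrow> (real \<Rightarrow> complex) \<Rightarrow> bool" where
  "smooth_upto_UNIV 0 f \<longleftrightarrow> True"
| "smooth_upto_UNIV (Suc n) f \<longleftrightarrow> (\<exists>f'. (\<forall>x. (f has_vector_derivative f' x) (at x)) \<and> smooth_upto_UNIV n f')"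

lemma smooth_upto_UNIV_imp_smooth_on:
  assumes "\<And>n. smooth_upto_UNIV n f"
  shows "smooth_on UNIV f"
proof -
  have "smooth_upto_UNIV (Suc n) f \<Longrightarrow> nderiv UNIV n f differentiable (at x)" for n x and f :: "real \<Rightarrow> complex"
  proof (induction n arbitrary: f)
    case 0
    then show ?case by (auto intro: differentiableI_vector)
  next
    case (Suc n)
    then obtain f' where f': "\<And>x. (f has_vector_derivative f' x) (at x)" "smooth_upto_UNIV (Suc n) f'"
      unfolding smooth_upto_UNIV.simps(2)[of "Suc n"] by blast
    have "nderiv UNIV (Suc 0) f = f'" using f'(1) by (auto intro: vector_derivative_at)
    then show ?case using Suc.IH[OF f'(2)] by (metis nderiv_shift)
  qed
  with assms show ?thesis unfolding smooth_on_def by blast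
qed

lemma smooth_upto_UNIV_Suc: "smooth_upto_UNIV (Suc n) f \<Longrightarrow> smooth_upto_UNIV n f"
  by (induction n arbitrary: f) auto

lemma smooth_upto_UNIV_const: "smooth_upto_UNIV n (\<lambda>_. c)"
  by (induction n arbitrary: c) (auto intro!: exI[of _ "\<lambda>_. 0"] derivative_intros)

lemma smooth_upto_UNIV_add: "smooth_upto_UNIV n f \<Longrightarrow> smooth_upto_UNIV n g \<Longrightarrow> smooth_upto_UNIV n (\<lambda>x. f x + g x)"
proof (induction n arbitrary: f g)
  case (Suc n)
  then obtain f' g' where d: "\<And>x. (f has_vector_derivative f' x) (at x)" "smooth_upto_UNIV n f'"
    "\<And>x. (g has_vector_derivative g' x) (at x)" "smooth_upto_UNIV n g'" by auto
  then show ?case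
    using Suc.IH[OF d(2,4)] by (auto intro!: exI[of _ "\<lambda>x. f' x + g' x"] has_vector_derivative_add)
qed simp

lemma smooth_upto_UNIV_mult: "smooth_upto_UNIV n f \<Longrightarrow> smooth_upto_UNIV n g \<Longrightarrow> smooth_upto_UNIV n (\<lambda>x. f x * g x)"
proof (induction n arbitrary: f g)
  case (Suc n)
  then obtain f' g' where d: "\<And>x. (f has_vector_derivative f' x) (at x)" "smooth_upto_UNIV n f'"
    "\<And>x. (g has_vector_derivative g' x) (at x)" "smooth_upto_UNIV n g'" by auto
  have "smooth_upto_UNIV n (\<lambda>x. f x * g' x + f' x * g x)"
    using d Suc.prems[THEN smooth_upto_UNIV_Suc] by (intro smooth_upto_UNIV_add Suc.IH)
  then show ?case
    using has_vector_derivative_mult[OF d(1,3)] by (auto intro!: exI[of _ "\<lambda>x. f x * g' x + f' x * g x"])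
qed simp

lemma smooth_upto_UNIV_affine: "smooth_upto_UNIV n f \<Longrightarrow> smooth_upto_UNIV n (\<lambda>x. f (a * x + b))"
proof (induction n arbitrary: f)
  case (Suc n)
  then obtain f' where d: "\<And>x. (f has_vector_derivative f' x) (at x)" "smooth_upto_UNIV n f'" by auto
  have "((\<lambda>x. f (a * x + b)) has_vector_derivative of_real a * f' (a * x + b)) (at x)" for x
  proof -
    have "((\<lambda>x. a * x + b) has_real_derivative a) (at x)" by (auto intro!: derivative_eq_intros)
    then have "((\<lambda>x. a * x + b) has_vector_derivative a) (at x)"
      by (simp add: has_real_derivative_iff_has_vector_derivative)
    from vector_diff_chain_at[OF this d(1)[of "a * x + b"]]
    show ?thesis by (simp add: o_def scaleR_conv_of_real)
  qed
  moreover have "smooth_upto_UNIV n (\<lambda>x. of_real a * f' (a * x + b))" by (intro smooth_upto_UNIV_mult smooth_upto_UNIV_const Suc.IH d)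
  ultimately show ?case by (auto intro!: exI[of _ "\<lambda>x. of_real a * f' (a * x + b)"])
qed simp

lemma smooth_upto_UNIV_polynomial: "polynomial_function f \<Longrightarrow> smooth_upto_UNIV n f"
proof (induction n arbitrary: f)
  case (Suc n)
  obtain p' where "polynomial_function p'" "\<And>x. (f has_vector_derivative p' x) (at x)"
    using has_vector_derivative_polynomial_function[OF Suc.prems] by blast
  then show ?case using Suc.IH by auto
qed simp

text \<open>The classical flat function exp(-1/x), with polynomial factors in 1/x so that the family
  is closed under differentiation.\<close>

definition flat :: "real poly \<Rightarrow> real \<Rightarrow> complex" where
  "flat q x = (if x > 0 then of_real (poly q (1 / x) * exp (- 1 / x)) else 0)"

lemma poly_exp_tendsto_0: "((\<lambda>y. poly q y * exp (- y)) \<longlongrightarrow> 0) (at_top :: real filter)"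
proof -
  have "((\<lambda>y. \<Sum>i\<le>degree q. coeff q i * (y ^ i / exp y)) \<longlongrightarrow> (\<Sum>i\<le>degree q. coeff q i * 0)) at_top"
    by (intro tendsto_intros tendsto_power_div_exp_0)
  then show ?thesis
    by (simp add: poly_altdef exp_minus divide_inverse sum_distrib_right mult.assoc)
qed

text \<open>With y = 1/x the derivative in x is -y^2 d/dy, which sends q(y) exp(-y) to y^2 (q -
  q')(y) exp(-y). At the origin the right difference quotient has the polynomial y q in place of q
  and tends to 0 by the decay of the exponential.\<close>

lemma flat_has_derivative:
  "(flat q has_vector_derivative flat ([:0, 0, 1:] * (q - pderiv q)) x) (at x)"
proof -
  define q' where "q' = [:0, 0, 1:] * (q - pderiv q)"
  consider "x > 0" | "x < 0" | "x = 0" by linarith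
  then have "(flat q has_vector_derivative flat q' x) (at x)"
  proof cases
    case 1
    have "((\<lambda>x. poly q (1 / x) * exp (- 1 / x)) has_real_derivative
       poly (pderiv q) (1 / x) * (- 1 / x\<^sup>2) * exp (- 1 / x) + poly q (1 / x) * (exp (- 1 / x) * (1 / x\<^sup>2))) (at x)"
      using 1 by (auto intro!: derivative_eq_intros DERIV_chain2[OF poly_DERIV] simp: power2_eq_square)
    also have "poly (pderiv q) (1 / x) * (- 1 / x\<^sup>2) * exp (- 1 / x) + poly q (1 / x) * (exp (- 1 / x) * (1 / x\<^sup>2))
        = poly q' (1 / x) * exp (- 1 / x)"
      by (simp add: q'_def algebra_simps power2_eq_square)
    finally have "((\<lambda>x. complex_of_real (poly q (1 / x) * exp (- 1 / x))) has_vector_derivative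
       complex_of_real (poly q' (1 / x) * exp (- 1 / x))) (at x)"
      by (intro has_vector_derivative_of_real) (simp add: has_real_derivative_iff_has_vector_derivative)
    then have "(flat q has_vector_derivative complex_of_real (poly q' (1 / x) * exp (- 1 / x))) (at x)"
      by (rule has_vector_derivative_transform_within_open[where S = "{0<..}"]) (use 1 in \<open>auto simp: flat_def\<close>)
    then show ?thesis using 1 by (simp add: flat_def)
  next
    case 2
    have "((\<lambda>_. 0) has_vector_derivative (0 :: complex)) (at x)" by simp
    then have "(flat q has_vector_derivative 0) (at x)"
      by (rule has_vector_derivative_transform_within_open[where S = "{..<0}"]) (use 2 in \<open>auto simp: flat_def\<close>)
    then show ?thesis using 2 by (simp add: flat_def)
  next
    case 3
    have r: "((\<lambda>h. flat q h / of_real h) \<longlongrightarrow> 0) (at_right 0)"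
    proof -
      have "((\<lambda>h. poly ([:0, 1:] * q) (1 / h) * exp (- (1 / h))) \<longlongrightarrow> 0) (at_right (0 :: real))"
        using filterlim_compose[OF poly_exp_tendsto_0 filterlim_inverse_at_top_right, of "[:0, 1:] * q"]
        by (simp add: inverse_eq_divide)
      then have "((\<lambda>h. complex_of_real (poly ([:0, 1:] * q) (1 / h) * exp (- (1 / h)))) \<longlongrightarrow> of_real 0) (at_right 0)"
        by (rule tendsto_of_real)
      then have "((\<lambda>h. complex_of_real (poly ([:0, 1:] * q) (1 / h) * exp (- (1 / h)))) \<longlongrightarrow> 0) (at_right 0)" by simp
      then show ?thesis
      proof (rule Lim_transform_eventually)
        show "\<forall>\<^sub>F h in at_right 0. complex_of_real (poly ([:0, 1:] * q) (1 / h) * exp (- (1 / h))) = flat q h / of_real h"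
          using eventually_at_right_less[of "0 :: real"] by eventually_elim (simp add: flat_def)
      qed
    qed
    have l: "((\<lambda>h. flat q h / of_real h) \<longlongrightarrow> 0) (at_left 0)"
      by (rule tendsto_eventually) (auto simp: flat_def eventually_at_filter)
    have "((\<lambda>h. flat q h / of_real h) \<longlongrightarrow> 0) (at 0)" using l r by (simp add: filterlim_split_at)
    then have "((\<lambda>h. norm (flat q h) / \<bar>h\<bar>) \<longlongrightarrow> 0) (at 0)"
      using tendsto_norm_zero by (fastforce simp: norm_divide)
    then have "((\<lambda>h. norm (flat q h /\<^sub>R \<bar>h\<bar>)) \<longlongrightarrow> 0) (at 0)"
      by (simp add: divide_inverse mult.commute)
    then have "((\<lambda>h. flat q h /\<^sub>R \<bar>h\<bar>) \<longlongrightarrow> 0) (at 0)" by (rule tendsto_norm_zero_cancel)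
    then show ?thesis
      unfolding 3 has_vector_derivative_def has_derivative_def
      by (simp add: flat_def[of _ 0] bounded_linear_zero)
  qed
  then show ?thesis by (simp add: q'_def)
qed

lemma smooth_upto_UNIV_flat: "smooth_upto_UNIV n (flat q)"
proof (induction n arbitrary: q)
  case (Suc n)
  then show ?case using flat_has_derivative by auto
qed simp

text \<open>The two factors vanish to the left of 1/m and to the right of 1 - 1/m; m starts at 3, so
  that room is left in between. The factor m^2 drives both arguments to infinity inside the
  interval, where \<open>flat 1\<close> tends to 1.\<close>

definition cutoff :: "nat \<Rightarrow> real \<Rightarrow> complex" where
  "cutoff n x = (let m = real (n + 3) in
     flat 1 (m\<^sup>2 * x + (- m)) * flat 1 (- (m\<^sup>2) * x + (m\<^sup>2 - m)))"

lemma smooth_upto_UNIV_cutoff: "smooth_upto_UNIV k (cutoff n)"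
  unfolding cutoff_def Let_def by (intro smooth_upto_UNIV_mult smooth_upto_UNIV_affine smooth_upto_UNIV_flat)

lemma norm_flat_1_le: "cmod (flat 1 x) \<le> 1" by (simp add: flat_def)

lemma cutoff_eq_0:
  assumes "x \<notin> {1 / real (n + 3)..1 - 1 / real (n + 3)}"
  shows "cutoff n x = 0"
proof -
  define m where "m = real (n + 3)"
  have m: "m > 0" by (simp add: m_def)
  have "m\<^sup>2 * x + (- m) \<le> 0 \<or> - (m\<^sup>2) * x + (m\<^sup>2 - m) \<le> 0"
  proof (cases "x < 1 / m")
    case True
    then have "m * x < 1" using m by (simp add: field_simps)
    then have "m * (m * x) \<le> m * 1" using m by (intro mult_left_mono) auto
    then show ?thesis by (simp add: power2_eq_square)
  next
    case False
    then have "x > 1 - 1 / m" using assms by (auto simp: m_def)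
    then have "m * x > m - 1" using m by (simp add: field_simps)
    then have "m * (m * x) \<ge> m * (m - 1)" using m by (intro mult_left_mono) auto
    then show ?thesis by (simp add: power2_eq_square algebra_simps)
  qed
  then show ?thesis unfolding cutoff_def Let_def m_def[symmetric] by (auto simp: flat_def)
qed

lemma test_fun_cutoff_mult:
  assumes "\<And>k. smooth_upto_UNIV k f"
  shows "test_fun (\<lambda>x. cutoff n x * f x)"
  unfolding test_fun_def
proof
  show "smooth_on UNIV (\<lambda>x. cutoff n x * f x)"
    by (intro smooth_upto_UNIV_imp_smooth_on smooth_upto_UNIV_mult smooth_upto_UNIV_cutoff assms)
  show "\<exists>a b. 0 < a \<and> b < 1 \<and> (\<forall>x. x \<notin> {a..b} \<longrightarrow> cutoff n x * f x = 0)"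
    by (rule exI[of _ "1 / real (n + 3)"], rule exI[of _ "1 - 1 / real (n + 3)"])
       (auto simp: cutoff_eq_0 simp del: atLeastAtMost_iff)
qed

lemma flat_1_tendsto: "(flat 1 \<longlongrightarrow> 1) at_top"
proof -
  have "((\<lambda>x. complex_of_real (exp (- (1 / x)))) \<longlongrightarrow> of_real (exp (- 0))) at_top"
    by (intro tendsto_intros tendsto_divide_0[OF tendsto_const] filterlim_at_top_imp_at_infinity filterlim_ident)
  then have "((\<lambda>x. complex_of_real (exp (- (1 / x)))) \<longlongrightarrow> 1) at_top" by simp
  then show ?thesis
  proof (rule Lim_transform_eventually)
    show "\<forall>\<^sub>F x in at_top. complex_of_real (exp (- (1 / x))) = flat 1 x"
      using eventually_gt_at_top[of 0] by eventually_elim (simp add: flat_def)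
  qed
qed

lemma cutoff_tendsto:
  assumes "0 < x" "x < 1"
  shows "(\<lambda>n. cutoff n x) \<longlonglongrightarrow> 1"
proof -
  have lim: "filterlim (\<lambda>n. (real (n + 3))\<^sup>2 * y + (- real (n + 3))) at_top sequentially" if "y > 0" for y :: real
  proof -
    have m: "filterlim (\<lambda>n. real (n + 3)) at_top sequentially"
      by (rule filterlim_compose[OF filterlim_real_sequentially]) (rule filterlim_add_const_nat_at_top)
    have "filterlim (\<lambda>n. -1 + y * real (n + 3)) at_top sequentially"
      by (intro filterlim_tendsto_add_at_top[OF tendsto_const] filterlim_tendsto_pos_mult_at_top[OF tendsto_const] that m)
    from filterlim_at_top_mult_at_top[OF m this] show ?thesis
      by (simp add: power2_eq_square algebra_simps)
  qed
  have "(\<lambda>n. flat 1 ((real (n + 3))\<^sup>2 * x + (- real (n + 3))) *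
      flat 1 ((real (n + 3))\<^sup>2 * (1 - x) + (- real (n + 3)))) \<longlonglongrightarrow> 1 * 1"
    using assms by (intro tendsto_mult filterlim_compose[OF flat_1_tendsto] lim) auto
  moreover have "cutoff n x = flat 1 ((real (n + 3))\<^sup>2 * x + (- real (n + 3))) *
      flat 1 ((real (n + 3))\<^sup>2 * (1 - x) + (- real (n + 3)))" for n
    unfolding cutoff_def Let_def by (simp only: right_diff_distrib) (simp add: algebra_simps)
  ultimately show ?thesis by simp
qed

lemma norm_cutoff_le: "cmod (cutoff n x) \<le> 1"
  unfolding cutoff_def Let_def norm_mult by (intro mult_le_one norm_flat_1_le norm_ge_zero)

section \<open>Calculus with test functions and their density\<close>

lemma test_fun_nderiv:
  assumes "test_fun \<theta>"
  shows "test_fun (nderiv UNIV (Suc 0) \<theta>)"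
proof -
  have s: "smooth_on UNIV \<theta>" using assms by (simp add: test_fun_def)
  obtain a b where ab: "0 < a" "b < 1" "\<And>x. x \<notin> {a..b} \<Longrightarrow> \<theta> x = 0"
    using assms unfolding test_fun_def by blast
  have "nderiv UNIV (Suc 0) \<theta> x = 0" if "x \<notin> {a..b}" for x
  proof -
    have "((\<lambda>_. 0) has_vector_derivative (0 :: complex)) (at x)" by simp
    then have "(\<theta> has_vector_derivative 0) (at x)"
      by (rule has_vector_derivative_transform_within_open[where S = "- {a..b}"])
         (use that ab(3) in \<open>auto simp: open_Compl\<close>)
    then show ?thesis by (simp add: vector_derivative_at)
  qed
  moreover have "smooth_on UNIV (nderiv UNIV (Suc 0) \<theta>)"
    using s unfolding smooth_on_def nderiv_shift by blast
  ultimately show ?thesis using ab unfolding test_fun_def by blast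
qed

lemma test_fun_nderiv_n: "test_fun \<theta> \<Longrightarrow> test_fun (nderiv UNIV j \<theta>)"
proof (induction j)
  case (Suc j)
  from test_fun_nderiv[OF Suc.IH[OF Suc.prems]] show ?case by simp
qed simp

lemma test_fun_0_1: "test_fun \<theta> \<Longrightarrow> \<theta> 0 = 0" "test_fun \<theta> \<Longrightarrow> \<theta> 1 = 0"
  unfolding test_fun_def by force+

lemma test_fun_derivative: "test_fun \<theta> \<Longrightarrow> (\<theta> has_vector_derivative nderiv UNIV (Suc 0) \<theta> x) (at x)"
  unfolding test_fun_def smooth_on_def
  by (auto simp: vector_derivative_works[symmetric] dest: spec[of _ 0])

lemma test_fun_continuous: "test_fun \<theta> \<Longrightarrow> continuous_on S \<theta>"
  by (meson test_fun_derivative continuous_on_vector_derivative has_vector_derivative_at_within)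

lemma test_fun_C1d: "test_fun \<theta> \<Longrightarrow> C1d \<theta> (nderiv UNIV (Suc 0) \<theta>)"
  unfolding C1d_def
  by (auto intro!: test_fun_continuous test_fun_nderiv has_vector_derivative_at_within test_fun_derivative
      simp del: nderiv.simps(2))

lemma test_fun_L2: "test_fun \<theta> \<Longrightarrow> \<theta> \<in> L2"
  by (intro L2_continuous test_fun_continuous)

text \<open>Cutoffs times a polynomial are test functions, and they converge to the polynomial by
  dominated convergence, the end points being a null set.\<close>

lemma closure_test_fun: "closure (cl ` {\<theta>. test_fun \<theta>}) = UNIV"
proof -
  have "cl f \<in> closure (cl ` {\<theta>. test_fun \<theta>})" if f: "polynomial_function f" for f
  proof -
    have c: "continuous_on {0..1} f" using f by (rule continuous_on_polymonial_function)
    have s: "\<And>k. smooth_upto_UNIV k f" using f by (rule smooth_upto_UNIV_polynomial)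
    have "(\<lambda>n. cl (\<lambda>x. cutoff n x * f x)) \<longlonglongrightarrow> cl f"
    proof (rule cl_tendsto_dominated[where w = f])
      show "(\<lambda>x. cutoff n x * f x) \<in> borel_measurable M01" for n
        by (intro L2_measurable test_fun_L2 test_fun_cutoff_mult s)
      show "f \<in> L2" by (intro L2_continuous c)
      then show "f \<in> borel_measurable M01" by (rule L2_measurable)
      show "cmod (cutoff n x * f x) \<le> cmod (f x)" for n x
        unfolding norm_mult by (rule mult_left_le_one_le) (auto simp: norm_cutoff_le)
      have "AE x in lborel. x \<noteq> 0" "AE x in lborel. x \<noteq> (1 :: real)"
        by (rule AE_lborel_singleton)+
      then have "AE x in lborel. x \<in> {0..1} \<longrightarrow> (\<lambda>n. cutoff n x * f x) \<longlonglongrightarrow> f x"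
      proof eventually_elim
        case (elim x)
        then show ?case using tendsto_mult[OF cutoff_tendsto[of x] tendsto_const[of "f x"]] by auto
      qed
      then show "AE x in M01. (\<lambda>n. cutoff n x * f x) \<longlonglongrightarrow> f x"
        by (subst AE_restrict_space_iff) auto
    qed
    then show ?thesis unfolding closure_sequential
      by (intro exI[of _ "\<lambda>n. cl (\<lambda>x. cutoff n x * f x)"]) (auto intro: test_fun_cutoff_mult s)
  qed
  then have "closure (cl ` {f. polynomial_function f}) \<subseteq> closure (cl ` {\<theta>. test_fun \<theta>})"
    by (intro closure_minimal) auto
  then show ?thesis by (auto simp: closure_polynomial)
qed

lemma pr_test_eq_0:
  assumes "\<And>\<theta>. test_fun \<theta> \<Longrightarrow> pr h (cl \<theta>) = 0"
  shows "h = 0"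
proof (rule pr_eq_0_imp)
  fix w
  have "closed {w. pr h w = 0}" by (intro closed_Collect_eq continuous_intros)
  then have "closure (cl ` {\<theta>. test_fun \<theta>}) \<subseteq> {w. pr h w = 0}"
    by (intro closure_minimal) (auto simp: assms)
  then show "pr h w = 0" by (auto simp: closure_test_fun)
qed

section \<open>Weak derivatives\<close>

lemma has_D_imp_weak:
  assumes "has_D u g" "test_fun \<theta>"
  shows "pr u (cl (nderiv UNIV (Suc 0) \<theta>)) = - pr g (cl \<theta>)"
proof -
  let ?t = "cl (nderiv UNIV (Suc 0) \<theta>)"
  obtain c where u: "u = cst c + prim g" using assms(1) by (auto simp: has_D_def)
  have t: "C1d \<theta> (nderiv UNIV (Suc 0) \<theta>)" by (rule test_fun_C1d[OF assms(2)])
  have p: "prim ?t = cl \<theta>" using t test_fun_0_1(1)[OF assms(2)] by (rule prim_antiderivative)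
  have 0: "pr ?t (cst 1) = 0"
    using integ_C1d[OF t, of 1] test_fun_0_1[OF assms(2)] by (simp add: integ_1)
  have "pr (cst c) ?t = c * pr ?t (cst 1)" by (subst cst_eq_csc) (simp add: pr_csc pr_sym)
  then have "pr u ?t = pr (prim g) ?t" using 0 by (simp add: u pr.add_left)
  also have "\<dots> = - pr g (prim ?t)" using pr_prim[of g ?t] unfolding 0 by (simp add: add_eq_0_iff)
  finally show ?thesis by (simp only: p)
qed

lemma smooth_on_UNIV_imp_smooth_upto_UNIV: "smooth_on UNIV f \<Longrightarrow> smooth_upto_UNIV n f"
proof (induction n arbitrary: f)
  case (Suc n)
  have "smooth_on UNIV (nderiv UNIV (Suc 0) f)"
    using Suc.prems unfolding smooth_on_def nderiv_shift by blast
  moreover have "(f has_vector_derivative nderiv UNIV (Suc 0) f x) (at x)" for x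
    using Suc.prems unfolding smooth_on_def by (auto simp: vector_derivative_works[symmetric] dest: spec[of _ 0])
  ultimately show ?case using Suc.IH by (auto simp del: nderiv.simps(2))
qed simp

lemma test_fun_lincomb:
  assumes "test_fun \<psi>" "test_fun \<eta>"
  shows "test_fun (\<lambda>x. \<psi> x + c * \<eta> x)"
proof -
  obtain a b where ab: "0 < a" "b < 1" "\<And>x. x \<notin> {a..b} \<Longrightarrow> \<psi> x = 0"
    using assms(1) unfolding test_fun_def by blast
  obtain a' b' where ab': "0 < a'" "b' < 1" "\<And>x. x \<notin> {a'..b'} \<Longrightarrow> \<eta> x = 0"
    using assms(2) unfolding test_fun_def by blast
  have "\<psi> x + c * \<eta> x = 0" if "x \<notin> {min a a'..max b b'}" for x
  proof -
    have "x \<notin> {a..b}" "x \<notin> {a'..b'}" using that unfolding atLeastAtMost_iff min_le_iff_disj le_max_iff_disj by blast+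
    then show ?thesis using ab(3) ab'(3) by simp
  qed
  then have "\<exists>a b. 0 < a \<and> b < 1 \<and> (\<forall>x. x \<notin> {a..b} \<longrightarrow> \<psi> x + c * \<eta> x = 0)"
    using ab ab' by (intro exI[of _ "min a a'"] exI[of _ "max b b'"]) (auto simp: min_def max_def)
  moreover have "smooth_on UNIV (\<lambda>x. \<psi> x + c * \<eta> x)"
    by (rule smooth_upto_UNIV_imp_smooth_on, intro smooth_upto_UNIV_add smooth_upto_UNIV_mult smooth_upto_UNIV_const; rule smooth_on_UNIV_imp_smooth_upto_UNIV)
       (use assms in \<open>simp_all add: test_fun_def\<close>)
  ultimately show ?thesis by (simp add: test_fun_def)
qed

text \<open>The primitive from 0 vanishes to the left of the support; to the right of it the
  primitive is constant and equal to its value at 1, which is 0 by the mean condition.\<close>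

lemma test_fun_antiderivative:
  assumes "test_fun \<xi>" "integ (cl \<xi>) 1 = 0"
  obtains \<theta> where "test_fun \<theta>" "nderiv UNIV (Suc 0) \<theta> = \<xi>"
proof -
  obtain a b where ab: "0 < a" "b < 1" "\<And>x. x \<notin> {a..b} \<Longrightarrow> \<xi> x = 0"
    using assms(1) unfolding test_fun_def by blast
  have c: "continuous_on S \<xi>" for S by (rule test_fun_continuous[OF assms(1)])
  have int: "\<xi> integrable_on {x..y}" for x y by (intro integrable_continuous_interval c)
  define F where "F x = integral {0..x} \<xi>" for x
  have F0: "F x = 0" if "x < a" for x
  proof -
    have "integral {0..x} \<xi> = integral {0..x} (\<lambda>_. 0)"
      using that ab(3) by (intro Henstock_Kurzweil_Integration.integral_cong) auto
    then show ?thesis by (simp add: F_def)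
  qed
  have dF: "(F has_vector_derivative \<xi> x) (at x)" for x
  proof (cases "x < a")
    case True
    have "((\<lambda>_. 0) has_vector_derivative (0 :: complex)) (at x)" by simp
    then have "(F has_vector_derivative 0) (at x)"
      by (rule has_vector_derivative_transform_within_open[where S = "{..<a}"]) (use True F0 in auto)
    then show ?thesis using True ab(3)[of x] by simp
  next
    case False
    then have "x \<in> {0..x+1}" "at x within {0..x+1} = at x" using ab(1) by (auto intro!: at_within_Icc_at)
    then show ?thesis
      using integral_has_vector_derivative[OF c, of x 0 "x + 1"] by (simp add: F_def[abs_def])
  qed
  have "C1d F \<xi>" unfolding C1d_def by (auto intro: c has_vector_derivative_at_within dF)
  then have F1: "F 1 = 0" using integ_C1d[of F \<xi> 1] assms(2) F0[of 0] ab(1) by simp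
  \<comment> \<open>Nothing in \<open>test_fun\<close> prevents b from lying below a or below 0; the
    maximum keeps the interval of integration meaningful.\<close>
  have Fb: "F x = integral {0..max 0 b} \<xi>" if "x > b" for x
  proof (cases "x \<le> max 0 b")
    case True
    then have "x < a" "b < x" using that ab(1) by (auto simp: max_def split: if_splits)
    then show ?thesis using F0[of x] F0[of "max 0 b"] ab(1) that by (auto simp: F_def max_def)
  next
    case False
    have "integral {0..max 0 b} \<xi> + integral {max 0 b..x} \<xi> = integral {0..x} \<xi>"
      using False by (intro Henstock_Kurzweil_Integration.integral_combine int) auto
    moreover have "integral {max 0 b..x} \<xi> = integral {max 0 b..x} (\<lambda>_. 0)"
      by (rule integral_spike[of "{b}"]) (use ab(3) in auto)
    ultimately show ?thesis by (simp add: F_def)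
  qed
  have F2: "F x = 0" if "x > b" for x using Fb[OF that] Fb[of 1] F1 ab(2) by simp
  have n1: "nderiv UNIV (Suc 0) F = \<xi>" using dF by (auto intro: vector_derivative_at)
  have "smooth_upto_UNIV n F" for n
  proof (cases n)
    case (Suc m)
    have "smooth_upto_UNIV m \<xi>" using assms(1) by (intro smooth_on_UNIV_imp_smooth_upto_UNIV) (simp add: test_fun_def)
    then show ?thesis using dF Suc by auto
  qed simp
  then have "test_fun F"
    unfolding test_fun_def using ab F0 F2
    by (intro conjI smooth_upto_UNIV_imp_smooth_on exI[of _ a] exI[of _ b]) (auto simp: not_le)
  then show thesis using n1 by (rule that)
qed

lemma pr_cst_left: "pr (cst c) w = c * pr (cst 1) w"
  by (subst cst_eq_csc) (simp add: pr_csc)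

text \<open>The lemma of du Bois-Reymond.\<close>

lemma weak_imp_has_D:
  assumes "\<And>\<theta>. test_fun \<theta> \<Longrightarrow> pr u (cl (nderiv UNIV (Suc 0) \<theta>)) = - pr g (cl \<theta>)"
  shows "has_D u g"
proof -
  define h where "h = u - prim g"
  have h0: "pr h (cl (nderiv UNIV (Suc 0) \<theta>)) = 0" if "test_fun \<theta>" for \<theta>
    using assms[OF that] has_D_imp_weak[OF has_D_prim that, of g] by (simp only: h_def pr.diff_left) simp
  have "\<exists>\<eta>. test_fun \<eta> \<and> pr (cst 1) (cl \<eta>) \<noteq> 0"
  proof (rule ccontr)
    assume "\<not> ?thesis"
    then have "cst 1 = 0" by (intro pr_test_eq_0) auto
    then show False using pr_cst[of 1] by (simp add: pr.zero_left)
  qed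
  then obtain \<eta> where \<eta>: "test_fun \<eta>" "pr (cst 1) (cl \<eta>) \<noteq> 0" by blast
  \<comment> \<open>The constant for which \<open>h - cst e\<close> annihilates \<eta>; it becomes
    the constant term of u.\<close>
  define e where "e = pr h (cl \<eta>) / pr (cst 1) (cl \<eta>)"
  have "pr (h - cst e) (cl \<psi>) = 0" if \<psi>: "test_fun \<psi>" for \<psi>
  proof -
    \<comment> \<open>Chosen so that \<psi> + d \<eta> has mean zero and is thus the derivative of a
      test function.\<close>
    define d where "d = - pr (cst 1) (cl \<psi>) / pr (cst 1) (cl \<eta>)"
    define \<xi> where "\<xi> x = \<psi> x + d * \<eta> x" for x
    have t: "test_fun \<xi>" unfolding \<xi>_def by (rule test_fun_lincomb[OF \<psi> \<eta>(1)])
    have cl: "cl \<xi> = cl \<psi> + csc d (cl \<eta>)"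
      by (simp add: \<xi>_def[abs_def] cl_add mul_cl test_fun_L2 \<psi> \<eta>(1) L2_cmult)
    have p: "pr w (cl \<xi>) = pr w (cl \<psi>) + d * pr w (cl \<eta>)" for w
      unfolding cl pr.add_right by (simp add: pr_csc pr_sym[of w])
    have "integ (cl \<xi>) 1 = 0"
      using \<eta>(2) unfolding integ_1 pr_sym[of _ "cst 1"] p by (simp add: d_def)
    then obtain \<theta> where "test_fun \<theta>" "nderiv UNIV (Suc 0) \<theta> = \<xi>"
      using test_fun_antiderivative[OF t] by blast
    then have "pr h (cl \<xi>) = 0" using h0 by metis
    then have "pr h (cl \<psi>) = - d * pr h (cl \<eta>)" by (simp add: p add_eq_0_iff2)
    then show ?thesis unfolding pr.diff_left pr_cst_left[of e] using \<eta>(2) by (simp add: e_def d_def)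
  qed
  then have "h - cst e = 0" by (rule pr_test_eq_0)
  then have "u = cst e + prim g" by (simp add: h_def algebra_simps)
  then show ?thesis by (auto simp: has_D_def)
qed

lemma weak_funpow_D:
  assumes "u \<in> HS j" "test_fun \<theta>"
  shows "pr u (cl (nderiv UNIV j \<theta>)) = (-1) ^ j * pr ((D ^^ j) u) (cl \<theta>)"
  using assms
proof (induction j arbitrary: u)
  case (Suc j)
  have "pr u (cl (nderiv UNIV (Suc j) \<theta>)) = - pr (D u) (cl (nderiv UNIV j \<theta>))"
    using has_D_imp_weak[OF HS_has_D[OF Suc.prems(1)] test_fun_nderiv_n[OF Suc.prems(2), of j]] by simp
  then show ?case using Suc.IH[OF HS_D[OF Suc.prems(1)] Suc.prems(2)] by (simp add: funpow_swap1)
qed simp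

lemma is_wderiv_iff_pr:
  assumes "u \<in> L2" "g \<in> L2"
  shows "is_wderiv j u g \<longleftrightarrow>
    (\<forall>\<theta>. test_fun \<theta> \<longrightarrow> pr (cl u) (cl (nderiv UNIV j \<theta>)) = (-1) ^ j * pr (cl g) (cl \<theta>))"
  unfolding is_wderiv_def
  by (intro iff_allI imp_cong refl) (simp add: pr_cl assms test_fun_L2 test_fun_nderiv_n)

lemma is_wderiv_unique:
  assumes "u \<in> L2" "g \<in> L2" "g' \<in> L2" "is_wderiv j u g" "is_wderiv j u g'"
  shows "cl g = cl g'"
proof -
  have "cl g - cl g' = 0"
  proof (rule pr_test_eq_0)
    fix \<theta> assume "test_fun \<theta>"
    then have "(-1) ^ j * pr (cl g) (cl \<theta>) = (-1) ^ j * pr (cl g') (cl \<theta>)"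
      using assms by (simp add: is_wderiv_iff_pr)
    then show "pr (cl g - cl g') (cl \<theta>) = 0" by (simp add: pr.diff_left)
  qed
  then show ?thesis by simp
qed

lemma is_wderiv_D:
  assumes "u \<in> L2" "g \<in> L2" "cl u \<in> HS j"
  shows "is_wderiv j u g \<longleftrightarrow> cl g = (D ^^ j) (cl u)"
proof
  assume "cl g = (D ^^ j) (cl u)"
  then show "is_wderiv j u g" using weak_funpow_D[OF assms(3)] by (simp add: is_wderiv_iff_pr assms)
next
  assume w: "is_wderiv j u g"
  obtain g' where g': "g' \<in> L2" "(D ^^ j) (cl u) = cl g'" by (rule cl_cases)
  then have "is_wderiv j u g'"
    using weak_funpow_D[OF assms(3)] by (simp add: is_wderiv_iff_pr assms)
  then show "cl g = (D ^^ j) (cl u)" using is_wderiv_unique[OF assms(1,2) g'(1) w] g'(2) by simp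
qed

text \<open>The definition of \<open>Sob\<close> compares each weak derivative with u itself.
  Testing with the derivative of \<theta> shows that the one of order j + 1 is the weak derivative
  of the one of order j, and the chain is then assembled from the top order downwards.\<close>

lemma Sob_iff: "u \<in> Sob m \<longleftrightarrow> u \<in> L2 \<and> cl u \<in> HS m"
proof
  assume "u \<in> Sob m"
  then have u: "u \<in> L2" and "\<forall>j\<le>m. \<exists>g\<in>L2. is_wderiv j u g" by (auto simp: Sob_def)
  then obtain g where g: "\<And>j. j \<le> m \<Longrightarrow> g j \<in> L2" "\<And>j. j \<le> m \<Longrightarrow> is_wderiv j u (g j)" by metis
  have "is_wderiv 0 u u" by (simp add: is_wderiv_def)
  then have g0: "cl (g 0) = cl u" using is_wderiv_unique[OF u _ u g(2), of 0] g(1) by simp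
  have has_D: "has_D (cl (g j)) (cl (g (Suc j)))" if "Suc j \<le> m" for j
  proof (rule weak_imp_has_D)
    fix \<theta> assume t: "test_fun \<theta>"
    have "pr (cl u) (cl (nderiv UNIV (Suc j) \<theta>)) = (-1) ^ Suc j * pr (cl (g (Suc j))) (cl \<theta>)"
      using g[OF that] t u is_wderiv_iff_pr by blast
    moreover have "pr (cl u) (cl (nderiv UNIV j (nderiv UNIV (Suc 0) \<theta>))) =
        (-1) ^ j * pr (cl (g j)) (cl (nderiv UNIV (Suc 0) \<theta>))"
      using g[of j] that test_fun_nderiv[OF t] u is_wderiv_iff_pr by (metis Suc_leD)
    ultimately have "(-1) ^ j * pr (cl (g j)) (cl (nderiv UNIV (Suc 0) \<theta>)) =
        (-1) ^ j * - pr (cl (g (Suc j))) (cl \<theta>)"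
      unfolding nderiv_shift by simp
    then show "pr (cl (g j)) (cl (nderiv UNIV (Suc 0) \<theta>)) = - pr (cl (g (Suc j))) (cl \<theta>)"
      by (subst (asm) mult_left_cancel) auto
  qed
  have "cl (g (m - i)) \<in> HS i" if "i \<le> m" for i
    using that
  proof (induction i)
    case (Suc i)
    then have "has_D (cl (g (m - Suc i))) (cl (g (m - i)))"
      using has_D[of "m - Suc i"] by (simp add: Suc_diff_Suc)
    then show ?case using Suc by (auto intro: HS_SucI)
  qed simp
  from this[of m] show "u \<in> L2 \<and> cl u \<in> HS m" using u g0 by simp
next
  assume u: "u \<in> L2 \<and> cl u \<in> HS m"
  have "\<exists>g\<in>L2. is_wderiv j u g" if "j \<le> m" for j
  proof -
    obtain g where "g \<in> L2" "(D ^^ j) (cl u) = cl g" by (rule cl_cases)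
    then show ?thesis using is_wderiv_D[of u g j] u HS_mono[OF _ that] by (intro bexI[of _ g]) auto
  qed
  then show "u \<in> Sob m" using u by (simp add: Sob_def)
qed

lemma Sob_L2: "u \<in> Sob m \<Longrightarrow> u \<in> L2" by (simp add: Sob_def)
lemma Sob_HS: "u \<in> Sob m \<Longrightarrow> cl u \<in> HS m" by (simp add: Sob_iff)

lemma wderiv:
  assumes "u \<in> Sob m" "j \<le> m"
  shows "wderiv j u \<in> L2" "cl (wderiv j u) = (D ^^ j) (cl u)"
proof -
  have u: "u \<in> L2" "cl u \<in> HS j" using assms HS_mono by (auto simp: Sob_iff)
  have "\<exists>g. g \<in> L2 \<and> is_wderiv j u g" using assms by (auto simp: Sob_def)
  then have w: "wderiv j u \<in> L2 \<and> is_wderiv j u (wderiv j u)" unfolding wderiv_def by (rule someI_ex)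
  then show "wderiv j u \<in> L2" by simp
  show "cl (wderiv j u) = (D ^^ j) (cl u)" using is_wderiv_D[OF u(1) _ u(2), of "wderiv j u"] w by blast
qed

lemma Sob_norm_eq: "u \<in> Sob m \<Longrightarrow> Sob_norm m u = sqrt (\<Sum>j\<le>m. (norm ((D ^^ j) (cl u)))\<^sup>2)"
  unfolding Sob_norm_def by (simp add: wderiv[of u m] flip: norm_cl)

lemma Sob_norm_nonneg: "0 \<le> Sob_norm m u"
  by (simp add: Sob_norm_def sum_nonneg)

lemma Sob_norm_le_HS_norm: "u \<in> Sob m \<Longrightarrow> Sob_norm m u \<le> HS_norm m (cl u)"
  using L2_set_le_sum[of "{..m}" "\<lambda>j. norm ((D ^^ j) (cl u))"]
  by (simp add: Sob_norm_eq HS_norm_eq_sum L2_set_def)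

text \<open>Each of the m + 1 summands is at most the Euclidean norm of them all.\<close>

lemma HS_norm_le_Sob_norm:
  assumes "u \<in> Sob m"
  shows "HS_norm m (cl u) \<le> (real m + 1) * Sob_norm m u"
proof -
  have "norm ((D ^^ j) (cl u)) \<le> Sob_norm m u" if "j \<le> m" for j
    unfolding Sob_norm_eq[OF assms]
    by (rule real_le_rsqrt, rule member_le_sum) (use that in auto)
  then have "HS_norm m (cl u) \<le> (\<Sum>j\<le>m. Sob_norm m u)" unfolding HS_norm_eq_sum by (intro sum_mono) auto
  then show ?thesis by (simp add: add.commute)
qed

lemma Sob_norm_tendsto_iff:
  assumes "\<And>s. f s \<in> Sob m"
  shows "((\<lambda>s. Sob_norm m (f s)) \<longlongrightarrow> 0) F \<longleftrightarrow> ((\<lambda>s. HS_norm m (cl (f s))) \<longlongrightarrow> 0) F"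
proof
  assume "((\<lambda>s. Sob_norm m (f s)) \<longlongrightarrow> 0) F"
  then have "((\<lambda>s. (real m + 1) * Sob_norm m (f s)) \<longlongrightarrow> 0) F" by (rule tendsto_mult_right_zero)
  then show "((\<lambda>s. HS_norm m (cl (f s))) \<longlongrightarrow> 0) F"
    by (rule Lim_null_comparison[rotated]) (simp add: HS_norm_le_Sob_norm assms)
next
  assume "((\<lambda>s. HS_norm m (cl (f s))) \<longlongrightarrow> 0) F"
  then show "((\<lambda>s. Sob_norm m (f s)) \<longlongrightarrow> 0) F"
    by (rule Lim_null_comparison[rotated])
       (simp add: Sob_norm_le_HS_norm assms Sob_norm_nonneg)
qed

lemma point_value:
  assumes "u \<in> Sob (Suc m)" "z \<in> {0..1}"
  shows "point_value u z = ev (cl u) z"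
  unfolding point_value_def
proof (rule the_equality)
  have e: "eq01 u (ev (cl u))"
    using cl_ev[OF Sob_HS[OF assms(1)]] Sob_L2[OF assms(1)] by (metis L2_ev cl_eq_iff)
  then show "\<exists>w. continuous_on {0..1} w \<and> eq01 u w \<and> w z = ev (cl u) z"
    using continuous_on_ev by blast
  fix c assume "\<exists>w. continuous_on {0..1} w \<and> eq01 u w \<and> w z = c"
  then obtain w where w: "continuous_on {0..1} w" "eq01 u w" "w z = c" by blast
  then have "eq01 w (ev (cl u))" using e eq01_sym eq01_trans by blast
  then show "c = ev (cl u) z"
    using eq01_continuous_imp_eq[OF w(1) continuous_on_ev _ assms(2)] w(3) by blast
qed

section \<open>The Schroedinger operator and its boundary spaces on classes\<close>

definition A :: "(real \<Rightarrow> complex) \<Rightarrow> l2 \<Rightarrow> l2" where "A W u = D (D u) + mul W u"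

lemma smooth_on_continuous:
  assumes "smooth_on {0..1} (f :: real \<Rightarrow> real)"
  shows "continuous_on {0..1} f"
proof -
  have "f differentiable at x within {0..1}" if "x \<in> {0..1}" for x
    using assms that unfolding smooth_on_def by (metis nderiv.simps(1))
  then show ?thesis
    by (simp add: continuous_on_eq_continuous_within differentiable_imp_continuous_within)
qed

lemma smooth_on_C1d:
  fixes f :: "real \<Rightarrow> real"
  assumes "smooth_on {0..1} f"
  shows "C1d (\<lambda>x. of_real (f x)) (\<lambda>x. of_real (nderiv {0..1} (Suc 0) f x))"
    and "smooth_on {0..1} (nderiv {0..1} (Suc 0) f)"
proof -
  show s: "smooth_on {0..1} (nderiv {0..1} (Suc 0) f)"
    using assms unfolding smooth_on_def nderiv_shift by blast
  have "(f has_vector_derivative nderiv {0..1} (Suc 0) f x) (at x within {0..1})" if "x \<in> {0..1}" for x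
    using assms that unfolding smooth_on_def
    by (auto simp: vector_derivative_works[symmetric] dest: spec[of _ 0])
  then show "C1d (\<lambda>x. of_real (f x)) (\<lambda>x. of_real (nderiv {0..1} (Suc 0) f x))"
    unfolding C1d_def using smooth_on_continuous[OF s]
    by (auto intro!: has_vector_derivative_of_real
        simp: has_real_derivative_iff_has_vector_derivative simp del: nderiv.simps(2))
qed

lemma smooth_on_imp_smooth_upto: "smooth_on {0..1} V \<Longrightarrow> smooth_upto m (\<lambda>x. of_real (V x :: real))"
proof (induction m arbitrary: V)
  case 0
  then show ?case by (simp add: continuous_on_of_real smooth_on_continuous)
next
  case (Suc m)
  then show ?case using smooth_on_C1d[OF Suc.prems] Suc.IH by auto
qed

lemma schr_op:
  assumes "smooth_on {0..1} V" "u \<in> Sob (Suc (Suc m))"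
  shows "schr_op V u \<in> Sob m" "cl (schr_op V u) = A (\<lambda>x. of_real (V x)) (cl u)"
proof -
  have c: "continuous_on {0..1} (\<lambda>x. complex_of_real (V x))"
    by (rule smooth_upto_continuous[OF smooth_on_imp_smooth_upto[OF assms(1)]])
  have w: "wderiv 2 u \<in> L2" "cl (wderiv 2 u) = D (D (cl u))"
    using wderiv[OF assms(2), of 2] by (auto simp: numeral_2_eq_2)
  have u: "u \<in> L2" "cl u \<in> HS (Suc (Suc m))" using assms(2) by (auto simp: Sob_iff)
  show cl: "cl (schr_op V u) = A (\<lambda>x. of_real (V x)) (cl u)"
  proof -
    have "cl (schr_op V u) = cl (wderiv 2 u) + cl (\<lambda>x. of_real (V x) * u x)"
      unfolding schr_op_def by (intro cl_add w L2_cont_mult[OF c] u)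
    then show ?thesis unfolding A_def w(2) by (simp only: mul_cl[OF c u(1)])
  qed
  have "schr_op V u \<in> L2" unfolding schr_op_def by (intro L2_add w L2_cont_mult c u)
  moreover have "A (\<lambda>x. of_real (V x)) (cl u) \<in> HS m"
    unfolding A_def using u(2)
    by (intro HS_add sob_bounded_HS[OF sob_bounded_mul[OF smooth_on_imp_smooth_upto[OF assms(1)]]] HS_D) (auto intro: HS_mono)
  ultimately show "schr_op V u \<in> Sob m" by (simp add: Sob_iff cl)
qed

lemma Sob_Dir_iff: "u \<in> Sob_Dir a \<longleftrightarrow> u \<in> L2 \<and> cl u \<in> range (G ^^ a)"
proof -
  have pv: "point_value (wderiv (2 * l) u) z = ev ((D ^^ (2 * l)) (cl u)) z"
    if u: "u \<in> Sob (2 * a)" and l: "l < a" and z: "z \<in> {0..1}" for l z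
  proof -
    have "(D ^^ (2 * l)) (cl u) \<in> HS (Suc (2 * a - 2 * l - 1))"
      by (rule HS_funpow_D) (use Sob_HS[OF u] l in simp)
    then have "wderiv (2 * l) u \<in> Sob (Suc (2 * a - 2 * l - 1))"
      using wderiv[OF u, of "2 * l"] l by (simp add: Sob_iff)
    from point_value[OF this z] show ?thesis using wderiv(2)[OF u, of "2 * l"] l by simp
  qed
  show ?thesis
    unfolding Dirichlet_iff_range_G[symmetric] Sob_Dir_def
    using pv by (auto simp: Sob_iff)
qed

lemma schr_op_funpow:
  assumes "smooth_on {0..1} V" "u \<in> Sob (2 * a)" "l \<le> a"
  shows "(schr_op V ^^ l) u \<in> Sob (2 * (a - l)) \<and>
    cl ((schr_op V ^^ l) u) = (A (\<lambda>x. of_real (V x)) ^^ l) (cl u)"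
  using assms(3)
proof (induction l)
  case (Suc l)
  then have e: "2 * (a - l) = Suc (Suc (2 * (a - Suc l)))" by linarith
  show ?case using schr_op[OF assms(1), of "(schr_op V ^^ l) u" "2 * (a - Suc l)"] Suc by (simp add: e)
qed (use assms(2) in simp)

definition HV :: "(real \<Rightarrow> complex) \<Rightarrow> nat \<Rightarrow> l2 set" where
  "HV W a = {u \<in> HS (2 * a). \<forall>l<a. ev ((A W ^^ l) u) 0 = 0 \<and> ev ((A W ^^ l) u) 1 = 0}"

lemma Sob_V_iff:
  assumes "smooth_on {0..1} V"
  shows "u \<in> Sob_V V a \<longleftrightarrow> u \<in> L2 \<and> cl u \<in> HV (\<lambda>x. of_real (V x)) a"
proof -
  have pv: "point_value ((schr_op V ^^ l) u) z = ev ((A (\<lambda>x. of_real (V x)) ^^ l) (cl u)) z"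
    if u: "u \<in> Sob (2 * a)" and l: "l < a" and z: "z \<in> {0..1}" for l z
  proof -
    have e: "2 * (a - l) = Suc (2 * (a - l) - 1)" using l by simp
    have "(schr_op V ^^ l) u \<in> Sob (Suc (2 * (a - l) - 1))"
      using schr_op_funpow[OF assms u, of l] l e by simp
    from point_value[OF this z] show ?thesis using schr_op_funpow[OF assms u, of l] l by simp
  qed
  show ?thesis unfolding HV_def Sob_V_def using pv by (auto simp: Sob_iff)
qed

subsection \<open>Curves\<close>

definition curve_continuous :: "nat \<Rightarrow> (real \<Rightarrow> l2) \<Rightarrow> bool" where
  "curve_continuous m U \<longleftrightarrow> (\<forall>t. ((\<lambda>s. HS_norm m (U s - U t)) \<longlongrightarrow> 0) (at t))"

definition curve_deriv :: "nat \<Rightarrow> (real \<Rightarrow> l2) \<Rightarrow> real \<Rightarrow> l2 \<Rightarrow> bool" where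
  "curve_deriv m U t g \<longleftrightarrow> ((\<lambda>h. HS_norm m ((U (t + h) - U t) /\<^sub>R h - g)) \<longlongrightarrow> 0) (at 0)"

lemma Sob_diff: "u \<in> Sob m \<Longrightarrow> w \<in> Sob m \<Longrightarrow> (\<lambda>x. u x - w x) \<in> Sob m"
  by (simp add: Sob_iff L2_diff cl_diff HS_diff)

lemma Sob_scaleR: "u \<in> Sob m \<Longrightarrow> (\<lambda>x. r *\<^sub>R u x) \<in> Sob m"
  by (simp add: Sob_iff L2_scaleR cl_scaleR HS_scaleR)

lemma C0_curve_iff:
  assumes "\<And>t. u t \<in> Sob m"
  shows "C0_curve X m u \<longleftrightarrow> (\<forall>t. u t \<in> X) \<and> curve_continuous m (\<lambda>t. cl (u t))"
  unfolding C0_curve_def curve_continuous_def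
proof -
  have "cl (\<lambda>x. u s x - u t x) = cl (u s) - cl (u t)" for s t by (intro cl_diff Sob_L2[OF assms])
  then show "((\<forall>t. u t \<in> X) \<and> (\<forall>t. (\<lambda>s. Sob_norm m (\<lambda>x. u s x - u t x)) \<midarrow>t\<rightarrow> 0)) =
    ((\<forall>t. u t \<in> X) \<and> (\<forall>t. (\<lambda>s. HS_norm m (cl (u s) - cl (u t))) \<midarrow>t\<rightarrow> 0))"
    by (simp add: Sob_norm_tendsto_iff Sob_diff assms)
qed

lemma has_time_deriv_iff:
  assumes "\<And>t. u t \<in> Sob m" "g \<in> Sob m"
  shows "has_time_deriv m u t g \<longleftrightarrow> curve_deriv m (\<lambda>t. cl (u t)) t (cl g)"
proof -
  have q: "(\<lambda>x. (u (t + h) x - u t x) /\<^sub>R h) \<in> Sob m" for h by (intro Sob_scaleR Sob_diff assms)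
  have "(\<lambda>x. (u (t + h) x - u t x) /\<^sub>R h - g x) \<in> Sob m" for h by (intro Sob_diff q assms)
  moreover have "cl (\<lambda>x. (u (t + h) x - u t x) /\<^sub>R h - g x) = (cl (u (t + h)) - cl (u t)) /\<^sub>R h - cl g" for h
    using q[of h, THEN Sob_L2] assms[THEN Sob_L2]
    by (simp add: cl_diff cl_scaleR L2_diff)
  ultimately show ?thesis
    unfolding has_time_deriv_def curve_deriv_def by (simp add: Sob_norm_tendsto_iff)
qed

lemma HS_norm_tendsto_imp: "((\<lambda>s. HS_norm m (f s - l)) \<longlongrightarrow> 0) F \<Longrightarrow> (f \<longlongrightarrow> l) F"
proof -
  assume "((\<lambda>s. HS_norm m (f s - l)) \<longlongrightarrow> 0) F"
  then have "((\<lambda>s. f s - l) \<longlongrightarrow> 0) F"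
    by (rule Lim_null_comparison[rotated]) (simp add: norm_le_HS_norm)
  then show ?thesis by (rule LIM_zero_cancel)
qed

text \<open>The two orders may differ because either limit already holds in
  \<open>l2\<close>.\<close>

lemma curve_deriv_unique: "curve_deriv m U t g \<Longrightarrow> curve_deriv n U t h \<Longrightarrow> g = h"
  unfolding curve_deriv_def by (rule tendsto_unique[OF _ HS_norm_tendsto_imp HS_norm_tendsto_imp]) auto

lemma has_vector_derivative_iff_quotient:
  "(f has_vector_derivative g) (at t) \<longleftrightarrow> ((\<lambda>h. (f (t + h) - f t) /\<^sub>R h - g) \<longlongrightarrow> 0) (at 0)"
proof -
  have "norm (f (t + h) - f t - h *\<^sub>R g) / norm h = norm ((f (t + h) - f t) /\<^sub>R h - g)" if "h \<noteq> 0" for h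
  proof -
    have "(f (t + h) - f t) /\<^sub>R h - g = (f (t + h) - f t - h *\<^sub>R g) /\<^sub>R h"
      using that by (simp add: scaleR_right_diff_distrib)
    then show ?thesis by (simp add: divide_inverse mult.commute)
  qed
  then have "((\<lambda>h. norm (f (t + h) - f t - h *\<^sub>R g) / norm h) \<longlongrightarrow> 0) (at 0) \<longleftrightarrow>
      ((\<lambda>h. norm ((f (t + h) - f t) /\<^sub>R h - g)) \<longlongrightarrow> 0) (at 0)"
    by (intro filterlim_cong refl) (auto simp: eventually_at_filter)
  then show ?thesis
    unfolding tendsto_norm_zero_iff
    by (simp add: has_vector_derivative_def has_derivative_at bounded_linear_scaleR_left)
qed

lemma curve_deriv_imp_has_vector_derivative: "curve_deriv m U t g \<Longrightarrow> (U has_vector_derivative g) (at t)"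
  unfolding curve_deriv_def has_vector_derivative_iff_quotient by (intro LIM_zero HS_norm_tendsto_imp)

lemma time_deriv:
  assumes "\<And>t. u t \<in> Sob m" "g \<in> Sob m" "curve_deriv m (\<lambda>t. cl (u t)) t (cl g)"
  shows "time_deriv m u t \<in> Sob m" "cl (time_deriv m u t) = cl g"
proof -
  have "\<exists>g. g \<in> Sob m \<and> has_time_deriv m u t g" using assms has_time_deriv_iff by blast
  then have w: "time_deriv m u t \<in> Sob m \<and> has_time_deriv m u t (time_deriv m u t)"
    unfolding time_deriv_def by (rule someI_ex)
  then show "time_deriv m u t \<in> Sob m" by simp
  from w show "cl (time_deriv m u t) = cl g"
    using curve_deriv_unique[OF _ assms(3)] has_time_deriv_iff[of u m "time_deriv m u t" t, OF assms(1)] by auto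
qed

section \<open>Exponentials of bounded operators\<close>

text \<open>A separate copy of the bounded operators, on which composition is the multiplication; as
  a Banach algebra it carries \<open>exp\<close>.\<close>

typedef endo = "UNIV :: (l2 \<Rightarrow>\<^sub>L l2) set" by simp

setup_lifting type_definition_endo

definition app :: "endo \<Rightarrow> l2 \<Rightarrow> l2" where "app a = blinfun_apply (Rep_endo a)"

definition endo_of :: "(l2 \<Rightarrow> l2) \<Rightarrow> endo" where "endo_of T = Abs_endo (Blinfun T)"

lemma app_endo_of: "bounded_linear T \<Longrightarrow> app (endo_of T) = T"
  by (simp add: endo_of_def app_def Abs_endo_inverse bounded_linear_Blinfun_apply)

lemma norm_cst_1: "norm (cst 1) = 1" using HS_norm_cst[of 0 1] by simp

instantiation endo :: real_normed_algebra_1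
begin

lift_definition zero_endo :: endo is 0 .
lift_definition one_endo :: endo is id_blinfun .
lift_definition plus_endo :: "endo \<Rightarrow> endo \<Rightarrow> endo" is "(+)" .
lift_definition minus_endo :: "endo \<Rightarrow> endo \<Rightarrow> endo" is "(-)" .
lift_definition uminus_endo :: "endo \<Rightarrow> endo" is uminus .
lift_definition scaleR_endo :: "real \<Rightarrow> endo \<Rightarrow> endo" is "(*\<^sub>R)" .
lift_definition times_endo :: "endo \<Rightarrow> endo \<Rightarrow> endo" is "(o\<^sub>L)" .
lift_definition norm_endo :: "endo \<Rightarrow> real" is norm .
definition dist_endo :: "endo \<Rightarrow> endo \<Rightarrow> real" where "dist_endo a b = norm (a - b)"
definition sgn_endo :: "endo \<Rightarrow> endo" where "sgn_endo a = inverse (norm a) *\<^sub>R a"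
definition uniformity_endo :: "(endo \<times> endo) filter" where
  "uniformity_endo = (INF e\<in>{0<..}. principal {(x, y). dist x y < e})"
definition open_endo :: "endo set \<Rightarrow> bool" where
  "open_endo U = (\<forall>x\<in>U. eventually (\<lambda>(x', y). x' = x \<longrightarrow> y \<in> U) uniformity)"

instance
proof
  fix a b c :: endo and r s :: real
  show "a + b + c = a + (b + c)" "a + b = b + a" "0 + a = a" "- a + a = 0" "a - b = a + - b"
    by (transfer; simp)+
  show "r *\<^sub>R (a + b) = r *\<^sub>R a + r *\<^sub>R b" "(r + s) *\<^sub>R a = r *\<^sub>R a + s *\<^sub>R a"
    "r *\<^sub>R s *\<^sub>R a = (r * s) *\<^sub>R a" "1 *\<^sub>R a = a"
    by (transfer; simp add: scaleR_add_right scaleR_add_left)+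
  show "a * b * c = a * (b * c)" "1 * a = a" "a * 1 = a"
    by (transfer; simp add: blinfun_eqI)+
  show "(a + b) * c = a * c + b * c" "a * (b + c) = a * b + a * c"
    by (transfer; auto intro!: blinfun_eqI simp: blinfun.bilinear_simps)+
  show "r *\<^sub>R a * b = r *\<^sub>R (a * b)" "a * r *\<^sub>R b = r *\<^sub>R (a * b)"
    by (transfer; auto intro!: blinfun_eqI simp: blinfun.bilinear_simps)+
  show "dist a b = norm (a - b)" by (rule dist_endo_def)
  show "sgn a = inverse (norm a) *\<^sub>R a" by (rule sgn_endo_def)
  show "(uniformity :: (endo \<times> endo) filter) = (INF e\<in>{0<..}. principal {(x, y). dist x y < e})"
    by (rule uniformity_endo_def)
  show "\<And>U. open U \<longleftrightarrow> (\<forall>x\<in>U. \<forall>\<^sub>F (x' :: endo, y) in uniformity. x' = x \<longrightarrow> y \<in> U)"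
    by (rule open_endo_def)
  show "norm a = 0 \<longleftrightarrow> a = 0" "norm (a + b) \<le> norm a + norm b" "norm (r *\<^sub>R a) = \<bar>r\<bar> * norm a"
    by (transfer; simp add: norm_triangle_ineq)+
  show "norm (a * b) \<le> norm a * norm b" by transfer (rule norm_blinfun_compose)
  show n1: "norm (1 :: endo) = 1"
  proof transfer
    have "1 \<le> norm (id_blinfun :: l2 \<Rightarrow>\<^sub>L l2)"
      using norm_blinfun[of id_blinfun "cst 1"] by (simp add: norm_cst_1)
    then show "norm (id_blinfun :: l2 \<Rightarrow>\<^sub>L l2) = 1" using norm_blinfun_id_le[where 'a = l2] by linarith
  qed
  have "norm (0 :: endo) = 0" by transfer simp
  with n1 show "(0 :: endo) \<noteq> 1" by auto
qed

end

instance endo :: banach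
proof
  fix X :: "nat \<Rightarrow> endo" assume X: "Cauchy X"
  have d: "dist a b = dist (Rep_endo a) (Rep_endo b)" for a b
    by (simp add: dist_endo_def dist_norm norm_endo.rep_eq minus_endo.rep_eq)
  have "Cauchy (\<lambda>n. Rep_endo (X n))" using X unfolding Cauchy_def d .
  then obtain L where "(\<lambda>n. Rep_endo (X n)) \<longlonglongrightarrow> L" by (auto simp: Cauchy_convergent_iff convergent_def)
  then have "X \<longlonglongrightarrow> Abs_endo L"
    unfolding tendsto_dist_iff[of X] d tendsto_dist_iff[of "\<lambda>n. Rep_endo (X n)"]
    by (simp add: Abs_endo_inverse)
  then show "convergent X" by (auto simp: convergent_def)
qed

lemma bounded_bilinear_app: "bounded_bilinear app"
proof
  fix a b :: endo and x y :: l2 and r :: real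
  show "app (a + b) x = app a x + app b x" "app a (x + y) = app a x + app a y"
    "app (r *\<^sub>R a) x = r *\<^sub>R app a x" "app a (r *\<^sub>R x) = r *\<^sub>R app a x"
    by (simp_all add: app_def plus_endo.rep_eq scaleR_endo.rep_eq blinfun.bilinear_simps)
  show "\<exists>K. \<forall>a b. norm (app a b) \<le> norm a * norm b * K"
    by (rule exI[of _ 1]) (simp add: app_def norm_endo.rep_eq norm_blinfun)
qed

interpretation app: bounded_bilinear app by (rule bounded_bilinear_app)

lemma app_mult: "app (a * b) x = app a (app b x)" by (simp add: app_def times_endo.rep_eq)
lemma app_1 [simp]: "app 1 x = x" by (simp add: app_def one_endo.rep_eq)
lemma app_power: "app (a ^ n) x = ((app a) ^^ n) x" by (induction n) (simp_all add: app_mult)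
lemma endo_eqI: "(\<And>x. app a x = app b x) \<Longrightarrow> a = b"
  by (simp add: app_def blinfun_eqI flip: Rep_endo_inject)
lemma exp_app_sums: "(\<lambda>n. ((app a) ^^ n) x /\<^sub>R fact n) sums app (exp a) x"
  using bounded_linear.sums[OF app.bounded_linear_left exp_converges[of a], of x] by (simp add: app.scaleR_left app_power)

lemma exp_minus_app [simp]: "app (exp (- a)) (app (exp a) x) = x" "app (exp a) (app (exp (- a)) x) = x"
  by (simp_all add: exp_minus_inverse flip: app_mult, metis exp_minus_inverse add.inverse_inverse app_mult app_1)

text \<open>The series converges in operator norm, hence at \<open>cl u\<close>, and a limit in L^2
  determines its class; so whatever function \<open>SOME\<close> selects has the class of the
  exponential. T has to agree with a only on \<open>L2\<close>.\<close>

lemma op_exp: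
  assumes T: "\<And>u. u \<in> L2 \<Longrightarrow> T u \<in> L2 \<and> cl (T u) = app a (cl u)" and u: "u \<in> L2"
  shows "op_exp T u \<in> L2" "cl (op_exp T u) = app (exp a) (cl u)"
proof -
  have Tn: "(T ^^ n) u \<in> L2 \<and> cl ((T ^^ n) u) = ((app a) ^^ n) (cl u)" for n
    by (induction n) (use T u in auto)
  have dv: "(\<lambda>x. (T ^^ n) u x / fact n) = (\<lambda>x. (1 / fact n) *\<^sub>R (T ^^ n) u x)" for n
    by (simp add: scaleR_conv_of_real divide_inverse mult.commute)
  have tm: "(\<lambda>x. (T ^^ n) u x / fact n) \<in> L2" "cl (\<lambda>x. (T ^^ n) u x / fact n) = ((app a) ^^ n) (cl u) /\<^sub>R fact n" for n
    unfolding dv using Tn[of n] by (simp_all add: L2_scaleR cl_scaleR divide_inverse)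
  have nrm: "L2_norm (\<lambda>x. w x - (\<Sum>n<N. (T ^^ n) u x / fact n)) =
      norm (cl w - (\<Sum>n<N. ((app a) ^^ n) (cl u) /\<^sub>R fact n))" if "w \<in> L2" for w N
    using that by (simp add: tm L2_sum cl_diff cl_sum L2_diff flip: norm_cl)
  have iff: "(\<lambda>N. L2_norm (\<lambda>x. w x - (\<Sum>n<N. (T ^^ n) u x / fact n))) \<longlonglongrightarrow> 0 \<longleftrightarrow>
      cl w = app (exp a) (cl u)" if w: "w \<in> L2" for w
  proof -
    have s: "(\<lambda>N. \<Sum>n<N. ((app a) ^^ n) (cl u) /\<^sub>R fact n) \<longlonglongrightarrow> app (exp a) (cl u)"
      using exp_app_sums by (simp add: sums_def)
    then have "(\<lambda>N. norm (cl w - (\<Sum>n<N. ((app a) ^^ n) (cl u) /\<^sub>R fact n))) \<longlonglongrightarrow>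
        norm (cl w - app (exp a) (cl u))" by (intro tendsto_intros)
    then show ?thesis unfolding nrm[OF w]
      using LIMSEQ_unique by fastforce
  qed
  obtain w0 where "w0 \<in> L2" "app (exp a) (cl u) = cl w0" by (rule cl_cases)
  then have "\<exists>w. w \<in> L2 \<and> (\<lambda>N. L2_norm (\<lambda>x. w x - (\<Sum>n<N. (T ^^ n) u x / fact n))) \<longlonglongrightarrow> 0"
    using iff by (intro exI[of _ w0]) simp
  then have w: "op_exp T u \<in> L2 \<and> (\<lambda>N. L2_norm (\<lambda>x. op_exp T u x - (\<Sum>n<N. (T ^^ n) u x / fact n))) \<longlonglongrightarrow> 0"
    unfolding op_exp_def by (rule someI_ex)
  then show "op_exp T u \<in> L2" by simp
  then show "cl (op_exp T u) = app (exp a) (cl u)" using w iff by blast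
qed

text \<open>Convergence of the series is known only in \<open>l2\<close>. Every derivative of the
  n-th term is dominated by \<open>K ^ n / fact n\<close> times the norm of u, so the derivatives of
  the partial sums converge as well and the closedness of differentiation places the limit in
  \<open>HS m\<close>. The bound comes out as \<open>exp K\<close>.\<close>

lemma sob_bounded_exp:
  assumes "sob_bounded m (app a)"
  shows "sob_bounded m (app (exp a))"
proof -
  obtain K where K: "0 \<le> K" "\<And>u. u \<in> HS m \<Longrightarrow> HS_norm m (app a u) \<le> K * HS_norm m u"
    by (rule bndE[OF assms]) blast
  have main: "app (exp a) u \<in> HS m \<and> HS_norm m (app (exp a) u) \<le> exp K * HS_norm m u" if u: "u \<in> HS m" for u
  proof -
    define f where "f n = ((app a) ^^ n) u /\<^sub>R fact n" for n
    define p where "p N = (\<Sum>n<N. f n)" for N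
    have an: "((app a) ^^ n) u \<in> HS m \<and> HS_norm m (((app a) ^^ n) u) \<le> K ^ n * HS_norm m u" for n
    proof (induction n)
      case (Suc n)
      have "HS_norm m (app a (((app a) ^^ n) u)) \<le> K * HS_norm m (((app a) ^^ n) u)" using Suc by (intro K) simp
      also have "\<dots> \<le> K * (K ^ n * HS_norm m u)" using Suc K by (intro mult_left_mono) auto
      finally show ?case using Suc sob_bounded_HS[OF assms] by (simp add: mult.assoc)
    qed (use u in simp)
    have f: "f n \<in> HS m" for n unfolding f_def using an by (intro HS_scaleR) blast
    have fn: "HS_norm m (f n) \<le> K ^ n / fact n * HS_norm m u" for n
      using an[of n] by (simp add: f_def HS_norm_scaleR divide_inverse mult.commute mult_left_mono)
    have p: "p N \<in> HS m" for N unfolding p_def by (intro HS_sum f)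
    have sK: "(\<lambda>n. K ^ n / fact n) sums exp K"
      using exp_converges[of K] by (simp add: divide_inverse mult.commute)
    have pN: "HS_norm m (p N) \<le> exp K * HS_norm m u" for N
    proof -
      have "HS_norm m (p N) \<le> (\<Sum>n<N. HS_norm m (f n))" unfolding p_def by (intro HS_norm_sum f)
      also have "\<dots> \<le> (\<Sum>n<N. K ^ n / fact n * HS_norm m u)" by (intro sum_mono fn)
      also have "\<dots> = (\<Sum>n<N. K ^ n / fact n) * HS_norm m u" by (simp add: sum_distrib_right)
      also have "(\<Sum>n<N. K ^ n / fact n) \<le> exp K"
        using sum_le_suminf[OF sums_summable[OF sK], of "{..<N}"] K sums_unique[OF sK] by simp
      finally show ?thesis by (simp add: mult_right_mono)
    qed
    have lim: "p \<longlonglongrightarrow> app (exp a) u"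
      using exp_app_sums[of a u] unfolding sums_def p_def f_def .
    have "convergent (\<lambda>N. (D ^^ j) (p N))" if j: "j \<le> m" for j
    proof -
      have "summable (\<lambda>n. (D ^^ j) (f n))"
      proof (rule summable_comparison_test')
        show "summable (\<lambda>n. K ^ n / fact n * HS_norm m u)"
          by (intro summable_mult2 sums_summable[OF sK])
        show "norm ((D ^^ j) (f n)) \<le> K ^ n / fact n * HS_norm m u" if "n \<ge> 0" for n
          using norm_funpow_D_le_HS_norm[OF j, of "f n"] fn[of n] by linarith
      qed
      then show ?thesis by (simp add: p_def summable_iff_convergent funpow_D_sum[OF f j])
    qed
    note c = HS_closed_HS_norm[OF p this lim]
    have "HS_norm m (app (exp a) u) \<le> exp K * HS_norm m u + HS_norm m (p N - app (exp a) u)" for N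
    proof -
      have "HS_norm m (p N - (p N - app (exp a) u)) \<le> HS_norm m (p N) + HS_norm m (p N - app (exp a) u)"
        by (intro HS_norm_diff HS_diff p c(1))
      then show ?thesis using pN[of N] by simp
    qed
    moreover have "(\<lambda>N. exp K * HS_norm m u + HS_norm m (p N - app (exp a) u)) \<longlonglongrightarrow> exp K * HS_norm m u + 0"
      by (intro tendsto_intros c(2))
    ultimately have "HS_norm m (app (exp a) u) \<le> exp K * HS_norm m u + 0" by (intro LIMSEQ_le_const) auto
    then have "HS_norm m (app (exp a) u) \<le> exp K * HS_norm m u" by simp
    with c(1) show ?thesis by blast
  qed
  then show ?thesis by (intro bndI[of "exp K"]) auto
qed

section \<open>The corrector\<close>

definition primy :: "real \<Rightarrow> l2 \<Rightarrow> l2" where "primy y u = prim u - cst (integ u y)"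

lemma bounded_linear_integ: "bounded_linear (\<lambda>u. integ u y)"
  unfolding integ_def by (rule pr.bounded_linear_left)

lemma bounded_linear_primy: "bounded_linear (primy y)"
  unfolding primy_def
  by (intro bounded_linear_sub bounded_linear_prim bounded_linear_compose[OF bounded_linear_cst bounded_linear_integ])

lemma sob_bounded_primy: "sob_bounded m (primy y)"
proof -
  have c: "sob_bounded m (\<lambda>u. cst (integ u y))"
  proof (rule bndI[of 1])
    show "HS_norm m (cst (integ u y)) \<le> 1 * HS_norm m u" for u
      using norm_integ_le[of u y] norm_le_HS_norm[of u m] by (simp add: HS_norm_cst)
  qed (auto intro: HS_cst)
  have "sob_bounded m (\<lambda>u. prim u + csc (-1) (cst (integ u y)))"
    by (intro sob_bounded_add sob_bounded_prim sob_bounded_comp[OF sob_bounded_csc c])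
  moreover have "csc (-1) w = - w" for w using csc_minus[of 1 w] by simp
  ultimately show ?thesis by (simp add: primy_def[abs_def])
qed

lemma interval_integral_eq_integ:
  assumes "f \<in> L2" "x \<in> {0..1}" "y \<in> {0..1}"
  shows "(LBINT z=y..x. f z) = integ (cl f) x - integ (cl f) y"
proof -
  have main: "(LBINT z=y..x. f z) = integ (cl f) x - integ (cl f) y"
    if xy: "0 \<le> y" "y \<le> x" "x \<le> 1" for x y
  proof -
    have "integ (cl f) x - integ (cl f) y = pr (cl f) (cl (\<lambda>z. (if z \<le> x then 1 else 0) - (if z \<le> y then 1 else 0)))"
      by (simp add: integ_def ind_def cl_diff L2_ind pr.diff_right)
    also have "\<dots> = (\<integral>z. f z * ((if z \<le> x then 1 else 0) - (if z \<le> y then 1 else 0)) \<partial>M01)"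
      by (intro pr_cl assms(1) L2_diff L2_ind)
    also have "\<dots> = (\<integral>z. indicator {y<..x} z *\<^sub>R f z \<partial>lborel)"
      using xy by (subst integral_restrict_space)
        (auto intro!: Bochner_Integration.integral_cong simp: indicator_def)
    also have "\<dots> = (LBINT z=y..x. f z)"
      using xy by (simp add: interval_integral_Ioc set_lebesgue_integral_def)
    finally show ?thesis ..
  qed
  show ?thesis
  proof (cases "y \<le> x")
    case False
    then show ?thesis using main[of x y] assms interval_integral_endpoints_reverse[of y x f] by simp
  qed (use main assms in simp)
qed

text \<open>Expanding \<open>(x - z)\<^sup>n\<^sup>-\<^sup>1\<close> by the binomial theorem reduces \<open>iter_int\<close> to multiplications by
  polynomials and a single integration, which are bounded on every \<open>HS m\<close>.\<close>

definition iterop :: "nat \<Rightarrow> real \<Rightarrow> l2 \<Rightarrow> l2" where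
  "iterop n y u = (\<Sum>j\<le>n - 1. mul (\<lambda>x. of_nat (n - 1 choose j) / fact (n - 1) * of_real x ^ j)
     (primy y (mul (\<lambda>z. (- 1 * of_real z) ^ (n - 1 - j)) u)))"

lemma smooth_upto_monomials: "smooth_upto m (\<lambda>x. c * of_real x ^ j)" "smooth_upto m (\<lambda>z. (- 1 * of_real z) ^ j)"
  by (intro smooth_upto_mult smooth_upto_power smooth_upto_const smooth_upto_of_real)+

lemma bounded_linear_iterop: "bounded_linear (iterop n y)"
  unfolding iterop_def
  by (intro bounded_linear_sum bounded_linear_compose[OF bounded_linear_mul]
      bounded_linear_compose[OF bounded_linear_primy bounded_linear_mul])

lemma sob_bounded_iterop: "sob_bounded m (iterop n y)"
  unfolding iterop_def
  by (intro sob_bounded_sum sob_bounded_comp[OF sob_bounded_mul sob_bounded_comp[OF sob_bounded_primy sob_bounded_mul]] smooth_upto_monomials)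

lemma iter_int:
  assumes u: "u \<in> L2" and y: "y \<in> {0..1}"
  shows "iter_int n y u \<in> L2" "cl (iter_int n y u) = iterop n y (cl u)"
proof -
  define N where "N = n - 1"
  define q where "q j x = of_nat (N choose j) / fact N * complex_of_real x ^ j" for j x
  define r where "r j z = (- 1 * complex_of_real z) ^ (N - j)" for j z
  define w where "w j = mul (r j) (cl u)" for j
  have cq: "continuous_on {0..1} (q j)" and cr: "continuous_on {0..1} (r j)" for j
    unfolding q_def r_def by (rule smooth_upto_continuous[OF smooth_upto_monomials(1)[of 0]] smooth_upto_continuous[OF smooth_upto_monomials(2)[of 0]])+
  have wj: "w j = cl (\<lambda>z. r j z * u z)" for j by (simp add: w_def mul_cl cr u)
  have pw: "primy y (w j) = cl (\<lambda>x. integ (w j) x - integ (w j) y)" for j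
    by (simp add: primy_def prim_def cl_diff L2_integ L2_const)
  have L: "(\<lambda>x. q j x * (integ (w j) x - integ (w j) y)) \<in> L2" for j
    by (intro L2_cont_mult cq L2_diff L2_integ L2_const)
  have "iterop n y (cl u) = (\<Sum>j\<le>N. mul (q j) (primy y (w j)))"
    unfolding iterop_def w_def q_def[abs_def] r_def[abs_def] N_def ..
  also have "\<dots> = cl (\<lambda>x. \<Sum>j\<le>N. q j x * (integ (w j) x - integ (w j) y))"
    unfolding pw by (simp add: mul_cl cq L2_diff L2_integ L2_const cl_sum L)
  finally have op: "iterop n y (cl u) = cl (\<lambda>x. \<Sum>j\<le>N. q j x * (integ (w j) x - integ (w j) y))" .
  have LS: "(\<lambda>x. \<Sum>j\<le>N. q j x * (integ (w j) x - integ (w j) y)) \<in> L2" by (intro L2_sum L)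
  have eq: "(\<Sum>j\<le>N. q j x * (integ (w j) x - integ (w j) y)) = iter_int n y u x" if x: "x \<in> {0..1}" for x
  proof -
    \<comment> \<open>Here x is a fixed number, so its powers act as scalars under the integral,
      whereas in \<open>iterop\<close> they are multipliers.\<close>
    define f where "f j z = of_nat (N choose j) * complex_of_real x ^ j * (r j z * u z)" for j z
    have f: "f j \<in> L2" for j unfolding f_def by (intro L2_cmult L2_cont_mult cr u)
    have "of_real ((x - z) ^ N) * u z = (\<Sum>j\<le>N. f j z)" for z
    proof -
      have "complex_of_real ((x - z) ^ N) = (of_real x + (- of_real z)) ^ N" by simp
      also have "\<dots> = (\<Sum>j\<le>N. of_nat (N choose j) * of_real x ^ j * (- of_real z) ^ (N - j))"
        by (rule binomial_ring)
      finally show ?thesis by (simp add: f_def r_def sum_distrib_right mult.assoc)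
    qed
    then have "(LBINT z=y..x. of_real ((x - z) ^ N) * u z) = (LBINT z=y..x. (\<Sum>j\<le>N. f j z))" by simp
    also have "\<dots> = integ (cl (\<lambda>z. \<Sum>j\<le>N. f j z)) x - integ (cl (\<lambda>z. \<Sum>j\<le>N. f j z)) y"
      by (rule interval_integral_eq_integ[OF L2_sum[OF f] x y])
    also have "cl (\<lambda>z. \<Sum>j\<le>N. f j z) = (\<Sum>j\<le>N. csc (of_nat (N choose j) * of_real x ^ j) (w j))"
      by (simp add: cl_sum f) (simp add: f_def wj mul_cl L2_cont_mult cr u)
    also have "integ \<dots> x - integ \<dots> y = (\<Sum>j\<le>N. of_nat (N choose j) * of_real x ^ j * (integ (w j) x - integ (w j) y))"
    proof -
      have "integ (\<Sum>j\<le>N. csc (c j) (w j)) s = (\<Sum>j\<le>N. c j * integ (w j) s)" for c s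
        by (simp add: integ_def pr.sum_left pr_csc)
      then show ?thesis by (simp add: sum_subtractf right_diff_distrib)
    qed
    finally have *: "(LBINT z=y..x. of_real ((x - z) ^ N) * u z) =
      (\<Sum>j\<le>N. of_nat (N choose j) * of_real x ^ j * (integ (w j) x - integ (w j) y))" .
    show ?thesis
      unfolding iter_int_def N_def[symmetric] *
      by (simp add: sum_distrib_left q_def mult.assoc divide_inverse mult.left_commute)
  qed
  have "cl (\<lambda>x. \<Sum>j\<le>N. q j x * (integ (w j) x - integ (w j) y)) = cl (iter_int n y u)"
    by (rule cl_eqI[OF LS eq])
  then show "cl (iter_int n y u) = iterop n y (cl u)" using op by simp
  have "iter_int n y u \<in> borel_measurable M01"
    using L2_measurable[OF LS] by (rule measurable_cong[THEN iffD1, rotated]) (simp add: space_M01 eq)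
  then show "iter_int n y u \<in> L2" by (rule L2_dominated[OF _ LS, where c = 1]) (simp add: eq)
qed

definition corrop :: "(nat \<Rightarrow> real \<Rightarrow> real \<Rightarrow> real) \<Rightarrow> (nat \<Rightarrow> nat \<Rightarrow> real \<Rightarrow> real) \<Rightarrow> nat \<Rightarrow> l2 \<Rightarrow> l2" where
  "corrop \<phi> \<alpha> k u = (\<Sum>y\<in>{0, 1}. \<Sum>i=1..k-1. \<Sum>n=1..2*i+1.
     mul (\<lambda>x. of_real (\<alpha> i n y * \<phi> (2 * i + 1 - n) y x)) (iterop n y u))"

lemma smooth_upto_cutoffs: "boundary_cutoffs \<phi> \<Longrightarrow> y \<in> {0, 1} \<Longrightarrow> smooth_upto m (\<lambda>x. of_real (c * \<phi> n y x))"
proof -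
  assume "boundary_cutoffs \<phi>" "y \<in> {0, 1}"
  then have "smooth_on {0..1} (\<phi> n y)" unfolding boundary_cutoffs_def by blast
  from smooth_upto_mult[OF smooth_upto_const smooth_on_imp_smooth_upto[OF this], of m "of_real c"] show ?thesis by simp
qed

lemma bounded_linear_corrop: "bounded_linear (corrop \<phi> \<alpha> k)"
  unfolding corrop_def
  by (intro bounded_linear_sum bounded_linear_compose[OF bounded_linear_mul bounded_linear_iterop])

lemma sob_bounded_corrop: "boundary_cutoffs \<phi> \<Longrightarrow> sob_bounded m (corrop \<phi> \<alpha> k)"
  unfolding corrop_def by (intro sob_bounded_sum sob_bounded_comp[OF sob_bounded_mul sob_bounded_iterop] smooth_upto_cutoffs)

lemma corrector:
  assumes "boundary_cutoffs \<phi>" "u \<in> L2"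
  shows "corrector \<phi> \<alpha> k u \<in> L2" "cl (corrector \<phi> \<alpha> k u) = corrop \<phi> \<alpha> k (cl u)"
proof -
  define t where "t y i n x = of_real (\<alpha> i n y * \<phi> (2 * i + 1 - n) y x) * iter_int n y u x" for y i n x
  have c: "continuous_on {0..1} (\<lambda>x. complex_of_real (\<alpha> i n y * \<phi> j y x))" if "y \<in> {0, 1}" for i n j y
    using smooth_upto_continuous[OF smooth_upto_cutoffs[OF assms(1) that]] .
  have t: "t y i n \<in> L2" "cl (t y i n) = mul (\<lambda>x. of_real (\<alpha> i n y * \<phi> (2 * i + 1 - n) y x)) (iterop n y (cl u))"
    if y: "y \<in> {0, 1}" for y i n
  proof -
    have "y \<in> {0..1}" using y by auto
    note it = iter_int[OF assms(2) this, of n]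
    show "t y i n \<in> L2" unfolding t_def by (intro L2_cont_mult c y it)
    show "cl (t y i n) = mul (\<lambda>x. of_real (\<alpha> i n y * \<phi> (2 * i + 1 - n) y x)) (iterop n y (cl u))"
      unfolding t_def it(2)[symmetric] by (rule mul_cl[OF c[OF y] it(1), symmetric])
  qed
  have eq: "corrector \<phi> \<alpha> k u = (\<lambda>x. \<Sum>y\<in>{0, 1}. \<Sum>i=1..k-1. \<Sum>n=1..2*i+1. t y i n x)"
    by (rule ext) (simp only: corrector_def t_def)
  show "corrector \<phi> \<alpha> k u \<in> L2" unfolding eq by (intro L2_sum t)
  show "cl (corrector \<phi> \<alpha> k u) = corrop \<phi> \<alpha> k (cl u)"
    unfolding eq corrop_def
    by (subst cl_sum, intro L2_sum t, assumption, rule sum.cong[OF refl],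
        subst cl_sum, intro L2_sum t, assumption, rule sum.cong[OF refl],
        subst cl_sum, intro t, assumption, rule sum.cong[OF refl], rule t(2))
qed

definition corr_endo :: "(nat \<Rightarrow> real \<Rightarrow> real \<Rightarrow> real) \<Rightarrow> (nat \<Rightarrow> nat \<Rightarrow> real \<Rightarrow> real) \<Rightarrow> nat \<Rightarrow> endo" where
  "corr_endo \<phi> \<alpha> k = endo_of (corrop \<phi> \<alpha> k)"

lemma app_corr_endo: "app (corr_endo \<phi> \<alpha> k) = corrop \<phi> \<alpha> k"
  unfolding corr_endo_def by (rule app_endo_of[OF bounded_linear_corrop])

lemma exp_corr:
  assumes "boundary_cutoffs \<phi>" "u \<in> L2"
  shows "exp_corr \<phi> \<alpha> k u \<in> L2" "cl (exp_corr \<phi> \<alpha> k u) = app (exp (corr_endo \<phi> \<alpha> k)) (cl u)"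
  unfolding exp_corr_def
  using op_exp[of "corrector \<phi> \<alpha> k" "corr_endo \<phi> \<alpha> k" u] corrector[OF assms(1)] assms(2)
  by (auto simp: app_corr_endo)

lemma exp_minus_corr:
  assumes "boundary_cutoffs \<phi>" "u \<in> L2"
  shows "exp_minus_corr \<phi> \<alpha> k u \<in> L2" "cl (exp_minus_corr \<phi> \<alpha> k u) = app (exp (- corr_endo \<phi> \<alpha> k)) (cl u)"
  unfolding exp_minus_corr_def
  using op_exp[of "\<lambda>u x. - corrector \<phi> \<alpha> k u x" "- corr_endo \<phi> \<alpha> k" u] corrector[OF assms(1)] assms(2)
  by (auto simp: app_corr_endo app.minus_left L2_uminus cl_uminus)

lemma sob_bounded_exp_corr_endo:
  assumes "boundary_cutoffs \<phi>"
  shows "sob_bounded m (app (exp (corr_endo \<phi> \<alpha> k)))" "sob_bounded m (app (exp (- corr_endo \<phi> \<alpha> k)))"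
proof -
  have c: "sob_bounded m (app (corr_endo \<phi> \<alpha> k))" unfolding app_corr_endo by (rule sob_bounded_corrop[OF assms])
  then show "sob_bounded m (app (exp (corr_endo \<phi> \<alpha> k)))" by (rule sob_bounded_exp)
  have "csc (-1) w = - w" for w using csc_minus[of 1 w] by simp
  then have "app (- corr_endo \<phi> \<alpha> k) = (\<lambda>u. csc (-1) (app (corr_endo \<phi> \<alpha> k) u))" by (simp add: app.minus_left fun_eq_iff)
  then have "sob_bounded m (app (- corr_endo \<phi> \<alpha> k))" using sob_bounded_comp[OF sob_bounded_csc c] by simp
  then show "sob_bounded m (app (exp (- corr_endo \<phi> \<alpha> k)))" by (rule sob_bounded_exp)
qed

section \<open>The boundary conditions of \<open>\<partial>\<^sup>2 + V\<close>\<close>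

lemma A_HS: "smooth_upto m W \<Longrightarrow> u \<in> HS (Suc (Suc m)) \<Longrightarrow> A W u \<in> HS m"
  unfolding A_def by (intro HS_add HS_D sob_bounded_HS[OF sob_bounded_mul]) (auto intro: HS_mono)

lemma A_add: "u \<in> HS (Suc (Suc m)) \<Longrightarrow> w \<in> HS (Suc (Suc n)) \<Longrightarrow> A W (u + w) = A W u + A W w"
  by (simp add: A_def D_add[of u "Suc m" w "Suc n"] D_add[OF HS_D HS_D]
      mul_add)

lemma A_csc: "u \<in> HS (Suc (Suc m)) \<Longrightarrow> A W (csc c u) = csc c (A W u)"
  by (simp add: A_def D_csc[of u "Suc m"] D_csc[OF HS_D] mul_csc
      mul_add)

lemma A_scaleR: "u \<in> HS (Suc (Suc m)) \<Longrightarrow> A W (r *\<^sub>R u) = r *\<^sub>R (A W u)"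
  using A_csc[of u m W "of_real r"] by (simp add: csc_of_real)

lemma A_diff: "u \<in> HS (Suc (Suc m)) \<Longrightarrow> w \<in> HS (Suc (Suc n)) \<Longrightarrow> A W (u - w) = A W u - A W w"
  using A_add[of u m "- w" n W] A_scaleR[of w n W "-1"] by (simp add: HS_minus)

lemma A_0 [simp]: "A W 0 = 0" using A_scaleR[of 0 0 W 0] by simp

context
  fixes W :: "real \<Rightarrow> complex"
  assumes W: "\<And>m. smooth_upto m W"
begin

lemma A_bound: obtains K where "0 \<le> K" "\<And>u. u \<in> HS (Suc (Suc m)) \<Longrightarrow> HS_norm m (A W u) \<le> K * HS_norm (Suc (Suc m)) u"
proof -
  obtain K where K: "0 \<le> K" "\<And>u. u \<in> HS m \<Longrightarrow> HS_norm m (mul W u) \<le> K * HS_norm m u"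
    by (rule bndE[OF sob_bounded_mul[OF W[of m]]]) blast
  show thesis
  proof (rule that[of "1 + K"])
    fix u assume u: "u \<in> HS (Suc (Suc m))"
    then have um: "u \<in> HS m" by (auto intro: HS_mono)
    have "HS_norm m (A W u) \<le> HS_norm m (D (D u)) + HS_norm m (mul W u)"
      unfolding A_def by (intro HS_norm_add HS_D u sob_bounded_HS[OF sob_bounded_mul[OF W]] um)
    also have "\<dots> \<le> HS_norm (Suc (Suc m)) u + K * HS_norm (Suc (Suc m)) u"
      using K(2)[OF um] mult_left_mono[OF HS_norm_mono[of m "Suc (Suc m)" u] K(1)]
      by (intro add_mono) auto
    finally show "HS_norm m (A W u) \<le> (1 + K) * HS_norm (Suc (Suc m)) u" by (simp add: distrib_right)
  qed (use K in simp)
qed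

lemma funpow_A_HS: "u \<in> HS (2 * l + m) \<Longrightarrow> (A W ^^ l) u \<in> HS m"
proof (induction l arbitrary: u)
  case (Suc l)
  have "A W u \<in> HS (2 * l + m)" using A_HS[OF W, of u "2 * l + m"] Suc.prems by simp
  then show ?case using Suc.IH by (simp add: funpow_swap1)
qed simp

lemma funpow_A_bound:
  "\<exists>K\<ge>0. \<forall>u\<in>HS (2 * l + m). HS_norm m ((A W ^^ l) u) \<le> K * HS_norm (2 * l + m) u"
proof (induction l)
  case 0
  then show ?case by (intro exI[of _ 1]) auto
next
  case (Suc l)
  then obtain K where K: "0 \<le> K" "\<And>u. u \<in> HS (2 * l + m) \<Longrightarrow> HS_norm m ((A W ^^ l) u) \<le> K * HS_norm (2 * l + m) u"
    by blast
  obtain L where L: "0 \<le> L" "\<And>u. u \<in> HS (Suc (Suc (2 * l + m))) \<Longrightarrow>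
      HS_norm (2 * l + m) (A W u) \<le> L * HS_norm (Suc (Suc (2 * l + m))) u" by (rule A_bound) blast
  have "HS_norm m ((A W ^^ Suc l) u) \<le> (K * L) * HS_norm (2 * Suc l + m) u" if u: "u \<in> HS (2 * Suc l + m)" for u
  proof -
    have u': "u \<in> HS (Suc (Suc (2 * l + m)))" using u by simp
    have "HS_norm m ((A W ^^ l) (A W u)) \<le> K * HS_norm (2 * l + m) (A W u)" by (intro K A_HS[OF W u'])
    also have "\<dots> \<le> K * (L * HS_norm (Suc (Suc (2 * l + m))) u)" by (intro mult_left_mono L u' K)
    finally show ?thesis by (simp add: funpow_swap1 mult.assoc del: HS_norm.simps)
  qed
  then show ?case using K(1) L(1) by (intro exI[of _ "K * L"]) auto
qed

lemma funpow_A_add: "u \<in> HS (2 * l) \<Longrightarrow> w \<in> HS (2 * l) \<Longrightarrow> (A W ^^ l) (u + w) = (A W ^^ l) u + (A W ^^ l) w"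
proof (induction l arbitrary: u w)
  case (Suc l)
  then have "u \<in> HS (Suc (Suc (2 * l)))" "w \<in> HS (Suc (Suc (2 * l)))" by simp_all
  then show ?case using Suc.IH[of "A W u" "A W w"] A_HS[OF W] by (simp add: funpow_swap1 A_add[of u "2 * l" w "2 * l"])
qed simp

lemma funpow_A_csc: "u \<in> HS (2 * l) \<Longrightarrow> (A W ^^ l) (csc c u) = csc c ((A W ^^ l) u)"
proof (induction l arbitrary: u)
  case (Suc l)
  then have "u \<in> HS (Suc (Suc (2 * l)))" by simp
  then show ?case using Suc.IH[of "A W u"] A_HS[OF W] by (simp add: funpow_swap1 A_csc[of u "2 * l"])
qed simp

lemma funpow_A_scaleR: "u \<in> HS (2 * l) \<Longrightarrow> (A W ^^ l) (r *\<^sub>R u) = r *\<^sub>R ((A W ^^ l) u)"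
  using funpow_A_csc[of u l "of_real r"] by (simp add: csc_of_real)

lemma funpow_A_diff: "u \<in> HS (2 * l) \<Longrightarrow> w \<in> HS (2 * l) \<Longrightarrow> (A W ^^ l) (u - w) = (A W ^^ l) u - (A W ^^ l) w"
  using funpow_A_add[of u l "- w"] funpow_A_scaleR[of w l "-1"] by (simp add: HS_minus)

lemma ev_funpow_A_tendsto:
  assumes "\<And>n. p n \<in> HS (2 * k)" "u \<in> HS (2 * k)" "((\<lambda>n. HS_norm (2 * k) (p n - u)) \<longlongrightarrow> 0) F" "l < k"
  shows "((\<lambda>n. ev ((A W ^^ l) (p n)) x) \<longlongrightarrow> ev ((A W ^^ l) u) x) F"
proof (rule ev_tendsto)
  \<comment> \<open>As l < k, at least two orders of regularity remain after l applications of the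
    operator, and a trace needs one.\<close>
  have e: "2 * k = 2 * l + Suc (2 * (k - l) - 1)" using assms(4) by simp
  define m where "m = Suc (2 * (k - l) - 1)"
  have e: "2 * k = 2 * l + m" "2 * l \<le> 2 * k" using e assms(4) by (simp_all add: m_def)
  show "(A W ^^ l) (p n) \<in> HS (Suc (2 * (k - l) - 1))" for n
    using assms(1)[of n] unfolding e(1) by (fold m_def) (rule funpow_A_HS)
  show "(A W ^^ l) u \<in> HS (Suc (2 * (k - l) - 1))"
    using assms(2) unfolding e(1) by (fold m_def) (rule funpow_A_HS)
  obtain K where K: "K \<ge> 0" "\<And>u. u \<in> HS (2 * l + m) \<Longrightarrow> HS_norm m ((A W ^^ l) u) \<le> K * HS_norm (2 * l + m) u"
    using funpow_A_bound by blast
  have "((\<lambda>n. HS_norm m ((A W ^^ l) (p n) - (A W ^^ l) u)) \<longlongrightarrow> 0) F"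
  proof (rule Lim_null_comparison)
    show "((\<lambda>n. K * HS_norm (2 * k) (p n - u)) \<longlongrightarrow> 0) F" by (rule tendsto_mult_right_zero[OF assms(3)])
    have "HS_norm m ((A W ^^ l) (p n) - (A W ^^ l) u) \<le> K * HS_norm (2 * k) (p n - u)" for n
      using K(2)[of "p n - u"] HS_diff[OF assms(1)[of n] assms(2)]
        funpow_A_diff[OF HS_mono[OF assms(1)[of n] e(2)] HS_mono[OF assms(2) e(2)]]
      by (simp add: e(1))
    then show "\<forall>\<^sub>F n in F. norm (HS_norm m ((A W ^^ l) (p n) - (A W ^^ l) u)) \<le> K * HS_norm (2 * k) (p n - u)" by simp
  qed
  then show "((\<lambda>n. HS_norm (Suc (2 * (k - l) - 1)) ((A W ^^ l) (p n) - (A W ^^ l) u)) \<longlongrightarrow> 0) F"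
    unfolding m_def .
qed

lemma HV_HS: "u \<in> HV W k \<Longrightarrow> u \<in> HS (2 * k)" by (simp add: HV_def)

lemma HV_Suc_subset: "u \<in> HV W (Suc k) \<Longrightarrow> u \<in> HV W k"
  by (auto simp: HV_def intro: HS_mono)

text \<open>The traces involved use fewer than 2 k derivatives, hence are continuous in the norm of
  \<open>HS (2 * k)\<close>. The filter is arbitrary so that the lemma serves sequences as well as
  difference quotients.\<close>

lemma HV_closed:
  assumes "\<And>n. p n \<in> HV W k" "u \<in> HS (2 * k)" "((\<lambda>n. HS_norm (2 * k) (p n - u)) \<longlongrightarrow> 0) F" "F \<noteq> bot"
  shows "u \<in> HV W k"
proof -
  have "ev ((A W ^^ l) u) x = 0" if "l < k" "\<And>n. ev ((A W ^^ l) (p n)) x = 0" for l x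
    using ev_funpow_A_tendsto[OF HV_HS[OF assms(1)] assms(2,3) that(1), of x] assms(4)
    by (simp add: that(2) tendsto_const_iff)
  then show ?thesis using assms(1,2) by (auto simp: HV_def)
qed

lemma HV_add: "u \<in> HV W k \<Longrightarrow> w \<in> HV W k \<Longrightarrow> u + w \<in> HV W k"
  unfolding HV_def
proof (clarsimp, intro conjI allI impI)
  assume *: "u \<in> HS (2 * k)" "w \<in> HS (2 * k)"
  then show "u + w \<in> HS (2 * k)" by (rule HS_add)
  assume z: "\<forall>l<k. ev ((A W ^^ l) u) 0 = 0 \<and> ev ((A W ^^ l) u) 1 = 0" "\<forall>l<k. ev ((A W ^^ l) w) 0 = 0 \<and> ev ((A W ^^ l) w) 1 = 0"
  fix l assume l: "l < k"
  have "(A W ^^ l) u \<in> HS (Suc 0)" "(A W ^^ l) w \<in> HS (Suc 0)"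
    using * l by (auto intro!: funpow_A_HS intro: HS_mono)
  moreover have "(A W ^^ l) (u + w) = (A W ^^ l) u + (A W ^^ l) w"
    using * l by (intro funpow_A_add) (auto intro: HS_mono)
  ultimately show "ev ((A W ^^ l) (u + w)) 0 = 0" "ev ((A W ^^ l) (u + w)) 1 = 0"
    using z l by (simp_all add: ev_add[of _ 0 _ 0])
qed

lemma HV_csc: "u \<in> HV W k \<Longrightarrow> csc c u \<in> HV W k"
  unfolding HV_def
proof (clarsimp, intro conjI allI impI)
  assume *: "u \<in> HS (2 * k)"
  then show "csc c u \<in> HS (2 * k)" by (rule HS_csc)
  assume z: "\<forall>l<k. ev ((A W ^^ l) u) 0 = 0 \<and> ev ((A W ^^ l) u) 1 = 0"
  fix l assume l: "l < k"
  have "(A W ^^ l) u \<in> HS (Suc 0)" using * l by (auto intro!: funpow_A_HS intro: HS_mono)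
  moreover have "(A W ^^ l) (csc c u) = csc c ((A W ^^ l) u)"
    using * l by (intro funpow_A_csc) (auto intro: HS_mono)
  ultimately show "ev ((A W ^^ l) (csc c u)) 0 = 0" "ev ((A W ^^ l) (csc c u)) 1 = 0"
    using z l by (simp_all add: ev_csc[of _ 0])
qed

lemma HV_scaleR: "u \<in> HV W k \<Longrightarrow> r *\<^sub>R u \<in> HV W k"
  using HV_csc[of u k "of_real r"] by (simp add: csc_of_real)

lemma HV_diff: "u \<in> HV W k \<Longrightarrow> w \<in> HV W k \<Longrightarrow> u - w \<in> HV W k"
  using HV_add[of u k "- w"] HV_scaleR[of w k "-1"] by simp

lemma range_G_iff: "u \<in> range G \<longleftrightarrow> u \<in> HS 2 \<and> ev u 0 = 0 \<and> ev u 1 = 0"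
  using Dirichlet_iff_range_G[of u 1] by auto

text \<open>The second derivative equals A w minus W w, hence is as regular as the worse of the two;
  each round gains two orders for w.\<close>

lemma regularity:
  assumes "w \<in> HS 2" "A W w \<in> HS (2 * k)"
  shows "w \<in> HS (2 * Suc k)"
proof -
  have "w \<in> HS (2 * Suc j)" if "j \<le> k" for j
    using that
  proof (induction j)
    case 0
    then show ?case using assms(1) by (simp add: numeral_2_eq_2)
  next
    case (Suc j)
    then have w: "w \<in> HS (2 * Suc j)" by simp
    have "D (D w) = A W w + csc (-1) (mul W w)" by (simp add: A_def csc_minus)
    also have "\<dots> \<in> HS (2 * Suc j)"
      by (intro HS_add HS_csc sob_bounded_HS[OF sob_bounded_mul[OF W]] w HS_mono[OF assms(2)]) (use Suc in simp)
    finally have "D (D w) \<in> HS (2 * Suc j)" .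
    moreover have "has_D w (D w)" "has_D (D w) (D (D w))"
      using assms(1) by (auto simp: numeral_2_eq_2 intro: HS_has_D HS_D)
    ultimately show ?case using HS_SucSuc_iff by simp
  qed
  then show ?thesis by blast
qed

text \<open>Identifies \<open>HV W k\<close> with the domain of the k-th power of the operator with
  Dirichlet conditions. The converse rests on \<open>regularity\<close>, since there w is only known
  to have two derivatives.\<close>

lemma HV_Suc_iff: "w \<in> HV W (Suc k) \<longleftrightarrow> w \<in> range G \<and> A W w \<in> HV W k"
proof
  assume w: "w \<in> HV W (Suc k)"
  have shift: "(A W ^^ l) (A W w) = (A W ^^ Suc l) w" for l by (simp add: funpow_swap1)
  have "w \<in> HS 2" using HV_HS[OF w] by (rule HS_mono) simp
  moreover have "ev w 0 = 0" "ev w 1 = 0" using w by (auto simp: HV_def dest: spec[of _ 0])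
  moreover have "A W w \<in> HS (2 * k)" using A_HS[OF W, of w "2 * k"] HV_HS[OF w] by simp
  moreover have "\<forall>l<k. ev ((A W ^^ l) (A W w)) 0 = 0 \<and> ev ((A W ^^ l) (A W w)) 1 = 0"
    using w unfolding shift HV_def by blast
  ultimately show "w \<in> range G \<and> A W w \<in> HV W k" unfolding range_G_iff by (simp add: HV_def)
next
  assume *: "w \<in> range G \<and> A W w \<in> HV W k"
  then have w: "w \<in> HS 2" "ev w 0 = 0" "ev w 1 = 0" unfolding range_G_iff by blast+
  have "w \<in> HS (2 * Suc k)" using * by (intro regularity w HV_HS) blast
  moreover have "ev ((A W ^^ l) w) 0 = 0 \<and> ev ((A W ^^ l) w) 1 = 0" if "l < Suc k" for l
    using that w * by (cases l) (auto simp: funpow_swap1 HV_def)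
  ultimately show "w \<in> HV W (Suc k)" by (simp add: HV_def)
qed

text \<open>The top part of the norm is that of D D w = A w - W w and is covered by induction; the
  bottom part is controlled by the same second derivative because w is \<open>G\<close> of it. Hence
  convergence in \<open>HS (2 * k)\<close> can be checked in \<open>l2\<close> on powers of the
  operator.\<close>

lemma graph_norm_estimate:
  "\<exists>K\<ge>0. \<forall>w\<in>HV W k. HS_norm (2 * k) w \<le> K * (\<Sum>l\<le>k. norm ((A W ^^ l) w))"
proof (induction k)
  case 0
  then show ?case by (intro exI[of _ 1]) auto
next
  case (Suc k)
  then obtain K where K: "K \<ge> 0" "\<And>w. w \<in> HV W k \<Longrightarrow> HS_norm (2 * k) w \<le> K * (\<Sum>l\<le>k. norm ((A W ^^ l) w))"
    by blast
  obtain M where M: "0 \<le> M" "\<And>u. u \<in> HS (2 * k) \<Longrightarrow> HS_norm (2 * k) (mul W u) \<le> M * HS_norm (2 * k) u"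
    by (rule bndE[OF sob_bounded_mul[OF W[of "2 * k"]]]) blast
  obtain L where L: "L \<ge> 0" "\<And>u. norm (mul W u) \<le> L * norm u" by (rule mul_bound) blast
  have "HS_norm (2 * Suc k) w \<le> (5 + 5 * L + K + M * K) * (\<Sum>l\<le>Suc k. norm ((A W ^^ l) w))" if w: "w \<in> HV W (Suc k)" for w
  proof -
    define s where "s = (\<Sum>l\<le>Suc k. norm ((A W ^^ l) w))"
    have s0: "norm w \<le> s" unfolding s_def by (rule order_trans[OF _ member_le_sum[of 0]]) auto
    have s1: "norm (A W w) \<le> s" unfolding s_def by (rule order_trans[OF _ member_le_sum[of 1]]) auto
    have sk: "(\<Sum>l\<le>k. norm ((A W ^^ l) w)) \<le> s" unfolding s_def by (rule sum_mono2) auto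
    have sk1: "(\<Sum>l\<le>k. norm ((A W ^^ l) (A W w))) \<le> s"
      unfolding s_def by (simp only: sum.atMost_Suc_shift[of _ k]) (simp add: funpow_swap1)
    have w': "w \<in> range G" "A W w \<in> HV W k" "w \<in> HV W k" "w \<in> HS (Suc (Suc (2 * k)))"
      using w HV_Suc_iff HV_Suc_subset HV_HS[OF w] by auto
    have DD: "D (D w) = A W w - mul W w" by (simp add: A_def)
    obtain g where g: "w = G g" using w'(1) by blast
    have "norm w + norm (D w) \<le> 5 * norm (D (D w))"
      unfolding g D_D_G using norm_G_le[of g] norm_D_G_le[of g] norm_ge_zero[of g] by linarith
    also have "norm (D (D w)) \<le> norm (A W w) + L * norm w"
      unfolding DD using norm_triangle_ineq4[of "A W w" "mul W w"] L(2)[of w] by linarith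
    also have "\<dots> \<le> s + L * s" using s0 s1 L(1) by (intro add_mono mult_left_mono)
    finally have 1: "norm w + norm (D w) \<le> 5 * (s + L * s)" by simp
    have "HS_norm (2 * k) (D (D w)) \<le> HS_norm (2 * k) (A W w) + HS_norm (2 * k) (mul W w)"
      unfolding DD by (intro HS_norm_diff HV_HS w' sob_bounded_HS[OF sob_bounded_mul[OF W]])
    also have "\<dots> \<le> K * s + M * (K * s)"
    proof (intro add_mono)
      show "HS_norm (2 * k) (A W w) \<le> K * s"
        using K(2)[OF w'(2)] mult_left_mono[OF sk1 K(1)] by linarith
      have "HS_norm (2 * k) w \<le> K * s" using K(2)[OF w'(3)] mult_left_mono[OF sk K(1)] by linarith
      then show "HS_norm (2 * k) (mul W w) \<le> M * (K * s)"
        using M(2)[OF HV_HS[OF w'(3)]] mult_left_mono[OF _ M(1)] by (meson order_trans)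
    qed
    finally have 2: "HS_norm (2 * k) (D (D w)) \<le> K * s + M * (K * s)" .
    have "HS_norm (2 * Suc k) w = norm w + norm (D w) + HS_norm (2 * k) (D (D w))" by simp
    with 1 2 show ?thesis unfolding s_def[symmetric] by (simp add: algebra_simps)
  qed
  moreover have "0 \<le> 5 + 5 * L + K + M * K" using K L M by simp
  ultimately show ?case by blast
qed

subsection \<open>Surjectivity of the traces\<close>

definition vanishes :: "nat \<Rightarrow> real \<Rightarrow> l2 \<Rightarrow> bool" where
  "vanishes n z u \<longleftrightarrow> (\<forall>i<n. ev ((D ^^ i) u) z = 0)"

lemma vanishes_Suc: "vanishes (Suc n) z u \<longleftrightarrow> ev u z = 0 \<and> vanishes n z (D u)"
  unfolding vanishes_def by (auto simp: less_Suc_eq_0_disj funpow_swap1)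

lemma vanishes_mono: "vanishes n z u \<Longrightarrow> m \<le> n \<Longrightarrow> vanishes m z u" by (auto simp: vanishes_def)

lemma vanishes_add:
  assumes "u \<in> HS n" "w \<in> HS n" "vanishes n z u" "vanishes n z w"
  shows "vanishes n z (u + w)"
  unfolding vanishes_def
proof (intro allI impI)
  fix i assume i: "i < n"
  have "(D ^^ i) u \<in> HS (Suc 0)" "(D ^^ i) w \<in> HS (Suc 0)"
    using assms i by (auto intro!: HS_funpow_D intro: HS_mono)
  then show "ev ((D ^^ i) (u + w)) z = 0"
    using assms i by (simp add: funpow_D_add[of u n] ev_add[of _ 0 _ 0] vanishes_def)
qed

lemma vanishes_mul:
  assumes "smooth_upto n f" "u \<in> HS n" "vanishes n z u" "z \<in> {0..1}"
  shows "vanishes n z (mul f u)"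
  using assms(1-3)
proof (induction n arbitrary: f u)
  case (Suc n)
  then obtain f' where f': "C1d f f'" "smooth_upto n f'" by auto
  have f: "smooth_upto n f" using Suc.prems(1) by (rule smooth_upto_Suc)
  note u = HS_Suc_subset[OF Suc.prems(2)] HS_D[OF Suc.prems(2)]
  have "vanishes n z (D (mul f u))"
    unfolding D_mul[OF f'(1) Suc.prems(2)]
    using Suc.prems(3) vanishes_Suc vanishes_mono[of "Suc n" z u n]
    by (intro vanishes_add Suc.IH f f' u sob_bounded_HS[OF sob_bounded_mul]) auto
  moreover have "ev (mul f u) z = 0"
    using ev_mul[OF f'(1) Suc.prems(2) assms(4)] Suc.prems(3) vanishes_Suc by simp
  ultimately show ?case by (simp add: vanishes_Suc)
qed (simp add: vanishes_def)

text \<open>If u vanishes to order 2 a at z, then so does W u, and the potential contributes nothing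
  to the traces involved: \<open>A W\<close> acts on them as the second derivative.\<close>

lemma vanishes_A:
  assumes "\<And>m. u \<in> HS m" "vanishes (2 * a) z u" "z \<in> {0..1}"
  shows "(\<forall>l<a. ev ((A W ^^ l) u) z = 0) \<and> ev ((A W ^^ a) u) z = ev ((D ^^ (2 * a)) u) z"
  using assms(1,2)
proof (induction a arbitrary: u)
  case (Suc a)
  have HD: "(D ^^ i) w \<in> HS m" if "\<And>m. w \<in> HS m" for w i m by (rule HS_funpow_D[OF that])
  have Wu: "mul W u \<in> HS m" for m by (intro sob_bounded_HS[OF sob_bounded_mul[OF W]] Suc.prems)
  have DDu: "D (D u) \<in> HS m" for m by (intro HS_D Suc.prems)
  have v: "vanishes (2 * Suc a) z (mul W u)" by (intro vanishes_mul W Suc.prems assms(3))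
  have Di: "ev ((D ^^ i) (A W u)) z = ev ((D ^^ Suc (Suc i)) u) z" if "i < 2 * Suc a" for i
  proof -
    have "ev ((D ^^ i) (A W u)) z = ev ((D ^^ i) (D (D u))) z + ev ((D ^^ i) (mul W u)) z"
      unfolding A_def by (simp add: funpow_D_add[OF DDu[of i] Wu[of i]] ev_add[OF HD[OF DDu] HD[OF Wu]])
    also have "ev ((D ^^ i) (mul W u)) z = 0" using v that by (simp add: vanishes_def)
    finally show ?thesis by (simp add: funpow_swap1)
  qed
  have "vanishes (2 * a) z (A W u)"
    using Suc.prems(2) unfolding vanishes_def by (auto simp: Di simp del: funpow.simps)
  then have IH: "(\<forall>l<a. ev ((A W ^^ l) (A W u)) z = 0) \<and>
      ev ((A W ^^ a) (A W u)) z = ev ((D ^^ (2 * a)) (A W u)) z"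
    by (intro Suc.IH A_HS[OF W] Suc.prems(1))
  have "ev u z = 0" using Suc.prems(2) by (auto simp: vanishes_def dest: spec[of _ 0])
  then have "ev ((A W ^^ l) u) z = 0" if "l < Suc a" for l
    using that IH by (cases l) (auto simp: funpow_swap1)
  moreover have "ev ((A W ^^ Suc a) u) z = ev ((D ^^ (2 * Suc a)) u) z"
    using IH Di[of "2 * a"] by (simp add: funpow_swap1)
  ultimately show ?case by blast
qed simp

end

lemma smooth_on_HS:
  fixes f :: "real \<Rightarrow> real"
  assumes "smooth_on {0..1} f"
  shows "cl (\<lambda>x. of_real (f x)) \<in> HS m"
    and "(D ^^ i) (cl (\<lambda>x. of_real (f x))) = cl (\<lambda>x. of_real (nderiv {0..1} i f x))"
proof -
  show "cl (\<lambda>x. of_real (f x)) \<in> HS m"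
    using assms
  proof (induction m arbitrary: f)
    case (Suc m)
    then show ?case using HS_SucI[OF has_D_C1d[OF smooth_on_C1d(1)]] smooth_on_C1d(2) by blast
  qed simp
  show "(D ^^ i) (cl (\<lambda>x. of_real (f x))) = cl (\<lambda>x. of_real (nderiv {0..1} i f x))"
    using assms
  proof (induction i arbitrary: f)
    case (Suc i)
    have "(D ^^ Suc i) (cl (\<lambda>x. of_real (f x))) = (D ^^ i) (cl (\<lambda>x. of_real (nderiv {0..1} (Suc 0) f x)))"
      by (simp only: funpow_Suc_right o_apply D_eq[OF has_D_C1d[OF smooth_on_C1d(1)[OF Suc.prems]]])
    also have "\<dots> = cl (\<lambda>x. of_real (nderiv {0..1} (Suc i) f x))"
      by (simp only: Suc.IH[OF smooth_on_C1d(2)[OF Suc.prems]] nderiv_shift)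
    finally show ?case .
  qed simp
qed

text \<open>A triangular system: the cutoff of index 2 a at y has a single nonzero derivative at the
  end points, so by \<open>vanishes_A\<close> it leaves the traces below level a alone and has trace
  1 at level a, at y only. The levels are thus corrected one after another.\<close>

lemma traces_surj:
  assumes W: "\<And>m. smooth_upto m W" and \<phi>: "boundary_cutoffs \<phi>"
  shows "\<exists>w. (\<forall>m. w \<in> HS m) \<and> (\<forall>l<a. \<forall>z\<in>{0, 1}. ev ((A W ^^ l) w) z = c l z)"
proof (induction a)
  case 0
  then show ?case by (intro exI[of _ 0]) auto
next
  case (Suc a)
  then obtain w where w: "\<And>m. w \<in> HS m" "\<And>l z. l < a \<Longrightarrow> z \<in> {0, 1} \<Longrightarrow> ev ((A W ^^ l) w) z = c l z"
    by blast
  define q where "q y = cl (\<lambda>x. complex_of_real (\<phi> (2 * a) y x))" for y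
  have s: "smooth_on {0..1} (\<phi> (2 * a) y)" if "y \<in> {0, 1}" for y
    using \<phi> that unfolding boundary_cutoffs_def by blast
  have nd: "smooth_on {0..1} f \<Longrightarrow> smooth_on {0..1} (nderiv {0..1} i f)" for i and f :: "real \<Rightarrow> real"
    by (induction i) (use smooth_on_C1d(2) in fastforce)+
  have q: "q y \<in> HS m" if "y \<in> {0, 1}" for y m unfolding q_def by (rule smooth_on_HS[OF s[OF that]])
  have evq: "ev ((D ^^ i) (q y)) z = (if z = y \<and> i = 2 * a then 1 else 0)" if "y \<in> {0, 1}" "z \<in> {0, 1}" for i y z
  proof -
    have "ev ((D ^^ i) (q y)) z = of_real (nderiv {0..1} i (\<phi> (2 * a) y) z)"
      unfolding q_def smooth_on_HS(2)[OF s[OF that(1)]]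
      by (rule ev_C1d[OF smooth_on_C1d(1)[OF nd[OF s[OF that(1)]]]]) (use that in auto)
    also have "nderiv {0..1} i (\<phi> (2 * a) y) z = (if z = y \<and> i = 2 * a then 1 else 0)"
      using \<phi> that unfolding boundary_cutoffs_def by blast
    finally show ?thesis by simp
  qed
  have Aq: "(\<forall>l<a. ev ((A W ^^ l) (q y)) z = 0) \<and> ev ((A W ^^ a) (q y)) z = (if z = y then 1 else 0)"
    if "y \<in> {0, 1}" "z \<in> {0, 1}" for y z
    using vanishes_A[OF W q[OF that(1)], of a z] that evq[OF that] by (auto simp: vanishes_def[OF W])
  define d where "d y = c a y - ev ((A W ^^ a) w) y" for y
  define w' where "w' = w + (csc (d 0) (q 0) + csc (d 1) (q 1))"
  have HA: "(A W ^^ l) u \<in> HS m" if "\<And>m. u \<in> HS m" for l u m by (rule funpow_A_HS[OF W that])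
  have h: "csc (d 0) (q 0) \<in> HS m" "csc (d 1) (q 1) \<in> HS m" for m by (intro HS_csc q; simp)+
  have evw: "ev ((A W ^^ l) w') z = ev ((A W ^^ l) w) z + (d 0 * ev ((A W ^^ l) (q 0)) z + d 1 * ev ((A W ^^ l) (q 1)) z)" for l z
    unfolding w'_def
    by (simp add: funpow_A_add[OF W w(1) HS_add[OF h]] funpow_A_add[OF W h] funpow_A_csc[OF W q]
        ev_add[OF HA[OF w(1), of _ "Suc 0"], where n = 0] ev_add[of _ 0 _ 0] ev_csc[of _ 0] HA[OF q, of _ _ "Suc 0"] HS_add HS_csc del: HS.simps(2))
  have "\<forall>l<Suc a. \<forall>z\<in>{0, 1}. ev ((A W ^^ l) w') z = c l z"
  proof (intro allI ballI impI)
    fix l z assume l: "l < Suc a" and z: "z \<in> {0 :: real, 1}"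
    show "ev ((A W ^^ l) w') z = c l z"
    proof (cases "l = a")
      case True
      then show ?thesis using z Aq[OF _ z, of 0] Aq[OF _ z, of 1] by (auto simp: evw d_def)
    next
      case False
      then show ?thesis using l w(2)[OF _ z, of l] Aq[OF _ z, of 0] Aq[OF _ z, of 1] by (auto simp: evw)
    qed
  qed
  moreover have "w' \<in> HS m" for m unfolding w'_def by (intro HS_add w h)
  ultimately show ?case by blast
qed

section \<open>Conjugation of the boundary conditions\<close>

text \<open>The class instance of \<open>l2\<close> is over the reals; this interpretation supplies
  spans and independence over the complex numbers, in which dimensions are counted.\<close>

interpretation cv: vector_space "\<lambda>c. csc c"
proof
  fix a b :: complex and x y :: l2
  show "csc a (x + y) = csc a x + csc a y"
    by (rule mul_add)
  show "csc (a + b) x = csc a x + csc b x" by (rule csc_add)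
  show "csc a (csc b x) = csc (a * b) x" by (rule csc_csc)
qed simp

text \<open>A nonzero x killed by all functionals would be independent of the \<open>e i\<close>,
  which are independent by duality; that is one vector too many for a span with card I generators.
  Linearity is assumed on S alone, as traces are linear only on sufficiently regular
  classes.\<close>

lemma biorthogonal_imp_zero:
  assumes I: "finite I" and S: "cv.subspace S" "\<And>i. i \<in> I \<Longrightarrow> p i \<in> S"
    and ell: "\<And>i u w. u \<in> S \<Longrightarrow> w \<in> S \<Longrightarrow> ell i (u + w) = ell i u + (ell i w :: complex)"
      "\<And>i u c. u \<in> S \<Longrightarrow> ell i (csc c u) = c * ell i u"
    and e: "\<And>i. i \<in> I \<Longrightarrow> e i \<in> cv.span (p ` I)"
      "\<And>i j. i \<in> I \<Longrightarrow> j \<in> I \<Longrightarrow> ell i (e j) = (if i = j then 1 else 0)"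
    and x: "x \<in> cv.span (p ` I)" "\<And>i. i \<in> I \<Longrightarrow> ell i x = 0"
  shows "x = 0"
proof (rule ccontr)
  assume "x \<noteq> 0"
  have span_S: "cv.span (p ` I) \<subseteq> S" using S by (intro cv.span_minimal) auto
  have inj: "inj_on e I" using e(2) by (intro inj_onI) (metis zero_neq_one)
  have xe: "x \<notin> e ` I" using x(2) e(2) by (metis imageE zero_neq_one)
  let ?T = "insert x (e ` I)"
  have ell_sum: "ell i (\<Sum>j\<in>J. csc (c j) (f j)) = (\<Sum>j\<in>J. c j * ell i (f j))"
    if "finite J" "\<And>j. j \<in> J \<Longrightarrow> f j \<in> S" for i c f and J :: "'a set"
    using that
  proof (induction J)
    case empty
    have "(0 :: l2) \<in> S" using S(1) by (rule cv.subspace_0)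
    then show ?case using ell(2)[of 0 i 0] by simp
  next
    case (insert j J)
    then show ?case
      by (simp add: ell cv.subspace_scale[OF S(1)] cv.subspace_sum[OF S(1)])
  qed
  have "cv.independent ?T"
  proof -
    have "c v = 0" if s0: "(\<Sum>v\<in>?T. csc (c v) v) = 0" and v: "v \<in> ?T" for c v
    proof -
      have s1: "csc (c x) x + (\<Sum>j\<in>I. csc (c (e j)) (e j)) = 0"
        using s0 I xe by (simp add: sum.reindex[OF inj])
      have ce: "c (e i) = 0" if i: "i \<in> I" for i
      proof -
        have "0 = ell i (csc (c x) x + (\<Sum>j\<in>I. csc (c (e j)) (e j)))"
          unfolding s1 using ell(2)[of 0 i 0] cv.subspace_0[OF S(1)] by simp
        also have "\<dots> = c x * ell i x + (\<Sum>j\<in>I. c (e j) * ell i (e j))"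
        proof -
          have xS: "x \<in> S" and eS: "\<And>j. j \<in> I \<Longrightarrow> e j \<in> S" using x(1) e(1) span_S by blast+
          have "ell i (csc (c x) x + (\<Sum>j\<in>I. csc (c (e j)) (e j))) =
              ell i (csc (c x) x) + ell i (\<Sum>j\<in>I. csc (c (e j)) (e j))"
            by (intro ell(1) cv.subspace_scale[OF S(1)] cv.subspace_sum[OF S(1)] xS eS)
          then show ?thesis by (simp add: ell(2) xS ell_sum I eS)
        qed
        also have "(\<Sum>j\<in>I. c (e j) * ell i (e j)) = (\<Sum>j\<in>I. if i = j then c (e j) else 0)"
          using i by (intro sum.cong) (auto simp: e(2))
        also have "\<dots> = c (e i)" using i I by simp
        finally show ?thesis using x(2)[OF i] by simp
      qed
      then have "csc (c x) x = 0" using s1 by simp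
      then have "c x = 0" using \<open>x \<noteq> 0\<close> by simp
      with ce v show ?thesis by auto
    qed
    then show ?thesis using I unfolding cv.dependent_finite[of ?T, OF finite.insertI[OF finite_imageI[OF I]]] by blast
  qed
  then have "card ?T \<le> card (p ` I)"
    using cv.independent_span_bound[of "p ` I" ?T] I x(1) e(1) by auto
  moreover have "card ?T = Suc (card I)" using I xe inj by (simp add: card_image)
  ultimately show False using card_image_le[OF I, of p] by simp
qed

text \<open>The affine functions 1 - x and x, which span the kernel of the second
  derivative.\<close>

definition corner :: "real \<Rightarrow> l2" where
  "corner z = (if z = 0 then cst 1 - prim (cst 1) else prim (cst 1))"

lemma corner:
  shows "corner z \<in> HS m" "D (D (corner z)) = 0"
    and "y \<in> {0, 1} \<Longrightarrow> z \<in> {0, 1} \<Longrightarrow> ev (corner z) y = (if y = z then 1 else 0)"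
proof -
  have p: "prim (cst 1) \<in> HS m" for m by (rule HS_Suc_subset[OF HS_prim[OF HS_cst]])
  show "corner z \<in> HS m" unfolding corner_def by (auto intro: HS_diff HS_cst p)
  have "D (cst 1 - prim (cst 1)) = - cst 1" using D_diff[OF HS_cst[where m = "Suc 0"] p[of "Suc 0"]] by simp
  moreover have "D (- cst 1) = 0" using D_minus[OF HS_cst[where m = "Suc 0"]] by simp
  ultimately show "D (D (corner z)) = 0" by (simp add: corner_def)
  have "ev (cst 1 - prim (cst 1)) x = 1 - integ (cst 1) x" for x
    using ev_diff[OF HS_cst[where m = "Suc 0"] p[of "Suc 0"]] by simp
  then show "ev (corner z) y = (if y = z then 1 else 0)" if "y \<in> {0, 1}" "z \<in> {0, 1}"
    using that by (auto simp: corner_def integ_1 pr_cst)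
qed

text \<open>The Lidstone polynomials. As D D undoes \<open>G\<close> and \<open>G\<close> produces
  zero end values, they are dual to the traces of even order.\<close>

definition lidstone :: "nat \<times> real \<Rightarrow> l2" where "lidstone i = (G ^^ fst i) (corner (snd i))"

lemma lidstone_HS: "lidstone i \<in> HS m"
proof -
  have "(G ^^ l) (corner z) \<in> HS m" for l z
    by (rule HS_mono[OF HS_funpow_G[OF corner(1)[of z m]]]) simp
  then show ?thesis by (simp add: lidstone_def)
qed

lemma ev_lidstone:
  assumes "y \<in> {0, 1}" "z \<in> {0, 1}"
  shows "ev ((D ^^ (2 * j)) (lidstone (l, z))) y = (if j = l \<and> y = z then 1 else 0)"
proof -
  have shift: "(D ^^ (2 * Suc j)) u = (D ^^ (2 * j)) (D (D u))" for j u by (simp add: funpow_swap1)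
  have z0: "(D ^^ (2 * j)) (0 :: l2) = 0" for j by (induction j) (simp_all add: shift del: funpow.simps mult_Suc_right)
  have "ev ((D ^^ (2 * j)) ((G ^^ l) (corner z))) y = (if j = l \<and> y = z then 1 else 0)"
  proof (induction j arbitrary: l)
    case 0
    then show ?case using assms by (cases l) (auto simp: corner(3))
  next
    case (Suc j)
    show ?case
    proof (cases l)
      case 0
      then show ?thesis using z0[of j] by (simp add: shift corner del: funpow.simps(2) mult_Suc_right) 
    next
      case (Suc l')
      have "(D ^^ (2 * Suc j)) ((G ^^ l) (corner z)) = (D ^^ (2 * j)) ((G ^^ l') (corner z))"
        unfolding shift Suc by simp
      then show ?thesis using Suc.IH[of l'] Suc by simp
    qed
  qed
  then show ?thesis by (simp add: lidstone_def)
qed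

text \<open>Subtracting the Lidstone interpolant removes the traces of all even orders below 2 k,
  and \<open>Dirichlet_iff_range_G\<close> applies to the remainder.\<close>

lemma Dirichlet_decomposition:
  assumes u: "u \<in> HS (2 * k)"
  shows "u - (\<Sum>i\<in>{..<k} \<times> {0, 1}. csc (ev ((D ^^ (2 * fst i)) u) (snd i)) (lidstone i)) \<in> range (G ^^ k)"
  unfolding Dirichlet_iff_range_G[symmetric]
proof (intro conjI allI impI)
  let ?I = "{..<k} \<times> {0, 1 :: real}"
  let ?s = "\<Sum>i\<in>?I. csc (ev ((D ^^ (2 * fst i)) u) (snd i)) (lidstone i)"
  have s: "?s \<in> HS m" for m by (intro HS_sum HS_csc lidstone_HS)
  show "u - ?s \<in> HS (2 * k)" by (intro HS_diff u s)
  have *: "ev ((D ^^ (2 * l)) (u - ?s)) y = 0" if l: "l < k" and y: "y \<in> {0, 1}" for l y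
  proof -
    have d1: "(D ^^ (2 * l)) u \<in> HS (Suc 0)" using u l by (auto intro!: HS_funpow_D intro: HS_mono)
    have d2: "(D ^^ (2 * l)) w \<in> HS (Suc 0)" if "\<And>m. w \<in> HS m" for w
      by (rule HS_funpow_D[OF that])
    have l2: "2 * l \<le> 2 * k" using l by simp
    have "ev ((D ^^ (2 * l)) ?s) y = (\<Sum>i\<in>?I. ev ((D ^^ (2 * l)) (csc (ev ((D ^^ (2 * fst i)) u) (snd i)) (lidstone i))) y)"
      by (subst funpow_D_sum[of _ _ "2 * l"], intro HS_csc lidstone_HS, simp, rule ev_sum[of _ _ 0])
         (intro d2 HS_csc lidstone_HS)
    also have "\<dots> = (\<Sum>i\<in>?I. ev ((D ^^ (2 * fst i)) u) (snd i) * ev ((D ^^ (2 * l)) (lidstone i)) y)"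
      by (intro sum.cong refl) (simp add: funpow_D_csc[OF lidstone_HS order_refl] ev_csc[OF d2[OF lidstone_HS]])
    also have "\<dots> = (\<Sum>i\<in>?I. if i = (l, y) then ev ((D ^^ (2 * l)) u) y else 0)"
      by (intro sum.cong refl) (use y ev_lidstone in fastforce)
    also have "\<dots> = ev ((D ^^ (2 * l)) u) y" using l y by (subst sum.delta) auto
    finally show ?thesis
      using funpow_D_diff[OF u s l2] ev_diff[OF d1 d2[OF s], where x = y] by simp
  qed
  fix l assume "l < k"
  then show "ev ((D ^^ (2 * l)) (u - ?s)) 0 = 0" "ev ((D ^^ (2 * l)) (u - ?s)) 1 = 0" using * by auto
qed

text \<open>Test functions have zero end values, hence are \<open>G\<close> of their second
  derivative, and they are dense.\<close>

lemma closure_range_G: "closure (range G) = UNIV"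
proof -
  have "cl \<theta> \<in> range G" if t: "test_fun \<theta>" for \<theta>
  proof -
    have "C1d \<theta> (nderiv UNIV (Suc 0) \<theta>)" "C1d (nderiv UNIV (Suc 0) \<theta>) (nderiv UNIV (Suc 0) (nderiv UNIV (Suc 0) \<theta>))"
      by (rule test_fun_C1d, rule t, rule test_fun_C1d, rule test_fun_nderiv, rule t)
    then have "cl \<theta> \<in> HS (Suc (Suc 0))"
      using has_D_C1d by (intro HS_SucI[OF has_D_C1d] HS_SucI) auto
    moreover have "ev (cl \<theta>) 0 = 0" "ev (cl \<theta>) 1 = 0"
      using ev_C1d[OF \<open>C1d \<theta> _\<close>] test_fun_0_1[OF t] by auto
    ultimately show ?thesis using eq_G_D_D by blast
  qed
  then have "closure (cl ` {\<theta>. test_fun \<theta>}) \<subseteq> closure (range G)" by (intro closure_mono) auto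
  then show ?thesis by (auto simp: closure_test_fun)
qed

text \<open>Density of the range of \<open>G\<close> is transported by \<open>G ^^ a\<close>, which
  is bounded from \<open>l2\<close> into \<open>HS (2 * a)\<close> with constant 5 ^ a.\<close>

lemma range_G_Suc_dense:
  assumes "u \<in> range (G ^^ a)"
  obtains p where "\<And>n :: nat. p n \<in> range (G ^^ Suc a)" "(\<lambda>n. HS_norm (2 * a) (p n - u)) \<longlonglongrightarrow> 0"
proof -
  obtain g where g: "u = (G ^^ a) g" using assms by blast
  have "g \<in> closure (range G)" by (simp add: closure_range_G)
  then obtain h where h: "\<And>n. h n \<in> range G" "h \<longlonglongrightarrow> g" unfolding closure_sequential by blast
  have "(G ^^ a) (x - y) = (G ^^ a) x - (G ^^ a) y" for x y
    by (induction a) (simp_all add: G_diff)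
  then have le: "HS_norm (2 * a) ((G ^^ a) (h n) - u) \<le> 5 ^ a * norm (h n - g)" for n
    using HS_norm_funpow_G[of a 0 "h n - g"] by (simp add: g)
  show thesis
  proof (rule that)
    show "(G ^^ a) (h n) \<in> range (G ^^ Suc a)" for n
      using h(1)[of n] by (auto simp: funpow_swap1)
    have "(\<lambda>n. 5 ^ a * norm (h n - g)) \<longlonglongrightarrow> 5 ^ a * norm (g - g)" by (intro tendsto_intros h)
    then have "(\<lambda>n. 5 ^ a * norm (h n - g)) \<longlonglongrightarrow> 0" by simp
    then show "(\<lambda>n. HS_norm (2 * a) ((G ^^ a) (h n) - u)) \<longlonglongrightarrow> 0"
      by (rule Lim_null_comparison[rotated]) (simp add: le)
  qed
qed

text \<open>The converse inclusion is a dimension count: the \<open>2 k\<close> functionals that define \<open>HV W k\<close>,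
  composed with \<open>E\<close>, remain independent and vanish on the range of \<open>G ^^ k\<close>, which has the
  \<open>2 k\<close> polynomials \<open>lidstone\<close> as a complement.\<close>

lemma conjugation_Dirichlet_iff:
  assumes W: "\<And>m. smooth_upto m W" and \<phi>: "boundary_cutoffs \<phi>"
    and E: "\<And>m. sob_bounded m (app E)" "\<And>m. sob_bounded m (app E')" "\<And>x. app E (app E' x) = x" "\<And>x. app E' (app E x) = x"
    and E_csc: "\<And>c x. app E (csc c x) = csc c (app E x)"
    and H: "app E ` range (G ^^ Suc k) \<subseteq> HV W (Suc k)"
    and u: "u \<in> HS (2 * k)"
  shows "app E u \<in> HV W k \<longleftrightarrow> u \<in> range (G ^^ k)"
proof -
  have sub: "app E v \<in> HV W k" if v: "v \<in> range (G ^^ k)" for v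
  proof -
    obtain p where p: "\<And>n :: nat. p n \<in> range (G ^^ Suc k)" "(\<lambda>n. HS_norm (2 * k) (p n - v)) \<longlonglongrightarrow> 0"
      using range_G_Suc_dense[OF v] by blast
    obtain K where K: "0 \<le> K" "\<And>u. u \<in> HS (2 * k) \<Longrightarrow> HS_norm (2 * k) (app E u) \<le> K * HS_norm (2 * k) u"
      by (rule bndE[OF E(1)[of "2 * k"]]) blast
    have v': "v \<in> HS (2 * k)" using v Dirichlet_iff_range_G by blast
    have pn: "p n \<in> HS (2 * k)" for n
      using p(1)[of n] Dirichlet_iff_range_G[of "p n" "Suc k"] by (auto intro: HS_mono)
    show ?thesis
    proof (rule HV_closed[OF W])
      show "app E (p n) \<in> HV W k" for n using H p(1) HV_Suc_subset[OF W] by blast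
      show "app E v \<in> HS (2 * k)" by (rule sob_bounded_HS[OF E(1) v'])
      show "(\<lambda>n. HS_norm (2 * k) (app E (p n) - app E v)) \<longlonglongrightarrow> 0"
      proof (rule Lim_null_comparison)
        show "(\<lambda>n. K * HS_norm (2 * k) (p n - v)) \<longlonglongrightarrow> 0" by (rule tendsto_mult_right_zero[OF p(2)])
        show "\<forall>\<^sub>F n in sequentially. norm (HS_norm (2 * k) (app E (p n) - app E v)) \<le> K * HS_norm (2 * k) (p n - v)"
          using K(2)[OF HS_diff[OF pn v']] by (simp add: app.diff_right)
      qed
    qed simp
  qed
  have "u \<in> range (G ^^ k)" if uV: "app E u \<in> HV W k"
  proof -
    define I where "I = {..<k} \<times> {0, 1 :: real}"
    define ell where "ell i v = ev ((A W ^^ fst i) (app E v)) (snd i)" for i and v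
    let ?S = "HS (2 * k)"
    have I: "finite I" by (simp add: I_def)
    have S: "cv.subspace ?S" by (auto simp: cv.subspace_def intro: HS_add HS_csc)
    have Ak: "(A W ^^ fst i) (app E v) \<in> HS (Suc 0)" "app E v \<in> HS (2 * fst i)" if "i \<in> I" "v \<in> ?S" for i v
    proof -
      show "app E v \<in> HS (2 * fst i)" using that by (intro HS_mono[OF sob_bounded_HS[OF E(1) that(2)]]) (auto simp: I_def)
      show "(A W ^^ fst i) (app E v) \<in> HS (Suc 0)"
        by (rule funpow_A_HS[OF W], rule HS_mono[OF sob_bounded_HS[OF E(1) that(2)]]) (use that(1) in \<open>auto simp: I_def\<close>)
    qed
    \<comment> \<open>Extended by zero because \<open>biorthogonal_imp_zero\<close> asks for
      linearity at every index, while \<open>ell i\<close> is known to be linear on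
      \<open>HS (2 * k)\<close> for i in I.\<close>
    define el where "el i v = (if i \<in> I then ell i v else 0)" for i v
    have el_add: "el i (v + w) = el i v + el i w" if "v \<in> ?S" "w \<in> ?S" for i v w
      unfolding el_def ell_def
      using that by (auto simp: app.add_right funpow_A_add[OF W Ak(2) Ak(2)] ev_add[OF Ak(1) Ak(1)])
    have el_csc: "el i (csc c v) = c * el i v" if "v \<in> ?S" for i v c
      unfolding el_def ell_def
      using that by (auto simp: E_csc funpow_A_csc[OF W Ak(2)] ev_csc[OF Ak(1)])
    have el_range: "el i v = 0" if "v \<in> range (G ^^ k)" for i v
      using sub[OF that] by (auto simp: el_def ell_def HV_def I_def)
    have range_S: "v \<in> ?S" if "v \<in> range (G ^^ k)" for v using that Dirichlet_iff_range_G by blast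
    \<comment> \<open>The projection onto the span of the Lidstone polynomials along the range of
      \<open>G ^^ k\<close>. The functionals vanish on that range by the inclusion already shown, so
      they factor through P.\<close>
    define P where "P v = (\<Sum>i\<in>I. csc (ev ((D ^^ (2 * fst i)) v) (snd i)) (lidstone i))" for v
    have P: "P v \<in> cv.span (lidstone ` I)" for v
      unfolding P_def by (intro cv.span_sum cv.span_scale cv.span_base) auto
    have PS: "P v \<in> ?S" for v unfolding P_def by (intro HS_sum HS_csc lidstone_HS)
    have dec: "v - P v \<in> range (G ^^ k)" if "v \<in> ?S" for v
      unfolding P_def I_def by (rule Dirichlet_decomposition[OF that])
    have el_P: "el i (P v) = el i v" if "v \<in> ?S" for i v
      using el_add[OF PS range_S[OF dec[OF that]], of i v] el_range[OF dec[OF that]] by simp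
    have "\<exists>w. (\<forall>m. w \<in> HS m) \<and> (\<forall>l<k. \<forall>z\<in>{0, 1}. ev ((A W ^^ l) w) z = (if (l, z) = i then 1 else 0))" for i
      using traces_surj[OF W \<phi>, where c = "\<lambda>l z. if (l, z) = i then 1 else 0"] by blast
    then obtain w where w: "\<And>i m. w i \<in> HS m"
      "\<And>i l z. l < k \<Longrightarrow> z \<in> {0, 1} \<Longrightarrow> ev ((A W ^^ l) (w i)) z = (if (l, z) = i then 1 else 0)" by metis
    \<comment> \<open>Classes with dual traces are pulled back by the inverse of E and then
      projected; the projection leaves the values of the functionals unchanged.\<close>
    define e where "e i = P (app E' (w i))" for i
    have wS: "app E' (w i) \<in> ?S" for i by (rule sob_bounded_HS[OF E(2) w(1)])
    have "P u = 0"
    proof (rule biorthogonal_imp_zero[OF I S, where p = lidstone and ell = el and e = e])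
      show "el i (e j) = (if i = j then 1 else 0)" if "i \<in> I" "j \<in> I" for i j
      proof -
        have "el i (e j) = ev ((A W ^^ fst i) (w j)) (snd i)"
          using that unfolding e_def el_P[OF wS] by (simp add: el_def ell_def E(3))
        also have "\<dots> = (if i = j then 1 else 0)"
          using that(1) w(2)[of "fst i" "snd i" j] by (auto simp: I_def)
        finally show ?thesis .
      qed
      show "el i (P u) = 0" if "i \<in> I" for i
        using uV that unfolding el_P[OF u] by (auto simp: el_def ell_def HV_def I_def)
    qed (use lidstone_HS P el_add el_csc in \<open>auto simp: e_def\<close>)
    then show ?thesis using dec[OF u] by simp
  qed
  then show ?thesis using sub by blast
qed

section \<open>Groups generated by skew-adjoint operators\<close>

lemma has_vector_derivative_app:
  "(F has_vector_derivative F') (at t) \<Longrightarrow> (f has_vector_derivative f') (at t) \<Longrightarrow>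
   ((\<lambda>s. app (F s) (f s)) has_vector_derivative (app (F t) f' + app F' (f t))) (at t)"
  by (rule bounded_bilinear.has_vector_derivative[OF bounded_bilinear_app])

lemma exp_skew_isometry:
  assumes "\<And>x. inner (app b x) x = 0"
  shows "norm (app (exp (t *\<^sub>R b)) x) = norm x"
proof -
  define f where "f s = app (exp (s *\<^sub>R b)) x" for s
  have d: "(f has_vector_derivative app b (f s)) (at s)" for s
    unfolding f_def
    using has_vector_derivative_app[OF exp_scaleR_has_vector_derivative_left[of b s] has_vector_derivative_const[of x "at s"]]
    by (simp add: app.zero_right app_mult)
  have "((\<lambda>s. inner (f s) (f s)) has_real_derivative 0) (at s)" for s
  proof -
    have "((\<lambda>s. inner (f s) (f s)) has_vector_derivative (inner (f s) (app b (f s)) + inner (app b (f s)) (f s))) (at s)"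
      by (rule bounded_bilinear.has_vector_derivative[OF bounded_bilinear_inner d d])
    then show ?thesis
      by (simp add: assms inner_commute[of "f s"] has_real_derivative_iff_has_vector_derivative)
  qed
  then have "inner (f t) (f t) = inner (f 0) (f 0)" by (rule DERIV_isconst_all[rule_format]) 
  then show ?thesis by (simp add: f_def norm_eq_sqrt_inner)
qed

lemma exp_commute:
  assumes "a * b = b * (a :: endo)"
  shows "exp a * b = b * exp a"
proof -
  have p: "a ^ n * b = b * a ^ n" for n
  proof (induction n)
    case (Suc n)
    have "a ^ Suc n * b = a * (a ^ n * b)" by (simp add: mult.assoc)
    also have "\<dots> = (a * b) * a ^ n" by (simp only: Suc mult.assoc)
    also have "\<dots> = b * a ^ Suc n" by (simp add: assms mult.assoc)
    finally show ?case .
  qed simp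
  have "(\<lambda>n. (a ^ n /\<^sub>R fact n) * b) sums (exp a * b)"
    by (intro sums_mult2 exp_converges)
  moreover have "(\<lambda>n. b * (a ^ n /\<^sub>R fact n)) sums (b * exp a)"
    by (intro sums_mult exp_converges)
  ultimately show ?thesis by (simp add: p sums_unique2)
qed

text \<open>The curve exp((t - s) b) exp(s a) x joins the two terms. Since a and b commute, its
  derivative is the product of the two exponentials applied to a x - b x, of constant norm because
  both exponentials are isometries.\<close>

lemma exp_difference_bound:
  assumes "\<And>x. inner (app a x) x = 0" "\<And>x. inner (app b x) x = 0" "a * b = b * a"
  shows "norm (app (exp (t *\<^sub>R a)) x - app (exp (t *\<^sub>R b)) x) \<le> \<bar>t\<bar> * norm (app a x - app b x)"
proof -
  define f where "f s = app (exp ((t - s) *\<^sub>R b) * exp (s *\<^sub>R a)) x" for s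
  define f' where "f' s = app (exp ((t - s) *\<^sub>R b)) (app (exp (s *\<^sub>R a)) (app a x - app b x))" for s
  have d: "(f has_vector_derivative f' s) (at s)" for s
  proof -
    have "((\<lambda>s. t - s) has_vector_derivative -1) (at s)"
      by (auto intro!: derivative_eq_intros simp flip: has_real_derivative_iff_has_vector_derivative)
    from vector_diff_chain_at[OF this exp_scaleR_has_vector_derivative_right[of b "t - s" UNIV]]
    have 1: "((\<lambda>s. exp ((t - s) *\<^sub>R b)) has_vector_derivative - (exp ((t - s) *\<^sub>R b) * b)) (at s)"
      by (simp add: o_def)
    have 2: "((\<lambda>s. exp (s *\<^sub>R a)) has_vector_derivative exp (s *\<^sub>R a) * a) (at s)"
      using exp_scaleR_has_vector_derivative_right[of a s UNIV] by simp
    have c: "b * exp (s *\<^sub>R a) = exp (s *\<^sub>R a) * b"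
      by (rule exp_commute[symmetric]) (simp add: assms(3))
    have "((\<lambda>s. exp ((t - s) *\<^sub>R b) * exp (s *\<^sub>R a)) has_vector_derivative
        exp ((t - s) *\<^sub>R b) * (exp (s *\<^sub>R a) * a) + - (exp ((t - s) *\<^sub>R b) * b) * exp (s *\<^sub>R a)) (at s)"
      by (rule has_vector_derivative_mult[OF 1 2])
    from has_vector_derivative_app[OF this has_vector_derivative_const[of x "at s"]]
    show ?thesis
      by (simp add: f_def[abs_def] f'_def app.zero_right app.add_left app.minus_left app_mult app.diff_right app.diff_left
          mult.assoc c)
  qed
  have nf': "norm (f' s) = norm (app a x - app b x)" for s
    unfolding f'_def by (simp add: exp_skew_isometry assms)
  have "norm (f t - f 0) \<le> norm (app a x - app b x) * norm (t - 0)"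
  proof (rule differentiable_bound[where S = UNIV and f' = "\<lambda>s h. h *\<^sub>R f' s"])
    show "(f has_derivative (\<lambda>h. h *\<^sub>R f' s)) (at s within UNIV)" for s
      using d[of s] by (simp add: has_vector_derivative_def)
    show "onorm (\<lambda>h. h *\<^sub>R f' s) \<le> norm (app a x - app b x)" for s
      by (rule onorm_le) (simp add: nf' mult.commute)
  qed auto
  then show ?thesis by (simp add: f_def mult.commute)
qed

text \<open>Stone's theorem in real form: solvability for \<mu> of both signs is what makes a skew
  operator skew-adjoint and yields a group rather than a semigroup. Scalars are real because the
  class structure of \<open>l2\<close> is.\<close>

locale skew_adjoint =
  fixes dom :: "l2 set" and B :: "l2 \<Rightarrow> l2"
  assumes dom: "subspace dom"
    and B_add: "x \<in> dom \<Longrightarrow> y \<in> dom \<Longrightarrow> B (x + y) = B x + B y"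
    and B_scaleR: "x \<in> dom \<Longrightarrow> B (r *\<^sub>R x) = r *\<^sub>R B x"
    and closed: "(\<And>n :: nat. xs n \<in> dom) \<Longrightarrow> xs \<longlonglongrightarrow> x \<Longrightarrow> (\<lambda>n. B (xs n)) \<longlonglongrightarrow> y \<Longrightarrow> x \<in> dom \<and> B x = y"
    and dense: "closure dom = UNIV"
    and skew: "x \<in> dom \<Longrightarrow> inner (B x) x = 0"
    and surj: "\<mu> \<noteq> 0 \<Longrightarrow> \<exists>x\<in>dom. \<mu> *\<^sub>R x - B x = f"
begin

lemma B_diff: "x \<in> dom \<Longrightarrow> y \<in> dom \<Longrightarrow> B (x - y) = B x - B y"
  using B_add[of x "- y"] B_scaleR[of y "-1"] subspace_neg[OF dom] by simp

lemma resolvent_bound: "x \<in> dom \<Longrightarrow> \<bar>\<mu>\<bar> * norm x \<le> norm (\<mu> *\<^sub>R x - B x)"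
proof (cases "x = 0")
  case False
  assume x: "x \<in> dom"
  have "\<mu> * (norm x)\<^sup>2 = inner (\<mu> *\<^sub>R x - B x) x"
    by (simp add: inner_diff_left skew[OF x] power2_norm_eq_inner)
  then have "\<bar>\<mu>\<bar> * (norm x)\<^sup>2 = \<bar>inner (\<mu> *\<^sub>R x - B x) x\<bar>"
    by (metis abs_mult abs_of_nonneg zero_le_power2)
  also have "\<dots> \<le> norm (\<mu> *\<^sub>R x - B x) * norm x" by (rule Cauchy_Schwarz_ineq2)
  finally show ?thesis using False by (simp add: power2_eq_square)
qed simp

lemma dom_approx:
  assumes "e > 0"
  obtains y where "y \<in> dom" "dist y x < e / 3"
  using closure_approachable[of x dom] dense assms by (metis UNIV_I divide_pos_pos zero_less_numeral)

section \<open>Resolvents of a skew-adjoint operator\<close>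

definition res :: "real \<Rightarrow> l2 \<Rightarrow> l2" where "res \<mu> f = (SOME x. x \<in> dom \<and> \<mu> *\<^sub>R x - B x = f)"

lemma res: "\<mu> \<noteq> 0 \<Longrightarrow> res \<mu> f \<in> dom" "\<mu> \<noteq> 0 \<Longrightarrow> \<mu> *\<^sub>R res \<mu> f - B (res \<mu> f) = f"
proof -
  have "res \<mu> f \<in> dom \<and> \<mu> *\<^sub>R res \<mu> f - B (res \<mu> f) = f" if "\<mu> \<noteq> 0"
    unfolding res_def by (rule someI_ex) (use surj[OF that] in blast)
  then show "\<mu> \<noteq> 0 \<Longrightarrow> res \<mu> f \<in> dom" "\<mu> \<noteq> 0 \<Longrightarrow> \<mu> *\<^sub>R res \<mu> f - B (res \<mu> f) = f" by blast+
qed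

lemma B_res: "\<mu> \<noteq> 0 \<Longrightarrow> B (res \<mu> f) = \<mu> *\<^sub>R res \<mu> f - f"
  using res(2)[of \<mu> f] by (simp add: algebra_simps)

lemma res_unique:
  assumes "\<mu> \<noteq> 0" "x \<in> dom" "\<mu> *\<^sub>R x - B x = f"
  shows "res \<mu> f = x"
proof -
  have d: "res \<mu> f - x \<in> dom" using res(1)[OF assms(1)] assms(2) by (intro subspace_diff[OF dom])
  have "\<mu> *\<^sub>R (res \<mu> f - x) - B (res \<mu> f - x) = 0"
    using res[OF assms(1), of f] assms(2,3) by (simp add: B_diff scaleR_diff_right algebra_simps)
  then have "\<bar>\<mu>\<bar> * norm (res \<mu> f - x) \<le> 0" using resolvent_bound[OF d, of \<mu>] by simp
  then have "norm (res \<mu> f - x) \<le> 0" using assms(1) by (simp add: mult_le_0_iff)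
  then show ?thesis by simp
qed

lemma norm_res: "\<mu> \<noteq> 0 \<Longrightarrow> \<bar>\<mu>\<bar> * norm (res \<mu> f) \<le> norm f"
  using resolvent_bound[OF res(1), of \<mu> \<mu> f] res(2)[of \<mu> f] by simp

lemma bounded_linear_res:
  assumes "\<mu> \<noteq> 0"
  shows "bounded_linear (res \<mu>)"
proof (rule bounded_linear_intro[where K = "1 / \<bar>\<mu>\<bar>"])
  fix f g r
  show "res \<mu> (f + g) = res \<mu> f + res \<mu> g"
    using res[OF assms, of f] res[OF assms, of g] subspace_add[OF dom]
    by (intro res_unique[OF assms]) (auto simp: B_add scaleR_add_right algebra_simps)
  show "res \<mu> (r *\<^sub>R f) = r *\<^sub>R res \<mu> f"
    using res[OF assms, of f] subspace_scale[OF dom]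
    by (intro res_unique[OF assms]) (auto simp: B_scaleR B_res[OF assms] scaleR_diff_right mult.commute)
  show "norm (res \<mu> f) \<le> norm f * (1 / \<bar>\<mu>\<bar>)"
    using norm_res[OF assms, of f] assms by (simp add: field_simps)
qed

lemma res_B: "\<mu> \<noteq> 0 \<Longrightarrow> x \<in> dom \<Longrightarrow> res \<mu> (B x) = B (res \<mu> x)"
proof (rule res_unique)
  assume \<mu>: "\<mu> \<noteq> 0" and x: "x \<in> dom"
  note r = res(1)[OF \<mu>, of x] subspace_scale[OF dom res(1)[OF \<mu>, of x]]
  show "B (res \<mu> x) \<in> dom" unfolding B_res[OF \<mu>] by (intro subspace_diff[OF dom] r x)
  show "\<mu> *\<^sub>R B (res \<mu> x) - B (B (res \<mu> x)) = B x"
    by (simp add: B_res[OF \<mu>] B_diff[OF r(2) x] B_scaleR[OF r(1)])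
qed

lemma res_commute:
  assumes "\<mu> \<noteq> 0" "\<nu> \<noteq> 0"
  shows "res \<mu> (res \<nu> f) = res \<nu> (res \<mu> f)"
proof (rule res_unique[OF assms(2), symmetric])
  show "res \<mu> (res \<nu> f) \<in> dom" by (rule res(1)[OF assms(1)])
  show "\<nu> *\<^sub>R res \<mu> (res \<nu> f) - B (res \<mu> (res \<nu> f)) = res \<mu> f"
    using res(2)[OF assms(2), of f] bounded_linear_res[OF assms(1)]
    by (simp add: res_B[OF assms(1) res(1)[OF assms(2)], symmetric] B_res[OF assms(2)]
        linear_diff[OF bounded_linear.linear] linear_scale[OF bounded_linear.linear])
qed

text \<open>The Yosida-type approximation \<open>n\<^sup>2 B (n\<^sup>2 - B\<^sup>2)\<^sup>-\<^sup>1\<close>; unlike \<open>n B (n - B)\<^sup>-\<^sup>1\<close> it is again skew.\<close>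

definition rate :: "nat \<Rightarrow> real" where "rate n = real (Suc n)"

lemma nz: "rate n \<noteq> 0" "- rate n \<noteq> 0" and rate_pos: "0 < rate n"
  by (simp_all add: rate_def)

text \<open>Since (m - B)(-m - B) = B^2 - m^2, this is m^2 (m^2 - B^2)^(-1) with m =
  \<open>rate n\<close>: a contraction into the domain that commutes with B there and tends to the
  identity.\<close>

definition K :: "nat \<Rightarrow> l2 \<Rightarrow> l2" where
  "K n x = - (rate n)\<^sup>2 *\<^sub>R res (rate n) (res (- rate n) x)"

text \<open>The composition of B with \<open>K n\<close>, from which B is eliminated through
  \<open>B_res\<close> so that the expression is visibly bounded on the whole space.\<close>

definition Bn :: "nat \<Rightarrow> endo" where
  "Bn n = endo_of (\<lambda>x. - (rate n)\<^sup>2 *\<^sub>R (rate n *\<^sub>R res (rate n) (res (- rate n) x) - res (- rate n) x))"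


lemma app_Bn: "app (Bn n) x = - (rate n)\<^sup>2 *\<^sub>R (rate n *\<^sub>R res (rate n) (res (- rate n) x) - res (- rate n) x)"
  unfolding Bn_def
  by (subst app_endo_of) (intro bounded_linear_scaleR_right[THEN bounded_linear_compose] bounded_linear_sub
      bounded_linear_compose[OF bounded_linear_res[OF nz(1)]] bounded_linear_res[OF nz(2)], rule refl)

lemma K_dom: "K n x \<in> dom"
  unfolding K_def by (intro subspace_scale[OF dom] res(1) nz)

lemma B_K: "B (K n x) = app (Bn n) x"
  unfolding K_def app_Bn by (simp only: B_scaleR[OF res(1)[OF nz(1)]] B_res[OF nz(1)])

lemma bounded_linear_K: "bounded_linear (K n)"
  unfolding K_def
  by (intro bounded_linear_scaleR_right[THEN bounded_linear_compose]
      bounded_linear_compose[OF bounded_linear_res[OF nz(1)]] bounded_linear_res[OF nz(2)])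

lemma K_B: "x \<in> dom \<Longrightarrow> K n (B x) = app (Bn n) x"
  unfolding B_K[symmetric]
  by (simp only: K_def res_B[OF nz(2)] res_B[OF nz(1) res(1)[OF nz(2)]] B_scaleR[OF res(1)[OF nz(1)]])

lemma norm_K: "norm (K n x) \<le> norm x"
proof -
  let ?m = "rate n"
  have "norm (K n x) = ?m * (?m * norm (res ?m (res (- ?m) x)))"
    using rate_pos[of n] by (simp add: K_def power2_eq_square mult.assoc)
  also have "\<dots> \<le> ?m * norm (res (- ?m) x)"
    using norm_res[OF nz(1), of n "res (- ?m) x"] rate_pos[of n] by (intro mult_left_mono) auto
  also have "\<dots> \<le> norm x" using norm_res[OF nz(2), of n x] rate_pos[of n] by simp
  finally show ?thesis .
qed

text \<open>Writing x = B (B y) - m^2 y, the approximation takes the value -m^2 B y at x, and B y is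
  orthogonal both to y and to B (B y).\<close>

lemma Bn_skew: "inner (app (Bn n) x) x = 0"
proof -
  let ?m = "rate n"
  define z where "z = res (- ?m) x"
  define y where "y = res ?m z"
  have yz: "y \<in> dom" "z \<in> dom" by (simp_all only: y_def z_def res(1)[OF nz(1)] res(1)[OF nz(2)])
  have By: "B y = ?m *\<^sub>R y - z" unfolding y_def by (rule B_res[OF nz(1)])
  have Bz: "B z = - ?m *\<^sub>R z - x" unfolding z_def by (rule B_res[OF nz(2)])
  have By_dom: "B y \<in> dom" unfolding By by (intro subspace_diff[OF dom] subspace_scale[OF dom] yz)
  have BBy: "B (B y) = ?m\<^sup>2 *\<^sub>R y + x"
  proof -
    have "B (B y) = ?m *\<^sub>R B y - B z"
      by (subst By) (simp only: B_diff[OF subspace_scale[OF dom yz(1)] yz(2)] B_scaleR[OF yz(1)])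
    then show ?thesis by (simp add: By Bz power2_eq_square algebra_simps)
  qed
  have x: "x = B (B y) - ?m\<^sup>2 *\<^sub>R y" using BBy by simp
  have "app (Bn n) x = - ?m\<^sup>2 *\<^sub>R B y" by (simp add: app_Bn y_def z_def B_res nz)
  moreover have "inner (B y) x = 0"
    by (subst x) (simp add: inner_diff_right skew[OF yz(1)] inner_commute[of "B y" "B (B y)"] skew[OF By_dom])
  ultimately show ?thesis by simp
qed

lemma Bn_commute: "Bn n * Bn m = Bn m * Bn n"
proof (rule endo_eqI)
  fix x
  note lin = bounded_linear.linear[OF bounded_linear_res]
  note c = res_commute[OF nz(1) nz(1), of m n] res_commute[OF nz(2) nz(1), of m n]
    res_commute[OF nz(1) nz(2), of m n] res_commute[OF nz(2) nz(2), of m n]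
    res_commute[OF nz(2) nz(1), of n n]
  show "app (Bn n * Bn m) x = app (Bn m * Bn n) x"
    unfolding app_mult app_Bn
    by (simp add: linear_diff[OF lin] linear_scale[OF lin] linear_neg[OF lin] nz c algebra_simps)
qed

text \<open>On the domain, K y - y is a sum of resolvent terms applied to B y and is of order 1 / n.
  Contractivity of \<open>K n\<close> extends the convergence to the whole space by density.\<close>

lemma K_tendsto: "(\<lambda>n. K n x) \<longlonglongrightarrow> x"
proof -
  have dom_lim: "(\<lambda>n. K n y) \<longlonglongrightarrow> y" if y: "y \<in> dom" for y
  proof -
    have "norm (K n y - y) \<le> 2 * norm (B y) * inverse (rate n)" for n
    proof -
      let ?m = "rate n"
      let ?w = "- ?m *\<^sub>R res (- ?m) y"
      have 1: "?m *\<^sub>R res ?m v - v = res ?m (B v)" if "v \<in> dom" for v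
        using B_res[OF nz(1), of n v] res_B[OF nz(1) that, of n] by simp
      have 2: "?w - y = res (- ?m) (B y)"
        using B_res[OF nz(2), of n y] res_B[OF nz(2) y, of n] by simp
      have K: "K n y = ?m *\<^sub>R res ?m ?w"
        using linear_scale[OF bounded_linear.linear[OF bounded_linear_res[OF nz(1)]], of n "- ?m" "res (- ?m) y"]
        by (simp add: K_def power2_eq_square)
      have "K n y - y = ?m *\<^sub>R res ?m (?w - y) + (?m *\<^sub>R res ?m y - y)"
        unfolding K using linear_diff[OF bounded_linear.linear[OF bounded_linear_res[OF nz(1)]], of n ?w y]
        by (simp add: scaleR_diff_right)
      also have "norm \<dots> \<le> ?m * norm (res ?m (res (- ?m) (B y))) + norm (res ?m (B y))"
        unfolding 2 1[OF y] using norm_triangle_ineq[of "?m *\<^sub>R res ?m (res (- ?m) (B y))" "res ?m (B y)"] rate_pos[of n] by simp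
      also have "\<dots> \<le> norm (res (- ?m) (B y)) + norm (res ?m (B y))"
        using norm_res[OF nz(1), of n "res (- ?m) (B y)"] rate_pos[of n] by simp
      also have "\<dots> \<le> norm (B y) * inverse ?m + norm (B y) * inverse ?m"
        using norm_res[OF nz(2), of n "B y"] norm_res[OF nz(1), of n "B y"]
          rate_pos[of n] by (intro add_mono) (simp_all add: field_simps)
      finally show ?thesis by (simp add: algebra_simps)
    qed
    moreover have "(\<lambda>n. 2 * norm (B y) * inverse (rate n)) \<longlonglongrightarrow> 2 * norm (B y) * 0"
      by (intro tendsto_intros LIMSEQ_inverse_real_of_nat[folded rate_def])
    ultimately have "(\<lambda>n. K n y - y) \<longlonglongrightarrow> 0"
      by (intro Lim_null_comparison[of "\<lambda>n. K n y - y" "\<lambda>n. 2 * norm (B y) * inverse (rate n)"]) auto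
    then show ?thesis by (rule LIM_zero_cancel)
  qed
  show ?thesis
  proof (rule LIMSEQ_I)
    fix e :: real assume "e > 0"
    obtain y where y: "y \<in> dom" "dist y x < e / 3" using dom_approx[OF \<open>e > 0\<close>] .
    obtain N where N: "\<And>n. n \<ge> N \<Longrightarrow> norm (K n y - y) < e / 3"
      using LIMSEQ_D[OF dom_lim[OF y(1)], of "e / 3"] \<open>e > 0\<close> by auto
    have "norm (K n x - x) < e" if "n \<ge> N" for n
    proof -
      have "K n x - x = K n (x - y) + (K n y - y) + (y - x)"
        by (simp add: linear_diff[OF bounded_linear.linear[OF bounded_linear_K]])
      also have "norm \<dots> \<le> norm (K n (x - y)) + norm (K n y - y) + norm (y - x)"
        by (intro norm_triangle_le add_mono norm_triangle_ineq order_refl)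
      also have "\<dots> < e / 3 + e / 3 + e / 3"
        using norm_K[of n "x - y"] y(2) N[OF that] by (intro add_strict_mono) (auto simp: dist_norm norm_minus_commute)
      finally show ?thesis by simp
    qed
    then show "\<exists>no. \<forall>n\<ge>no. norm (K n x - x) < e" by blast
  qed
qed

lemma Bn_tendsto: "x \<in> dom \<Longrightarrow> (\<lambda>n. app (Bn n) x) \<longlonglongrightarrow> B x"
  using K_tendsto[of "B x"] by (simp add: K_B)

section \<open>The limit group\<close>

definition En :: "nat \<Rightarrow> real \<Rightarrow> endo" where "En n t = exp (t *\<^sub>R Bn n)"

lemma norm_En [simp]: "norm (app (En n t) x) = norm x"
  unfolding En_def by (rule exp_skew_isometry[OF Bn_skew])

lemma En_diff: "norm (app (En n t) x - app (En m t) x) \<le> \<bar>t\<bar> * norm (app (Bn n) x - app (Bn m) x)"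
  unfolding En_def by (rule exp_difference_bound[OF Bn_skew Bn_skew Bn_commute])

text \<open>On the domain \<open>En_diff\<close> reduces the claim to the convergence of
  \<open>app (Bn n) y\<close>; isometry extends it by density.\<close>

lemma Cauchy_En: "Cauchy (\<lambda>n. app (En n t) x)"
proof (rule CauchyI)
  fix e :: real assume "e > 0"
  obtain y where y: "y \<in> dom" "dist y x < e / 3" using dom_approx[OF \<open>e > 0\<close>] .
  have "Cauchy (\<lambda>n. app (Bn n) y)" using Bn_tendsto[OF y(1)] by (rule LIMSEQ_imp_Cauchy)
  \<comment> \<open>The summand 1 covers t = 0.\<close>
  moreover have "e / (3 * (\<bar>t\<bar> + 1)) > 0" using \<open>e > 0\<close> by simp
  ultimately obtain N where N: "\<And>m n. m \<ge> N \<Longrightarrow> n \<ge> N \<Longrightarrow>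
      norm (app (Bn m) y - app (Bn n) y) < e / (3 * (\<bar>t\<bar> + 1))"
    unfolding Cauchy_iff by meson
  have "norm (app (En m t) x - app (En n t) x) < e" if "m \<ge> N" "n \<ge> N" for m n
  proof -
    have "app (En m t) x - app (En n t) x =
        app (En m t) (x - y) + (app (En m t) y - app (En n t) y) + app (En n t) (y - x)"
      by (simp add: app.diff_right)
    also have "norm \<dots> \<le> norm (app (En m t) (x - y)) + norm (app (En m t) y - app (En n t) y) + norm (app (En n t) (y - x))"
      by (intro norm_triangle_le add_mono norm_triangle_ineq order_refl)
    also have "norm (app (En m t) y - app (En n t) y) \<le> e / 3"
    proof -
      have "norm (app (En m t) y - app (En n t) y) \<le> \<bar>t\<bar> * norm (app (Bn m) y - app (Bn n) y)" by (rule En_diff)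
      also have "\<dots> \<le> (\<bar>t\<bar> + 1) * (e / (3 * (\<bar>t\<bar> + 1)))"
        using N[OF that] by (intro mult_mono) auto
      also have "\<dots> = e / 3" by (simp add: field_simps)
      finally show ?thesis .
    qed
    finally show ?thesis using y(2) by (simp add: dist_norm norm_minus_commute)
  qed
  then show "\<exists>M. \<forall>m\<ge>M. \<forall>n\<ge>M. norm (app (En m t) x - app (En n t) x) < e" by blast
qed

definition S :: "real \<Rightarrow> l2 \<Rightarrow> l2" where "S t x = lim (\<lambda>n. app (En n t) x)"

lemma S: "(\<lambda>n. app (En n t) x) \<longlonglongrightarrow> S t x"
  unfolding S_def using Cauchy_En by (simp add: Cauchy_convergent_iff convergent_LIMSEQ_iff)

lemma S_0: "S 0 x = x"
  using S[of 0 x] by (simp add: En_def LIMSEQ_const_iff)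

lemma norm_S: "norm (S t x) = norm x"
  using tendsto_norm[OF S[of t x]] by (simp add: LIMSEQ_const_iff)

lemma S_diff: "S t (x - y) = S t x - S t y"
  using S[of t "x - y"] tendsto_diff[OF S[of t x] S[of t y]] by (simp add: app.diff_right LIMSEQ_unique)

lemma En_S_bound:
  assumes "x \<in> dom"
  shows "norm (app (En n t) x - S t x) \<le> \<bar>t\<bar> * norm (app (Bn n) x - B x)"
proof (rule tendsto_le[OF sequentially_bot])
  show "(\<lambda>m. \<bar>t\<bar> * norm (app (Bn n) x - app (Bn m) x)) \<longlonglongrightarrow> \<bar>t\<bar> * norm (app (Bn n) x - B x)"
    by (intro tendsto_intros Bn_tendsto assms)
  show "(\<lambda>m. norm (app (En n t) x - app (En m t) x)) \<longlonglongrightarrow> norm (app (En n t) x - S t x)"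
    by (intro tendsto_intros S)
qed (simp add: En_diff)

text \<open>Composing with \<open>K n\<close> puts the approximants into the domain without further
  argument, and B of them is the n-th group applied to \<open>app (Bn n) x\<close>, which converges.
  Closedness of B does the rest.\<close>

lemma S_dom:
  assumes x: "x \<in> dom"
  shows "S t x \<in> dom" "B (S t x) = S t (B x)"
proof -
  have "S t x \<in> dom \<and> B (S t x) = S t (B x)"
  proof (rule closed)
    show "K n (app (En n t) x) \<in> dom" for n by (rule K_dom)
    show "(\<lambda>n. K n (app (En n t) x)) \<longlonglongrightarrow> S t x"
    proof -
      have "(\<lambda>n. K n (app (En n t) x - S t x)) \<longlonglongrightarrow> 0"
      proof (rule Lim_null_comparison)
        show "(\<lambda>n. norm (app (En n t) x - S t x)) \<longlonglongrightarrow> 0" using S by (intro tendsto_norm_zero LIM_zero)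
      qed (simp add: norm_K)
      from tendsto_add[OF this K_tendsto[of "S t x"]] show ?thesis
        by (simp add: linear_diff[OF bounded_linear.linear[OF bounded_linear_K]])
    qed
    have "B (K n (app (En n t) x)) = app (En n t) (app (Bn n) x)" for n
      unfolding B_K En_def using exp_commute[of "t *\<^sub>R Bn n" "Bn n"] by (simp flip: app_mult)
    moreover have "(\<lambda>n. app (En n t) (app (Bn n) x)) \<longlonglongrightarrow> S t (B x)"
    proof -
      have "(\<lambda>n. app (En n t) (app (Bn n) x - B x)) \<longlonglongrightarrow> 0"
        by (rule Lim_null_comparison[OF _ tendsto_norm_zero[OF LIM_zero[OF Bn_tendsto[OF x]]]]) simp
      from tendsto_add[OF this S[of t "B x"]] show ?thesis by (simp add: app.diff_right)
    qed
    ultimately show "(\<lambda>n. B (K n (app (En n t) x))) \<longlonglongrightarrow> S t (B x)" by simp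
  qed
  then show "S t x \<in> dom" "B (S t x) = S t (B x)" by blast+
qed

text \<open>Uniformity over bounded times is what differentiation of the limit in
  \<open>S_derivative\<close> requires. It comes from \<open>En_S_bound\<close>, whose right-hand
  side is linear in |t|, and from density.\<close>

lemma En_uniform:
  assumes "e > 0" "T > 0"
  shows "\<forall>\<^sub>F n in sequentially. \<forall>t\<in>{-T<..<T}. norm (app (En n t) x - S t x) \<le> e"
proof -
  obtain y where y: "y \<in> dom" "dist y x < e / 3" using dom_approx[OF \<open>e > 0\<close>] .
  have "\<forall>\<^sub>F n in sequentially. dist (app (Bn n) y) (B y) < e / (3 * T)"
    using assms by (intro tendstoD[OF Bn_tendsto[OF y(1)]]) simp
  then show ?thesis
  proof eventually_elim
    case (elim n)
    show ?case
    proof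
      fix t assume t: "t \<in> {-T<..<T}"
      have "app (En n t) x - S t x = app (En n t) (x - y) + (app (En n t) y - S t y) + S t (y - x)"
        by (simp add: app.diff_right S_diff)
      also have "norm \<dots> \<le> norm (app (En n t) (x - y)) + norm (app (En n t) y - S t y) + norm (S t (y - x))"
        by (intro norm_triangle_le add_mono norm_triangle_ineq order_refl)
      also have "norm (app (En n t) y - S t y) \<le> e / 3"
      proof -
        have "norm (app (En n t) y - S t y) \<le> \<bar>t\<bar> * norm (app (Bn n) y - B y)" by (rule En_S_bound[OF y(1)])
        also have "\<dots> \<le> T * (e / (3 * T))" using t elim by (intro mult_mono) (auto simp: dist_norm)
        also have "\<dots> = e / 3" using assms(2) by simp
        finally show ?thesis .
      qed
      finally show "norm (app (En n t) x - S t x) \<le> e" using y(2) by (simp add: norm_S dist_norm norm_minus_commute)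
    qed
  qed
qed

lemma S_derivative:
  assumes x: "x \<in> dom"
  shows "((\<lambda>t. S t x) has_vector_derivative S t (B x)) (at t)"
proof -
  define T where "T = \<bar>t\<bar> + 1"
  have T: "T > 0" "t \<in> {-T<..<T}" by (auto simp: T_def)
  have "\<exists>g. \<forall>s\<in>{-T<..<T}. (\<lambda>n. app (En n s) x) \<longlonglongrightarrow> g s \<and>
      (g has_derivative (\<lambda>h. h *\<^sub>R S s (B x))) (at s within {-T<..<T})"
  proof (rule has_derivative_sequence[where f' = "\<lambda>n s h. h *\<^sub>R app (En n s) (app (Bn n) x)"])
    show "convex {-T<..<T}" by simp
    show "((\<lambda>s. app (En n s) x) has_derivative (\<lambda>h. h *\<^sub>R app (En n s) (app (Bn n) x))) (at s within {-T<..<T})" for n s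
    proof -
      have "((\<lambda>s. app (En n s) x) has_vector_derivative app (En n s) (app (Bn n) x)) (at s)"
        using has_vector_derivative_app[OF exp_scaleR_has_vector_derivative_right[of "Bn n" s UNIV] has_vector_derivative_const[of x "at s"]]
        by (simp add: En_def app.zero_right app_mult)
      then show ?thesis using has_derivative_at_withinI by (auto simp: has_vector_derivative_def)
    qed
    show "t \<in> {-T<..<T}" by (rule T)
    show "(\<lambda>n. app (En n t) x) \<longlonglongrightarrow> S t x" by (rule S)
    fix e :: real assume e: "e > 0"
    have "\<forall>\<^sub>F n in sequentially. \<forall>s\<in>{-T<..<T}. norm (app (En n s) (B x) - S s (B x)) \<le> e / 2"
      using e T by (intro En_uniform) auto
    moreover have "\<forall>\<^sub>F n in sequentially. dist (app (Bn n) x) (B x) < e / 2"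
      using e by (intro tendstoD[OF Bn_tendsto[OF x]]) simp
    ultimately show "\<forall>\<^sub>F n in sequentially. \<forall>s\<in>{-T<..<T}. \<forall>h.
        norm (h *\<^sub>R app (En n s) (app (Bn n) x) - h *\<^sub>R S s (B x)) \<le> e * norm h"
    proof eventually_elim
      case (elim n)
      show ?case
      proof (intro ballI allI)
        fix s h assume s: "s \<in> {-T<..<T}"
        have "app (En n s) (app (Bn n) x) - S s (B x) =
            app (En n s) (app (Bn n) x - B x) + (app (En n s) (B x) - S s (B x))" by (simp add: app.diff_right)
        also have "norm \<dots> \<le> norm (app (Bn n) x - B x) + norm (app (En n s) (B x) - S s (B x))"
          by (rule order_trans[OF norm_triangle_ineq]) simp
        also have "\<dots> \<le> e" using elim s by (fastforce simp: dist_norm)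
        finally have "\<bar>h\<bar> * norm (app (En n s) (app (Bn n) x) - S s (B x)) \<le> \<bar>h\<bar> * e"
          by (intro mult_left_mono) auto
        then show "norm (h *\<^sub>R app (En n s) (app (Bn n) x) - h *\<^sub>R S s (B x)) \<le> e * norm h"
          by (simp only: scaleR_diff_right[symmetric] norm_scaleR real_norm_def mult.commute[of e])
      qed
    qed
  qed
  then obtain g where g: "\<And>s. s \<in> {-T<..<T} \<Longrightarrow> (\<lambda>n. app (En n s) x) \<longlonglongrightarrow> g s"
    "(g has_derivative (\<lambda>h. h *\<^sub>R S t (B x))) (at t within {-T<..<T})" using T(2) by blast
  have gS: "g s = S s x" if "s \<in> {-T<..<T}" for s using g(1)[OF that] S LIMSEQ_unique by blast
  have "(g has_vector_derivative S t (B x)) (at t)"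
    using g(2) unfolding has_vector_derivative_def at_within_open[OF T(2) open_greaterThanLessThan] .
  then show ?thesis
    by (rule has_vector_derivative_transform_within_open[where S = "{-T<..<T}"]) (use T gS in auto)
qed

text \<open>Orbits that start in the domain are differentiable; isometry and density give the
  continuity of the others.\<close>

lemma continuous_S: "continuous_on UNIV (\<lambda>t. S t x)"
proof -
  have c: "continuous_on UNIV (\<lambda>t. S t y)" if "y \<in> dom" for y
    using S_derivative[OF that] by (intro continuous_on_vector_derivative) (auto intro: has_vector_derivative_at_within)
  show ?thesis
    unfolding continuous_on_iff
  proof (intro ballI allI impI)
    fix t e :: real assume "e > 0"
    obtain y where y: "y \<in> dom" "dist y x < e / 3" using dom_approx[OF \<open>e > 0\<close>] .
    obtain d where d: "d > 0" "\<And>s. dist s t < d \<Longrightarrow> dist (S s y) (S t y) < e / 3"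
      using c[OF y(1)] \<open>e > 0\<close> unfolding continuous_on_iff by (metis UNIV_I divide_pos_pos zero_less_numeral)
    have "dist (S s x) (S t x) < e" if "dist s t < d" for s
    proof -
      have "S s x - S t x = S s (x - y) + (S s y - S t y) + S t (y - x)" by (simp add: S_diff)
      also have "norm \<dots> \<le> norm (S s (x - y)) + norm (S s y - S t y) + norm (S t (y - x))"
        by (intro norm_triangle_le add_mono norm_triangle_ineq order_refl)
      also have "\<dots> < e" using y(2) d(2)[OF that] by (simp add: norm_S dist_norm norm_minus_commute)
      finally show ?thesis by (simp add: dist_norm)
    qed
    then show "\<exists>d>0. \<forall>x'\<in>UNIV. dist x' t < d \<longrightarrow> dist (S x' x) (S t x) < e" using d(1) by blast
  qed
qed

end

lemma HS_norm_tendsto_bound: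
  assumes "((\<lambda>s. HS_norm n (g s)) \<longlongrightarrow> 0) F" "\<And>s. HS_norm m (f s) \<le> C * HS_norm n (g s)"
  shows "((\<lambda>s. HS_norm m (f s)) \<longlongrightarrow> 0) F"
proof (rule Lim_null_comparison)
  show "((\<lambda>s. C * HS_norm n (g s)) \<longlongrightarrow> 0) F" by (rule tendsto_mult_right_zero[OF assms(1)])
  show "\<forall>\<^sub>F s in F. norm (HS_norm m (f s)) \<le> C * HS_norm n (g s)" using assms(2) by simp
qed

section \<open>The group generated by the Dirichlet realisation\<close>

text \<open>The equation at s' is a fixed point equation built on the solution map R at s, which is
  Lipschitz with constant c; the condition on the step makes it a contraction of factor 1/2.\<close>

lemma continuity_step:
  fixes P Q :: "'a::banach \<Rightarrow> 'b::real_normed_vector"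
  assumes P: "bounded_linear P" and Q: "bounded_linear Q" and q: "\<And>x. norm (Q x) \<le> q * norm x"
    and c: "\<And>x. norm x \<le> c * norm (P x + s *\<^sub>R Q x)" "0 \<le> c"
    and step: "\<bar>s' - s\<bar> * (c * q) \<le> 1 / 2" and sur: "\<And>f. \<exists>x. P x + s *\<^sub>R Q x = f"
  shows "\<exists>x. P x + s' *\<^sub>R Q x = f"
proof -
  note lin = linear_diff[OF bounded_linear.linear[OF P]] linear_diff[OF bounded_linear.linear[OF Q]]
  obtain R where R: "\<And>f. P (R f) + s *\<^sub>R Q (R f) = f" using sur by metis
  have R_diff: "norm (R f - R g) \<le> c * norm (f - g)" for f g
  proof -
    have "P (R f - R g) + s *\<^sub>R Q (R f - R g) = f - g"
      using R[of f] R[of g] by (simp add: lin scaleR_diff_right algebra_simps)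
    then show ?thesis using c(1)[of "R f - R g"] by simp
  qed
  define T where "T x = R (f - (s' - s) *\<^sub>R Q x)" for x
  have "\<exists>!x. T x = x"
  proof (rule banach_fix_type[where c = "1 / 2"])
    show "\<forall>x y. dist (T x) (T y) \<le> 1 / 2 * dist x y"
    proof (intro allI)
      fix x y
      have "dist (T x) (T y) \<le> c * norm ((s' - s) *\<^sub>R Q (y - x))"
        unfolding dist_norm T_def by (rule order_trans[OF R_diff]) (simp add: lin scaleR_diff_right)
      also have "\<dots> \<le> c * (\<bar>s' - s\<bar> * (q * norm (y - x)))"
        using c(2) q[of "y - x"] by (simp add: mult_left_mono)
      also have "\<dots> = (\<bar>s' - s\<bar> * (c * q)) * norm (y - x)" by (simp add: mult_ac)
      also have "\<dots> \<le> 1 / 2 * norm (y - x)" by (rule mult_right_mono[OF step]) simp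
      finally show "dist (T x) (T y) \<le> 1 / 2 * dist x y" by (simp add: dist_norm norm_minus_commute)
    qed
  qed auto
  then obtain x where "T x = x" by blast
  then have "P x + s *\<^sub>R Q x = f - (s' - s) *\<^sub>R Q x" using R[of "f - (s' - s) *\<^sub>R Q x"] by (simp add: T_def)
  then have "P x + s' *\<^sub>R Q x = f" by (simp add: algebra_simps)
  then show ?thesis ..
qed

lemma method_of_continuity:
  fixes P Q :: "'a::banach \<Rightarrow> 'b::real_normed_vector"
  assumes P: "bounded_linear P" and Q: "bounded_linear Q"
    and c: "\<And>s x. 0 \<le> s \<Longrightarrow> s \<le> 1 \<Longrightarrow> norm x \<le> c * norm (P x + s *\<^sub>R Q x)" "0 \<le> c"
    and sur: "\<And>f. \<exists>x. P x = f"
  shows "\<exists>x. P x + Q x = f"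
proof -
  obtain q where q: "q > 0" "\<And>x. norm (Q x) \<le> q * norm x"
    using bounded_linear.pos_bounded[OF Q] by (metis mult.commute)
  \<comment> \<open>A step of length 1 / N must satisfy c q / N <= 1/2.\<close>
  obtain N :: nat where N: "2 * (c * q) + 1 < real N" using reals_Archimedean2 by blast
  have N0: "real N > 0" using N c(2) q(1) mult_nonneg_nonneg[of c q] by linarith
  have "\<exists>x. P x + (real j / real N) *\<^sub>R Q x = f" if "j \<le> N" for j f
    using that
  proof (induction j arbitrary: f)
    case 0
    then show ?case using sur by simp
  next
    case (Suc j)
    have j: "real j / real N \<le> 1" "0 \<le> real j / real N" using Suc.prems N0 by simp_all
    have "\<bar>real (Suc j) / real N - real j / real N\<bar> * (c * q) \<le> 1 / 2"
    proof -
      have "real (Suc j) / real N - real j / real N = 1 / real N" by (simp add: diff_divide_distrib[symmetric])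
      moreover have "c * q \<le> real N / 2" using N by linarith
      ultimately show ?thesis using N0 by (simp add: field_simps)
    qed
    then show ?case
    proof (rule continuity_step[OF P Q q(2) c(1)[OF j(2,1)] c(2)])
      show "\<exists>x. P x + (real j / real N) *\<^sub>R Q x = f" for f using Suc.IH Suc.prems by simp
    qed
  qed
  from this[of N f] N0 show ?thesis by simp
qed

lemma cnj_pr: "cnj (pr a b) = pr (cj a) (cj b)"
  by (cases a rule: cl_cases, cases b rule: cl_cases)
     (simp add: cj_cl pr_cl L2_cnj flip: Bochner_Integration.integral_cnj)

text \<open>For a real potential the bilinear pairing of V u with the conjugate of u equals its own
  conjugate. It is therefore real, and a factor i makes its real part vanish.\<close>

lemma inner_mul_real:
  assumes "continuous_on {0..1} V"
  shows "inner (csc \<i> (mul (\<lambda>x. of_real (V x)) u)) u = 0"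
proof -
  let ?W = "\<lambda>x. complex_of_real (V x)"
  have "continuous_on {0..1} ?W" using assms by (rule continuous_on_of_real)
  then have "cnj (pr (mul ?W u) (cj u)) = pr (mul ?W (cj u)) u"
    by (simp add: cnj_pr cj_mul)
  also have "\<dots> = pr (mul ?W u) (cj u)" by (metis pr_mul pr_sym)
  finally have "Im (cnj (pr (mul ?W u) (cj u))) = Im (pr (mul ?W u) (cj u))" by (rule arg_cong)
  then have "Im (pr (mul ?W u) (cj u)) = 0" by simp
  then show ?thesis by (simp add: inner_eq_pr pr_csc)
qed

locale schroedinger =
  fixes V :: "real \<Rightarrow> real"
  assumes smooth: "smooth_on {0..1} V"
begin

definition W :: "real \<Rightarrow> complex" where "W x = of_real (V x)"

lemma W: "smooth_upto m W" unfolding W_def[abs_def] by (rule smooth_on_imp_smooth_upto[OF smooth])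

text \<open>With this factor the Schroedinger equation reads U' = B U, and the operator becomes
  skew.\<close>

definition B :: "l2 \<Rightarrow> l2" where "B u = csc (- \<i>) (A W u)"

lemma A_eq_B: "A W u = csc \<i> (B u)" by (simp add: B_def csc_csc)

lemma A_G: "A W (G g) = g + mul W (G g)" by (simp add: A_def)

lemma range_G_HS: "x \<in> range G \<Longrightarrow> x \<in> HS (Suc (Suc 0))" using HS_G[of _ 0] by auto

lemma skew_B: "inner (B (G g)) (G g) = 0"
proof -
  have "B (G g) = - (csc \<i> g + csc \<i> (mul W (G g)))"
    unfolding B_def A_G csc_minus by (simp add: mul_add)
  then show ?thesis
    using inner_mul_real[OF smooth_on_continuous[OF smooth], of "G g"] inner_G[of g] unfolding W_def[abs_def]
    by (simp add: inner_diff_left inner_minus_left)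
qed

text \<open>Written in terms of \<open>g = \<partial>\<^sup>2 x\<close>, the equation joins \<open>\<i> g = f\<close> to the wanted one by a segment on
  which skewness gives a uniform a priori bound.\<close>

lemma resolvent_surj:
  assumes "\<mu> \<noteq> 0"
  shows "\<exists>x\<in>range G. \<mu> *\<^sub>R x - B x = f"
proof -
  let ?Q = "\<lambda>g. \<mu> *\<^sub>R G g + csc \<i> (mul W (G g))"
  have Q: "bounded_linear ?Q"
    by (intro bounded_linear_add bounded_linear_compose[OF bounded_linear_scaleR_right]
        bounded_linear_compose[OF bounded_linear_mul] bounded_linear_G)
  obtain M where M: "M \<ge> 0" "\<And>u. norm (mul W u) \<le> M * norm u" by (rule mul_bound) blast
  have "\<exists>g. csc \<i> g + ?Q g = f"
  proof (rule method_of_continuity[OF bounded_linear_mul Q])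
    show "0 \<le> 1 + (\<bar>\<mu>\<bar> + M) / \<bar>\<mu>\<bar>" using M by simp
    show "\<exists>x. csc \<i> x = f" for f by (rule exI[of _ "csc (- \<i>) f"]) (simp add: csc_csc)
    fix s :: real and g assume s: "0 \<le> s" "s \<le> 1"
    let ?L = "csc \<i> g + s *\<^sub>R ?Q g"
    have "inner ?L (G g) = s * \<mu> * (norm (G g))\<^sup>2"
      using inner_mul_real[OF smooth_on_continuous[OF smooth], of "G g"] inner_G[of g] unfolding W_def[abs_def]
      by (simp add: inner_add_left power2_norm_eq_inner)
    then have "s * \<bar>\<mu>\<bar> * (norm (G g))\<^sup>2 = \<bar>inner ?L (G g)\<bar>"
      using s(1) by (simp add: abs_mult)
    also have "\<dots> \<le> norm ?L * norm (G g)" by (rule Cauchy_Schwarz_ineq2)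
    finally have 1: "s * \<bar>\<mu>\<bar> * norm (G g) \<le> norm ?L"
      by (cases "G g = 0") (simp_all add: power2_eq_square)
    have "norm g = norm (?L - s *\<^sub>R ?Q g)" by (simp add: norm_csc)
    also have "\<dots> \<le> norm ?L + s * norm (?Q g)"
      using norm_triangle_ineq4[of ?L "s *\<^sub>R ?Q g"] s(1) by simp
    also have "norm (?Q g) \<le> (\<bar>\<mu>\<bar> + M) * norm (G g)"
      using norm_triangle_ineq[of "\<mu> *\<^sub>R G g" "csc \<i> (mul W (G g))"] M(2)[of "G g"]
      by (simp add: norm_csc distrib_right)
    \<comment> \<open>The factor s is kept: skewness bounds only s |\<mu>| times the norm of
      \<open>G g\<close>, which says little about \<open>G g\<close> for small s, but the term to be
      absorbed carries the same s.\<close>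
    also have "s * ((\<bar>\<mu>\<bar> + M) * norm (G g)) = (\<bar>\<mu>\<bar> + M) / \<bar>\<mu>\<bar> * (s * \<bar>\<mu>\<bar> * norm (G g))"
      using assms by simp
    also have "\<dots> \<le> (\<bar>\<mu>\<bar> + M) / \<bar>\<mu>\<bar> * norm ?L" using 1 M(1) by (intro mult_left_mono) auto
    finally show "norm g \<le> (1 + (\<bar>\<mu>\<bar> + M) / \<bar>\<mu>\<bar>) * norm ?L"
      using s(1) by (simp add: distrib_right mult_left_mono)
  qed
  then obtain g where g: "csc \<i> g + ?Q g = f" by blast
  have "\<mu> *\<^sub>R G g - B (G g) = f"
    unfolding B_def A_G csc_minus using g by (simp add: mul_add algebra_simps)
  then show ?thesis by blast
qed

sublocale skew_adjoint "range G" B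
proof
  show "subspace (range G)"
    by (rule linear_subspace_image[OF bounded_linear.linear[OF bounded_linear_G] subspace_UNIV])
  show "B (x + y) = B x + B y" if "x \<in> range G" "y \<in> range G" for x y
    using range_G_HS[OF that(1)] range_G_HS[OF that(2)]
    by (simp add: B_def A_add[of x 0 y 0] mul_add)
  show "B (r *\<^sub>R x) = r *\<^sub>R B x" if "x \<in> range G" for x r
    using range_G_HS[OF that]
    by (simp add: B_def A_scaleR[of x 0] mul_scaleR)
  show "closure (range G) = UNIV" by (rule closure_range_G)
  show "inner (B x) x = 0" if "x \<in> range G" for x using that skew_B by blast
  show "\<exists>x\<in>range G. \<mu> *\<^sub>R x - B x = f" if "\<mu> \<noteq> 0" for \<mu> f using that by (rule resolvent_surj)
  fix xs :: "nat \<Rightarrow> l2" and x y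
  assume xs: "\<And>n. xs n \<in> range G" "xs \<longlonglongrightarrow> x" "(\<lambda>n. B (xs n)) \<longlonglongrightarrow> y"
  \<comment> \<open>The limit of the second derivatives. Passing to the limit under the bounded
    operator \<open>G\<close> shows at once that x lies in the range.\<close>
  define h where "h = csc \<i> y - mul W x"
  have DD: "D (D (xs n)) = csc \<i> (B (xs n)) - mul W (xs n)" for n
    unfolding A_eq_B[symmetric] by (simp add: A_def)
  have "(\<lambda>n. D (D (xs n))) \<longlonglongrightarrow> h"
    unfolding DD h_def by (intro tendsto_diff bounded_linear.tendsto[OF bounded_linear_mul] xs)
  then have "(\<lambda>n. G (D (D (xs n)))) \<longlonglongrightarrow> G h" by (rule bounded_linear.tendsto[OF bounded_linear_G])
  moreover have "G (D (D (xs n))) = xs n" for n using xs(1)[of n] by auto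
  ultimately have x: "x = G h" using xs(2) LIMSEQ_unique by simp
  have "A W x = h + mul W x" using A_G[of h] by (simp only: x)
  then have "A W x = csc \<i> y" by (simp add: h_def)
  then show "x \<in> range G \<and> B x = y" unfolding B_def using x by (simp add: csc_csc)
qed

lemma HV_Suc_iff_B: "w \<in> HV W (Suc k) \<longleftrightarrow> w \<in> range G \<and> B w \<in> HV W k"
proof -
  have "B w \<in> HV W k" if "A W w \<in> HV W k" unfolding B_def using that by (rule HV_csc[OF W])
  moreover have "A W w \<in> HV W k" if "B w \<in> HV W k" unfolding A_eq_B using that by (rule HV_csc[OF W])
  ultimately show ?thesis unfolding HV_Suc_iff[OF W] by blast
qed

text \<open>The group commutes with B, and \<open>HV W k\<close> is the domain of the k-th power of
  B.\<close>

lemma S_HV: "x \<in> HV W k \<Longrightarrow> S t x \<in> HV W k"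
proof (induction k arbitrary: x)
  case (Suc k)
  then show ?case using S_dom[of x t] unfolding HV_Suc_iff_B by auto
qed (simp add: HV_def)

text \<open>The powers differ by a unimodular constant. Regularity of w serves to pull the constant
  out of \<open>A W\<close>, linearity of \<open>D\<close> being available on differentiable
  classes.\<close>

lemma norm_A_B: "w \<in> HS (2 * l) \<Longrightarrow> norm ((A W ^^ l) w) = norm ((B ^^ l) w)"
proof -
  have "\<exists>c. cmod c = 1 \<and> (\<forall>w\<in>HS (2 * l). (B ^^ l) w = csc c ((A W ^^ l) w))"
  proof (induction l)
    case 0
    then show ?case by (intro exI[of _ 1]) auto
  next
    case (Suc l)
    then obtain c where c: "cmod c = 1" "\<And>w. w \<in> HS (2 * l) \<Longrightarrow> (B ^^ l) w = csc c ((A W ^^ l) w)" by blast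
    have "(B ^^ Suc l) w = csc (c * - \<i>) ((A W ^^ Suc l) w)" if w: "w \<in> HS (2 * Suc l)" for w
    proof -
      have Aw: "A W w \<in> HS (2 * l)" using A_HS[OF W, of w "2 * l"] w by simp
      then have "B w \<in> HS (2 * l)" unfolding B_def by (rule HS_csc)
      then have "(B ^^ l) (B w) = csc c ((A W ^^ l) (csc (- \<i>) (A W w)))" using c(2) by (simp add: B_def)
      also have "\<dots> = csc (c * - \<i>) ((A W ^^ l) (A W w))" by (simp only: funpow_A_csc[OF W Aw] csc_csc)
      finally show ?thesis by (simp only: funpow_Suc_right o_apply)
    qed
    then show ?case using c(1) by (intro exI[of _ "c * - \<i>"]) (auto simp: norm_mult)
  qed
  then show "w \<in> HS (2 * l) \<Longrightarrow> ?thesis" by (auto simp: norm_csc)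
qed

lemma S_funpow_B: "x \<in> HV W k \<Longrightarrow> l \<le> k \<Longrightarrow> (B ^^ l) (S t x) = S t ((B ^^ l) x) \<and> (B ^^ l) x \<in> HV W (k - l)"
proof (induction l arbitrary: x k)
  case (Suc l)
  then obtain j where k: "k = Suc j" by (cases k) auto
  with Suc have "x \<in> range G" "B x \<in> HV W j" using HV_Suc_iff_B by auto
  then show ?case using Suc.IH[of "B x" j] Suc.prems k S_dom[of x t] by (simp only: funpow_Suc_right o_apply) simp
qed simp

lemma funpow_B_diff:
  "x \<in> HV W k \<Longrightarrow> y \<in> HV W k \<Longrightarrow> l \<le> k \<Longrightarrow> (B ^^ l) (x - y) = (B ^^ l) x - (B ^^ l) y"
proof (induction l arbitrary: x y k)
  case (Suc l)
  then obtain j where k: "k = Suc j" by (cases k) auto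
  with Suc have "x \<in> range G" "B x \<in> HV W j" "y \<in> range G" "B y \<in> HV W j" using HV_Suc_iff_B by auto
  then show ?case using Suc.IH[of "B x" j "B y"] Suc.prems k by (simp only: funpow_Suc_right o_apply) (simp add: B_diff)
qed simp

lemma funpow_B_scaleR:
  "x \<in> HV W k \<Longrightarrow> l \<le> k \<Longrightarrow> (B ^^ l) (r *\<^sub>R x) = r *\<^sub>R ((B ^^ l) x)"
proof (induction l arbitrary: x k)
  case (Suc l)
  then obtain j where k: "k = Suc j" by (cases k) auto
  with Suc have "x \<in> range G" "B x \<in> HV W j" using HV_Suc_iff_B by auto
  then show ?case using Suc.IH[of "B x" j] Suc.prems k by (simp only: funpow_Suc_right o_apply) (simp add: B_scaleR)
qed simp

text \<open>By \<open>graph_norm_estimate\<close>, convergence in the Sobolev norm becomes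
  convergence in \<open>l2\<close> of finitely many powers of B, where the properties of the group
  apply.\<close>

lemma HS_norm_tendsto_HV:
  assumes "\<And>s. f s \<in> HV W k" "\<And>l. l \<le> k \<Longrightarrow> ((\<lambda>s. (B ^^ l) (f s)) \<longlongrightarrow> 0) F"
  shows "((\<lambda>s. HS_norm (2 * k) (f s)) \<longlongrightarrow> 0) F"
proof -
  obtain C where C: "\<And>w. w \<in> HV W k \<Longrightarrow> HS_norm (2 * k) w \<le> C * (\<Sum>l\<le>k. norm ((A W ^^ l) w))"
    using graph_norm_estimate[OF W, of k] by blast
  have le: "HS_norm (2 * k) (f s) \<le> C * (\<Sum>l\<le>k. norm ((B ^^ l) (f s)))" for s
  proof -
    have "norm ((A W ^^ l) (f s)) = norm ((B ^^ l) (f s))" if "l \<le> k" for l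
      using that by (intro norm_A_B HS_mono[OF HV_HS[OF W assms(1)]]) simp
    then show ?thesis using C[OF assms(1)[of s]] by simp
  qed
  have "((\<lambda>s. C * (\<Sum>l\<le>k. norm ((B ^^ l) (f s)))) \<longlongrightarrow> C * (\<Sum>l\<le>k. norm (0 :: l2))) F"
    by (intro tendsto_intros assms(2)) simp
  then have "((\<lambda>s. C * (\<Sum>l\<le>k. norm ((B ^^ l) (f s)))) \<longlongrightarrow> 0) F" by simp
  then show ?thesis by (rule Lim_null_comparison[rotated]) (simp add: le)
qed

text \<open>The common form, free of representatives, to which both the boundary value problem and
  the modified equation are reduced.\<close>

definition strong_solution :: "nat \<Rightarrow> (real \<Rightarrow> l2) \<Rightarrow> bool" where
  "strong_solution k U \<longleftrightarrow> (\<forall>t. U t \<in> HV W k) \<and> curve_continuous (2 * k) U \<and> (\<forall>t. curve_deriv (2 * k - 2) U t (B (U t)))"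

text \<open>Powers of B pass through \<open>S\<close>, so after \<open>HS_norm_tendsto_HV\<close>
  continuity and differentiability are those of the orbit of \<open>(B ^^ l) x\<close> in
  \<open>l2\<close>. The derivative uses up one power of B, hence two orders of regularity.\<close>

lemma strong_solution_exists:
  assumes x: "x \<in> HV W (Suc k)"
  shows "strong_solution (Suc k) (\<lambda>t. S t x)"
  unfolding strong_solution_def
proof (intro conjI allI)
  have cont: "((\<lambda>s. S s y) \<longlongrightarrow> S t y) (at t)" for t y
    using continuous_S[of y] by (simp add: continuous_on_def)
  show "S t x \<in> HV W (Suc k)" for t by (rule S_HV[OF x])
  show "curve_continuous (2 * Suc k) (\<lambda>t. S t x)"
    unfolding curve_continuous_def
  proof (intro allI HS_norm_tendsto_HV)
    fix t
    show "S s x - S t x \<in> HV W (Suc k)" for s by (intro HV_diff[OF W] S_HV x)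
    fix l assume l: "l \<le> Suc k"
    have "(B ^^ l) (S s x - S t x) = S s ((B ^^ l) x) - S t ((B ^^ l) x)" for s
      using S_funpow_B[OF x l] funpow_B_diff[OF S_HV[OF x] S_HV[OF x] l] by simp
    then show "((\<lambda>s. (B ^^ l) (S s x - S t x)) \<longlongrightarrow> 0) (at t)" using LIM_zero[OF cont] by simp
  qed
  show "curve_deriv (2 * Suc k - 2) (\<lambda>t. S t x) t (B (S t x))" for t
  proof -
    have Bx: "x \<in> range G" "B x \<in> HV W k" using x unfolding HV_Suc_iff_B by blast+
    have xk: "x \<in> HV W k" by (rule HV_Suc_subset[OF W x])
    have BS: "B (S t x) = S t (B x)" by (rule S_dom(2)[OF Bx(1)])
    have q: "(S (t + h) x - S t x) /\<^sub>R h \<in> HV W k" for h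
      by (intro HV_scaleR[OF W] HV_diff[OF W] S_HV xk)
    have d: "S (t + h) x - S t x \<in> HV W k" for h by (intro HV_diff[OF W] S_HV xk)
    have "((\<lambda>h. HS_norm (2 * k) ((S (t + h) x - S t x) /\<^sub>R h - B (S t x))) \<longlongrightarrow> 0) (at 0)"
      unfolding BS
    proof (rule HS_norm_tendsto_HV)
      show "(S (t + h) x - S t x) /\<^sub>R h - S t (B x) \<in> HV W k" for h
        by (intro HV_diff[OF W] q S_HV Bx)
      fix l assume l: "l \<le> k"
      \<comment> \<open>Here l is at most k while x lies in \<open>HV W (Suc k)\<close>, so y is
        still in the domain of B and its orbit is differentiable.\<close>
      define y where "y = (B ^^ l) x"
      have y: "y \<in> range G"
        using S_funpow_B[OF x, of l] l HV_Suc_iff_B[of y "k - l"] by (simp add: y_def Suc_diff_le)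
      have "(B ^^ l) ((S (t + h) x - S t x) /\<^sub>R h - S t (B x)) = (S (t + h) y - S t y) /\<^sub>R h - S t (B y)" for h
      proof -
        have "(B ^^ l) (S t (B x)) = S t (B y)"
          using S_funpow_B[OF Bx(2) l] by (simp add: y_def funpow_swap1)
        then show ?thesis
          unfolding funpow_B_diff[OF q S_HV[OF Bx(2)] l] funpow_B_scaleR[OF d l]
            funpow_B_diff[OF S_HV[OF xk] S_HV[OF xk] l]
          using S_funpow_B[OF xk l] by (simp add: y_def)
      qed
      moreover have "((\<lambda>h. (S (t + h) y - S t y) /\<^sub>R h - S t (B y)) \<longlongrightarrow> 0) (at 0)"
        using S_derivative[OF y, of t] unfolding has_vector_derivative_iff_quotient .
      ultimately show "((\<lambda>h. (B ^^ l) ((S (t + h) x - S t x) /\<^sub>R h - S t (B x))) \<longlongrightarrow> 0) (at 0)" by simp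
    qed
    then show ?thesis by (simp add: curve_deriv_def)
  qed
qed

lemma strong_solution_unique:
  assumes "strong_solution (Suc k) U" "strong_solution (Suc k) U'" "U 0 = U' 0"
  shows "U t = U' t"
proof -
  define Z where "Z s = U s - U' s" for s
  have r: "U s \<in> range G" "U' s \<in> range G" for s
    using assms(1,2) HV_Suc_iff_B by (auto simp: strong_solution_def)
  have Zr: "Z s \<in> range G" "B (Z s) = B (U s) - B (U' s)" for s
    unfolding Z_def using r by (auto intro!: subspace_diff[OF dom] B_diff)
  have d: "(Z has_vector_derivative B (Z s)) (at s)" for s
    unfolding Zr(2) unfolding Z_def[abs_def]
    using assms(1,2) by (intro has_vector_derivative_diff curve_deriv_imp_has_vector_derivative) (auto simp: strong_solution_def)
  have "((\<lambda>s. inner (Z s) (Z s)) has_real_derivative 0) (at s)" for s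
  proof -
    have "((\<lambda>s. inner (Z s) (Z s)) has_vector_derivative (inner (Z s) (B (Z s)) + inner (B (Z s)) (Z s))) (at s)"
      by (rule bounded_bilinear.has_vector_derivative[OF bounded_bilinear_inner d d])
    then show ?thesis
      by (simp add: skew[OF Zr(1)] inner_commute[of "Z s"] has_real_derivative_iff_has_vector_derivative)
  qed
  then have "inner (Z t) (Z t) = inner (Z 0) (Z 0)" by (rule DERIV_isconst_all[rule_format])
  then show ?thesis using assms(3) by (simp add: Z_def)
qed

lemma HS_B: "u \<in> HS (Suc (Suc m)) \<Longrightarrow> B u \<in> HS m"
  unfolding B_def by (intro HS_csc A_HS[OF W])

lemma curve_continuous_B:
  assumes U: "\<And>t. U t \<in> HS (Suc (Suc m))" and c: "curve_continuous (Suc (Suc m)) U"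
  shows "curve_continuous m (\<lambda>t. B (U t))"
proof -
  obtain C where C: "0 \<le> C" "\<And>u. u \<in> HS (Suc (Suc m)) \<Longrightarrow> HS_norm m (A W u) \<le> C * HS_norm (Suc (Suc m)) u"
    by (rule A_bound[OF W]) blast
  have "HS_norm m (B (U s) - B (U t)) \<le> C * HS_norm (Suc (Suc m)) (U s - U t)" for s t
  proof -
    have "B (U s) - B (U t) = csc (- \<i>) (A W (U s - U t))"
      by (simp add: B_def A_diff[OF U U] mul_diff)
    then show ?thesis
      using C(2)[OF HS_diff[OF U U], of s t] HS_norm_csc[OF A_HS[OF W HS_diff[OF U U]], of "- \<i>" s t]
      by (simp del: HS_norm.simps)
  qed
  note le = this
  show ?thesis
    unfolding curve_continuous_def
    by (intro allI, rule HS_norm_tendsto_bound, rule c[unfolded curve_continuous_def, rule_format], rule le)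
qed

text \<open>If \<open>U\<close> takes values in \<open>HV W j\<close>, so do its difference quotients, and hence also \<open>B (U t)\<close>.\<close>

lemma Dirichlet_bootstrap:
  assumes U: "\<And>t. U t \<in> HS (2 * k)" "\<And>t. ev (U t) 0 = 0" "\<And>t. ev (U t) 1 = 0"
    and d: "\<And>t. curve_deriv (2 * k - 2) U t (B (U t))" and "1 \<le> j" "j \<le> k"
  shows "U t \<in> HV W j"
  using assms(5,6)
proof (induction j arbitrary: t rule: dec_induct)
  case base
  have "U t \<in> HS 2" by (rule HS_mono[OF U(1)]) (use base in simp)
  then show ?case using U(2,3)[of t] by (simp add: HV_def)
next
  case (step j)
  have h: "((\<lambda>h. HS_norm (2 * k - 2) ((U (t + h) - U t) /\<^sub>R h - B (U t))) \<longlongrightarrow> 0) (at 0)"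
    using d[of t] by (simp add: curve_deriv_def)
  have "((\<lambda>h. HS_norm (2 * j) ((U (t + h) - U t) /\<^sub>R h - B (U t))) \<longlongrightarrow> 0) (at 0)"
    by (rule Lim_null_comparison[OF _ h]) (use step in \<open>auto intro!: always_eventually HS_norm_mono\<close>)
  then have "B (U t) \<in> HV W j"
  proof (rule HV_closed[OF W, rotated 2])
    show "(U (t + h) - U t) /\<^sub>R h \<in> HV W j" for h
      using step by (intro HV_scaleR[OF W] HV_diff[OF W]) auto
    show "B (U t) \<in> HS (2 * j)" by (rule HS_B, rule HS_mono[OF U(1)]) (use step in simp)
  qed simp
  moreover have "U t \<in> range G"
  proof -
    have "U t \<in> HS 2" by (rule HS_mono[OF U(1)]) (use step in simp)
    then show ?thesis using U(2,3)[of t] by (simp only: range_G_iff[OF W])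
  qed
  ultimately show ?case by (simp add: HV_Suc_iff_B)
qed

end

lemma Sob_mono: "u \<in> Sob n \<Longrightarrow> m \<le> n \<Longrightarrow> u \<in> Sob m"
  using HS_mono by (auto simp: Sob_iff)

lemma curve_continuous_app:
  assumes "curve_continuous m U" "\<And>t. U t \<in> HS m" "sob_bounded m (app a)"
  shows "curve_continuous m (\<lambda>t. app a (U t))"
proof -
  obtain C where C: "0 \<le> C" "\<And>u. u \<in> HS m \<Longrightarrow> HS_norm m (app a u) \<le> C * HS_norm m u"
    by (rule bndE[OF assms(3)]) blast
  have "HS_norm m (app a (U s) - app a (U t)) \<le> C * HS_norm m (U s - U t)" for s t
    using C(2)[OF HS_diff[OF assms(2) assms(2)], of s t] by (simp add: app.diff_right)
  note le = this
  show ?thesis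
    unfolding curve_continuous_def
    by (intro allI, rule HS_norm_tendsto_bound, rule assms(1)[unfolded curve_continuous_def, rule_format], rule le)
qed

lemma curve_deriv_app:
  assumes "curve_deriv m U t g" "\<And>t. U t \<in> HS m" "g \<in> HS m" "sob_bounded m (app a)"
  shows "curve_deriv m (\<lambda>t. app a (U t)) t (app a g)"
proof -
  obtain C where C: "0 \<le> C" "\<And>u. u \<in> HS m \<Longrightarrow> HS_norm m (app a u) \<le> C * HS_norm m u"
    by (rule bndE[OF assms(4)]) blast
  have "HS_norm m ((app a (U (t + h)) - app a (U t)) /\<^sub>R h - app a g) \<le> C * HS_norm m ((U (t + h) - U t) /\<^sub>R h - g)" for h
    using C(2)[OF HS_diff[OF HS_scaleR[OF HS_diff[OF assms(2) assms(2)]] assms(3)], of "inverse h" "t + h" t]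
    by (simp add: app.diff_right app.scaleR_right)
  note le = this
  show ?thesis
    unfolding curve_deriv_def by (rule HS_norm_tendsto_bound, rule assms(1)[unfolded curve_deriv_def], rule le)
qed

lemma primy_csc: "primy y (csc c u) = csc c (primy y u)"
proof -
  have "cst (c * a) = csc c (cst a)" for a by (simp add: mul_cl L2_const)
  then show ?thesis
    by (simp add: primy_def prim_csc integ_csc mul_diff)
qed

lemma corrop_csc: "corrop \<phi> \<alpha> k (csc c u) = csc c (corrop \<phi> \<alpha> k u)"
proof -
  have "iterop n y (csc c u) = csc c (iterop n y u)" for n y
    by (simp only: iterop_def mul_csc primy_csc cv.scale_sum_right)
  then show ?thesis by (simp only: corrop_def mul_csc cv.scale_sum_right)
qed

text \<open>Multiplication by c is itself a bounded operator commuting with a, so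
  \<open>exp_commute\<close> applies.\<close>

lemma exp_app_csc:
  assumes "\<And>x. app a (csc c x) = csc c (app a x)"
  shows "app (exp a) (csc c x) = csc c (app (exp a) x)"
proof -
  have "a * endo_of (csc c) = endo_of (csc c) * a"
    by (rule endo_eqI) (simp add: app_mult app_endo_of[OF bounded_linear_mul] assms)
  then have "exp a * endo_of (csc c) = endo_of (csc c) * exp a" by (rule exp_commute)
  then have "app (exp a * endo_of (csc c)) x = app (endo_of (csc c) * exp a) x" by simp
  then show ?thesis by (simp add: app_mult app_endo_of[OF bounded_linear_mul])
qed

section \<open>The correspondence of solutions\<close>

locale corrected_schroedinger = schroedinger +
  fixes \<phi> :: "nat \<Rightarrow> real \<Rightarrow> real \<Rightarrow> real" and \<alpha> :: "nat \<Rightarrow> nat \<Rightarrow> real \<Rightarrow> real" and k :: nat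
  assumes cutoffs: "boundary_cutoffs \<phi>" and admissible: "admissible_coeffs V \<phi> \<alpha>" and k: "k \<ge> 1"
begin

section \<open>The conjugating exponential and the spaces that it exchanges\<close>

definition E :: endo where "E = exp (corr_endo \<phi> \<alpha> k)"
definition E' :: endo where "E' = exp (- corr_endo \<phi> \<alpha> k)"

lemma sob_bounded_E: "sob_bounded m (app E)" "sob_bounded m (app E')"
  unfolding E_def E'_def by (rule sob_bounded_exp_corr_endo[OF cutoffs])+

lemma E_inverse [simp]: "app E (app E' x) = x" "app E' (app E x) = x"
  unfolding E_def E'_def by simp_all

lemma E_csc: "app E (csc c x) = csc c (app E x)"
  unfolding E_def by (rule exp_app_csc) (simp add: app_corr_endo corrop_csc)

lemma E'_csc: "app E' (csc c x) = csc c (app E' x)"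
  using E_csc[of c "app E' x"] E_inverse(2)[of "csc c (app E' x)"] by simp

lemma exp_corr_E: "u \<in> L2 \<Longrightarrow> exp_corr \<phi> \<alpha> k u \<in> L2 \<and> cl (exp_corr \<phi> \<alpha> k u) = app E (cl u)"
  unfolding E_def using exp_corr[OF cutoffs] by blast

lemma E_range_Suc: "app E ` range (G ^^ Suc k) \<subseteq> HV W (Suc k)"
proof
  fix y assume "y \<in> app E ` range (G ^^ Suc k)"
  then obtain x where x: "x \<in> range (G ^^ Suc k)" "y = app E x" by blast
  obtain u where u: "u \<in> L2" "x = cl u" by (rule cl_cases)
  have "u \<in> Sob_Dir (k + 1)" using u x unfolding Sob_Dir_iff by simp
  then have "exp_corr \<phi> \<alpha> k u \<in> Sob_V V (k + 1)"
    using admissible k unfolding admissible_coeffs_def by blast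
  then have "cl (exp_corr \<phi> \<alpha> k u) \<in> HV W (k + 1)" unfolding Sob_V_iff[OF smooth] W_def[abs_def] by blast
  then show "y \<in> HV W (Suc k)" using exp_corr_E[OF u(1)] u(2) x(2) by simp
qed

lemma E_range_iff: "u \<in> HS (2 * k) \<Longrightarrow> app E u \<in> HV W k \<longleftrightarrow> u \<in> range (G ^^ k)"
  using conjugation_Dirichlet_iff[OF W cutoffs sob_bounded_E E_inverse E_csc E_range_Suc] .

lemma range_G_HS2k: "u \<in> range (G ^^ j) \<Longrightarrow> u \<in> HS (2 * j)"
  using Dirichlet_iff_range_G by blast

lemma E_range: "u \<in> range (G ^^ k) \<Longrightarrow> app E u \<in> HV W k"
  using E_range_iff range_G_HS2k by blast

lemma E'_HV: "w \<in> HV W k \<Longrightarrow> app E' w \<in> range (G ^^ k)"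
  using E_range_iff[of "app E' w"] sob_bounded_HS[OF sob_bounded_E(2) HV_HS[OF W]] by simp

text \<open>The inclusion at level k, once proved, serves as the hypothesis of
  \<open>conjugation_Dirichlet_iff\<close> one level lower. It is needed because
  \<open>C1_curve\<close> demands time derivatives in \<open>Sob_Dir (k - 1)\<close>.\<close>

lemma E'_HV_pred: "w \<in> HV W (k - 1) \<Longrightarrow> app E' w \<in> range (G ^^ (k - 1))"
proof -
  assume w: "w \<in> HV W (k - 1)"
  have "app E ` range (G ^^ Suc (k - 1)) \<subseteq> HV W (Suc (k - 1))" using E_range k by auto
  from conjugation_Dirichlet_iff[OF W cutoffs sob_bounded_E E_inverse E_csc this sob_bounded_HS[OF sob_bounded_E(2) HV_HS[OF W w]]]
  show ?thesis using w by simp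
qed

lemma k_Suc: obtains j where "k = Suc j" using k by (cases k) auto

lemma HS_2k: "u \<in> HS (2 * k) \<Longrightarrow> u \<in> HS (Suc (Suc (2 * k - 2)))"
  by (rule k_Suc) simp

text \<open>The second derivative subtracted in \<open>V_cor\<close> cancels, which leaves the
  operator conjugated by the exponential; the factor i passes through \<open>E'\<close> by complex
  linearity.\<close>

lemma V_cor_equation:
  assumes v: "v \<in> Sob_Dir k" and g: "g \<in> L2"
  shows "eq01 (\<lambda>x. \<i> * g x) (\<lambda>x. wderiv 2 v x + V_cor V \<phi> \<alpha> k v x) \<longleftrightarrow>
    cl g = app E' (B (app E (cl v)))"
proof -
  have vL: "v \<in> L2" "cl v \<in> HS (2 * k)" using v range_G_HS2k by (auto simp: Sob_Dir_iff)
  have ec: "exp_corr \<phi> \<alpha> k v \<in> L2" "cl (exp_corr \<phi> \<alpha> k v) = app E (cl v)" using exp_corr_E[OF vL(1)] by auto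
  have "exp_corr \<phi> \<alpha> k v \<in> Sob (Suc (Suc (2 * k - 2)))"
    using ec HS_2k[OF sob_bounded_HS[OF sob_bounded_E(1) vL(2)]] by (simp add: Sob_iff)
  note so = schr_op[OF smooth this]
  have em: "exp_minus_corr \<phi> \<alpha> k (schr_op V (exp_corr \<phi> \<alpha> k v)) \<in> L2"
    "cl (exp_minus_corr \<phi> \<alpha> k (schr_op V (exp_corr \<phi> \<alpha> k v))) = app E' (A W (app E (cl v)))"
    using exp_minus_corr[OF cutoffs Sob_L2[OF so(1)]] so(2) by (simp_all add: E'_def ec W_def[abs_def])
  have rhs: "(\<lambda>x. wderiv 2 v x + V_cor V \<phi> \<alpha> k v x) = exp_minus_corr \<phi> \<alpha> k (schr_op V (exp_corr \<phi> \<alpha> k v))"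
    by (simp add: V_cor_def)
  have "eq01 (\<lambda>x. \<i> * g x) (\<lambda>x. wderiv 2 v x + V_cor V \<phi> \<alpha> k v x) \<longleftrightarrow>
      csc \<i> (cl g) = app E' (A W (app E (cl v)))"
    unfolding rhs using em g by (simp add: mul_cl L2_cmult flip: cl_eq_iff)
  also have "app E' (A W (app E (cl v))) = csc \<i> (app E' (B (app E (cl v))))"
    unfolding A_eq_B by (rule E'_csc)
  also have "csc \<i> (cl g) = csc \<i> (app E' (B (app E (cl v)))) \<longleftrightarrow> cl g = app E' (B (app E (cl v)))"
    by (metis csc_inverse complex_i_not_zero)
  finally show ?thesis .
qed

text \<open>The conjugation by E is bounded on each \<open>HS m\<close>, so it carries continuity,
  time derivatives and the equation in both directions. The conjunct \<open>v0 \<in> L2\<close>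
  stands on both sides because equality almost everywhere with \<open>v 0\<close> does not make v0
  measurable.\<close>

lemma modified_solution_iff:
  "modified_solution V \<phi> \<alpha> k v0 v \<and> v0 \<in> L2 \<longleftrightarrow>
    (\<forall>t. v t \<in> L2) \<and> v0 \<in> L2 \<and> strong_solution k (\<lambda>t. app E (cl (v t))) \<and> cl (v 0) = cl v0"
proof
  assume m: "modified_solution V \<phi> \<alpha> k v0 v \<and> v0 \<in> L2"
  then have C0: "C0_curve (Sob_Dir k) (2 * k) v" and C1: "C1_curve (Sob_Dir (k - 1)) (2 * k - 2) v"
    and eq: "\<And>t. eq01 (\<lambda>x. \<i> * time_deriv (2 * k - 2) v t x) (\<lambda>x. wderiv 2 (v t) x + V_cor V \<phi> \<alpha> k (v t) x)"
    and init: "eq01 (v 0) v0" unfolding modified_solution_def by blast+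
  have vD: "v t \<in> Sob_Dir k" for t using C0 by (simp add: C0_curve_def)
  have vL: "v t \<in> L2" "cl (v t) \<in> range (G ^^ k)" for t using vD[of t] unfolding Sob_Dir_iff by blast+
  have vS: "v t \<in> Sob (2 * k)" for t using vL[of t] range_G_HS2k by (simp add: Sob_iff)
  then have vS': "v t \<in> Sob (2 * k - 2)" for t by (rule Sob_mono) simp
  note vS = vS vS'
  obtain v' where v': "\<And>t. v' t \<in> Sob_Dir (k - 1)" "\<And>t. has_time_deriv (2 * k - 2) v t (v' t)"
    using C1 unfolding C1_curve_def C0_curve_def by blast
  have v'S: "v' t \<in> Sob (2 * k - 2)" for t
    using v'(1)[of t] range_G_HS2k[of _ "k - 1"] by (auto simp: Sob_Dir_iff Sob_iff diff_mult_distrib2)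
  have hd: "curve_deriv (2 * k - 2) (\<lambda>t. cl (v t)) t (cl (v' t))" for t
    using v'(2)[of t] has_time_deriv_iff[of v "2 * k - 2" "v' t" t] vS v'S by blast
  have td: "time_deriv (2 * k - 2) v t \<in> L2" "cl (time_deriv (2 * k - 2) v t) = cl (v' t)" for t
    using time_deriv[of v "2 * k - 2" "v' t" t] vS v'S hd Sob_L2 by blast+
  have B: "cl (v' t) = app E' (B (app E (cl (v t))))" for t
    using V_cor_equation[OF vD td(1)] eq td(2) by metis
  have "strong_solution k (\<lambda>t. app E (cl (v t)))"
    unfolding strong_solution_def
  proof (intro conjI allI)
    show "app E (cl (v t)) \<in> HV W k" for t by (rule E_range[OF vL(2)])
    show "curve_continuous (2 * k) (\<lambda>t. app E (cl (v t)))"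
      using C0 C0_curve_iff[of v "2 * k" "Sob_Dir k"] vS by (intro curve_continuous_app sob_bounded_E Sob_HS) blast+
    have "curve_deriv (2 * k - 2) (\<lambda>t. app E (cl (v t))) t (app E (cl (v' t)))" for t
      by (intro curve_deriv_app hd Sob_HS vS v'S sob_bounded_E)
    then show "curve_deriv (2 * k - 2) (\<lambda>t. app E (cl (v t))) t (B (app E (cl (v t))))" for t
      by (simp add: B)
  qed
  then show "(\<forall>t. v t \<in> L2) \<and> v0 \<in> L2 \<and> strong_solution k (\<lambda>t. app E (cl (v t))) \<and> cl (v 0) = cl v0"
    using vL m init by (simp add: cl_eq_iff)
next
  assume a: "(\<forall>t. v t \<in> L2) \<and> v0 \<in> L2 \<and> strong_solution k (\<lambda>t. app E (cl (v t))) \<and> cl (v 0) = cl v0"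
  define U where "U t = app E (cl (v t))" for t
  have U: "U t \<in> HV W k" "curve_continuous (2 * k) U" "curve_deriv (2 * k - 2) U t (B (U t))" for t
    using a unfolding strong_solution_def U_def[abs_def] by blast+
  have vU: "cl (v t) = app E' (U t)" for t by (simp add: U_def)
  have vL: "v t \<in> L2" "cl (v t) \<in> range (G ^^ k)" for t
    using a E'_HV[OF U(1)] by (auto simp only: vU)
  have vD: "v t \<in> Sob_Dir k" for t using vL[of t] by (simp add: Sob_Dir_iff)
  have vS: "v t \<in> Sob (2 * k)" for t using vL[of t] range_G_HS2k by (simp add: Sob_iff)
  then have vS': "v t \<in> Sob (2 * k - 2)" for t by (rule Sob_mono) simp
  note vS = vS vS'
  have vD1: "v t \<in> Sob_Dir (k - 1)" for t
  proof (rule k_Suc)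
    fix j assume "k = Suc j"
    then show ?thesis using vD[of t] unfolding Sob_Dir_def using HS_mono by (auto simp: Sob_iff)
  qed
  have US: "U t \<in> HS (2 * k)" "U t \<in> HS (Suc (Suc (2 * k - 2)))" "U t \<in> HS (2 * k - 2)" for t
    using HV_HS[OF W U(1)] HS_2k[OF HV_HS[OF W U(1)]] HS_mono[OF HV_HS[OF W U(1)], of "2 * k - 2"] by simp_all
  have BU: "B (U t) \<in> HV W (k - 1)" for t
    by (rule k_Suc) (use U(1)[of t] HV_Suc_iff_B in auto)
  have "\<forall>t. \<exists>g. g \<in> L2 \<and> app E' (B (U t)) = cl g" by (metis cl_cases)
  then obtain v' where v': "\<And>t. v' t \<in> L2" "\<And>t. app E' (B (U t)) = cl (v' t)" by metis
  have v'D: "v' t \<in> Sob_Dir (k - 1)" for t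
    using v'(1) E'_HV_pred[OF BU] by (simp add: Sob_Dir_iff v'(2))
  have v'S: "v' t \<in> Sob (2 * k - 2)" for t
    using v'D[of t] range_G_HS2k[of _ "k - 1"] by (auto simp: Sob_Dir_iff Sob_iff diff_mult_distrib2)
  have BS: "B (U t) \<in> HS (2 * k - 2)" for t by (rule HS_B[OF US(2)])
  have hd: "curve_deriv (2 * k - 2) (\<lambda>t. cl (v t)) t (cl (v' t))" for t
    unfolding vU v'(2)[symmetric] by (intro curve_deriv_app U US BS sob_bounded_E)
  have td: "time_deriv (2 * k - 2) v t \<in> L2" "cl (time_deriv (2 * k - 2) v t) = cl (v' t)" for t
    using time_deriv[of v "2 * k - 2" "v' t" t] vS v'S hd Sob_L2 by blast+
  have "C0_curve (Sob_Dir k) (2 * k) v"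
    unfolding C0_curve_iff[of v, OF vS(1)] vU using vD by (auto intro!: curve_continuous_app U US sob_bounded_E)
  moreover have "C0_curve (Sob_Dir (k - 1)) (2 * k - 2) v'"
    unfolding C0_curve_iff[of v', OF v'S] v'(2)[symmetric]
    using v'D curve_continuous_B[of U "2 * k - 2", OF US(2)] U(2)
    by (auto intro!: curve_continuous_app BS sob_bounded_E) (rule k_Suc, simp)
  moreover have "has_time_deriv (2 * k - 2) v t (v' t)" for t
    using has_time_deriv_iff[of v "2 * k - 2" "v' t" t] vS v'S hd by blast
  moreover have "eq01 (\<lambda>x. \<i> * time_deriv (2 * k - 2) v t x) (\<lambda>x. wderiv 2 (v t) x + V_cor V \<phi> \<alpha> k (v t) x)" for t
    unfolding V_cor_equation[OF vD td(1)] td(2) v'(2)[symmetric] U_def ..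
  moreover have "eq01 (v 0) v0" using a cl_eq_iff[of "v 0" v0] by blast
  ultimately show "modified_solution V \<phi> \<alpha> k v0 v \<and> v0 \<in> L2"
    unfolding modified_solution_def C1_curve_def using vD1 a by blast
qed

text \<open>The problem itself imposes only the boundary condition of lowest order;
  \<open>Dirichlet_bootstrap\<close> supplies the others.\<close>

lemma dirichlet_schr_solution_iff:
  assumes C0: "C0_curve (Sob (2 * k)) (2 * k) u" and C1: "C1_curve (Sob (2 * k - 2)) (2 * k - 2) u"
  shows "dirichlet_schr_solution V k u \<longleftrightarrow> strong_solution k (\<lambda>t. cl (u t))"
proof -
  have uS: "u t \<in> Sob (2 * k)" "u t \<in> Sob (2 * k - 2)" "u t \<in> Sob (Suc (Suc (2 * k - 2)))" for t
    using C0 C1 HS_2k by (auto simp: C0_curve_def C1_curve_def Sob_iff)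
  obtain u' where u': "\<And>t. u' t \<in> Sob (2 * k - 2)" "\<And>t. has_time_deriv (2 * k - 2) u t (u' t)"
    using C1 unfolding C1_curve_def C0_curve_def by blast
  have hd: "curve_deriv (2 * k - 2) (\<lambda>t. cl (u t)) t (cl (u' t))" for t
    using u'(2)[of t] has_time_deriv_iff[of u "2 * k - 2" "u' t" t] uS u'(1) by blast
  have td: "time_deriv (2 * k - 2) u t \<in> L2" "cl (time_deriv (2 * k - 2) u t) = cl (u' t)" for t
    using time_deriv[of u "2 * k - 2" "u' t" t] uS u'(1) hd Sob_L2 by blast+
  have eq: "eq01 (\<lambda>x. \<i> * time_deriv (2 * k - 2) u t x) (schr_op V (u t)) \<longleftrightarrow> cl (u' t) = B (cl (u t))" for t
  proof -
    note so = schr_op[OF smooth uS(3)[of t]]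
    have "eq01 (\<lambda>x. \<i> * time_deriv (2 * k - 2) u t x) (schr_op V (u t)) \<longleftrightarrow> csc \<i> (cl (u' t)) = csc \<i> (B (cl (u t)))"
      unfolding A_eq_B[symmetric] td(2)[symmetric]
      using Sob_L2[OF so(1)] so(2) td(1) by (simp add: W_def[abs_def] mul_cl L2_cmult flip: cl_eq_iff)
    also have "\<dots> \<longleftrightarrow> cl (u' t) = B (cl (u t))" by (metis csc_inverse complex_i_not_zero)
    finally show ?thesis .
  qed
  have pv: "point_value (u t) z = ev (cl (u t)) z" if "z \<in> {0..1}" for t z
    by (rule point_value[OF uS(3) that])
  show ?thesis
  proof
    assume "dirichlet_schr_solution V k u"
    then have B: "\<And>t. cl (u' t) = B (cl (u t))" and z: "\<And>t. ev (cl (u t)) 0 = 0" "\<And>t. ev (cl (u t)) 1 = 0"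
      unfolding dirichlet_schr_solution_def by (simp_all add: eq pv)
    have "cl (u t) \<in> HV W k" for t
      by (rule Dirichlet_bootstrap[OF Sob_HS[OF uS(1)] z _ k order_refl]) (use hd B in simp)
    then show "strong_solution k (\<lambda>t. cl (u t))"
      unfolding strong_solution_def using C0 C0_curve_iff[of u, OF uS(1)] hd B by simp
  next
    assume s: "strong_solution k (\<lambda>t. cl (u t))"
    then have "cl (u' t) = B (cl (u t))" for t using hd curve_deriv_unique unfolding strong_solution_def by blast
    moreover have "ev (cl (u t)) 0 = 0 \<and> ev (cl (u t)) 1 = 0" for t
    proof -
      have "cl (u t) \<in> HV W k" using s by (simp add: strong_solution_def)
      then show ?thesis using k by (auto simp: HV_def dest: spec[of _ 0])
    qed
    ultimately show "dirichlet_schr_solution V k u"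
      unfolding dirichlet_schr_solution_def by (simp add: eq pv)
  qed
qed

text \<open>Existence comes from U, so the choice in \<open>modified_flow\<close> is a genuine
  solution, and uniqueness identifies it with U up to representatives. Admitting an arbitrary strong
  solution makes the lemma serve both directions of the correspondence.\<close>

lemma modified_flow_strong_solution:
  assumes U: "strong_solution k U" and v0: "v0 \<in> L2" "app E (cl v0) = U 0"
  shows "modified_flow V \<phi> \<alpha> k t v0 \<in> L2" "app E (cl (modified_flow V \<phi> \<alpha> k t v0)) = U t"
proof -
  have "\<forall>t. \<exists>f. f \<in> L2 \<and> app E' (U t) = cl f" by (metis cl_cases)
  then obtain v where v: "\<And>t. v t \<in> L2" "\<And>t. app E' (U t) = cl (v t)" by metis
  have "cl (v 0) = cl v0" using v0(2) v(2)[of 0] by (metis E_inverse(2))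
  then have "modified_solution V \<phi> \<alpha> k v0 v"
    using modified_solution_iff[of v0 v] v(1) v0(1) U by (simp add: v(2)[symmetric])
  then have "modified_solution V \<phi> \<alpha> k v0 (SOME v. modified_solution V \<phi> \<alpha> k v0 v)"
    by (rule someI[of "\<lambda>v. modified_solution V \<phi> \<alpha> k v0 v"])
  moreover define w where "w = (SOME v. modified_solution V \<phi> \<alpha> k v0 v)"
  ultimately have w: "\<And>t. w t \<in> L2" "strong_solution k (\<lambda>t. app E (cl (w t)))" "cl (w 0) = cl v0"
    using modified_solution_iff[of v0 w] v0(1) by auto
  have mw: "modified_flow V \<phi> \<alpha> k t v0 = w t" by (simp add: modified_flow_def w_def)
  show "modified_flow V \<phi> \<alpha> k t v0 \<in> L2" by (simp add: mw w)
  obtain j where "k = Suc j" by (rule k_Suc)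
  then show "app E (cl (modified_flow V \<phi> \<alpha> k t v0)) = U t"
    unfolding mw using strong_solution_unique[of j "\<lambda>t. app E (cl (w t))" U t] w U v0(2) by simp
qed

text \<open>For a given solution, the curve itself witnesses the existence on which
  \<open>modified_flow\<close> depends, and the datum is its value at time 0 pulled back by the
  inverse exponential. For a given datum, the group \<open>S\<close> is the witness.\<close>

lemma solution_correspondence:
  assumes C0: "C0_curve (Sob (2 * k)) (2 * k) u" and C1: "C1_curve (Sob (2 * k - 2)) (2 * k - 2) u"
  shows "dirichlet_schr_solution V k u \<longleftrightarrow>
    (\<exists>v0 \<in> Sob_Dir k. \<forall>t. eq01 (u t) (exp_corr \<phi> \<alpha> k (modified_flow V \<phi> \<alpha> k t v0)))"
  unfolding dirichlet_schr_solution_iff[OF assms]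
proof
  have uL: "u t \<in> L2" for t using C0 Sob_L2 unfolding C0_curve_def by blast
  assume s: "strong_solution k (\<lambda>t. cl (u t))"
  obtain v0 where v0: "v0 \<in> L2" "app E' (cl (u 0)) = cl v0" by (rule cl_cases)
  have "cl (u 0) \<in> HV W k" using s by (simp add: strong_solution_def)
  from E'_HV[OF this] have v0D: "v0 \<in> Sob_Dir k" using v0 by (simp add: Sob_Dir_iff)
  have "app E (cl v0) = cl (u 0)" by (simp flip: v0(2))
  note f = modified_flow_strong_solution[OF s v0(1) this]
  have "eq01 (u t) (exp_corr \<phi> \<alpha> k (modified_flow V \<phi> \<alpha> k t v0))" for t
    using exp_corr_E[OF f(1)[of t]] f(2)[of t] uL[of t] by (simp flip: cl_eq_iff)
  then show "\<exists>v0 \<in> Sob_Dir k. \<forall>t. eq01 (u t) (exp_corr \<phi> \<alpha> k (modified_flow V \<phi> \<alpha> k t v0))"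
    using v0D by blast
next
  have uL: "u t \<in> L2" for t using C0 Sob_L2 unfolding C0_curve_def by blast
  assume "\<exists>v0 \<in> Sob_Dir k. \<forall>t. eq01 (u t) (exp_corr \<phi> \<alpha> k (modified_flow V \<phi> \<alpha> k t v0))"
  then obtain v0 where v0: "v0 \<in> Sob_Dir k"
    and u: "\<And>t. eq01 (u t) (exp_corr \<phi> \<alpha> k (modified_flow V \<phi> \<alpha> k t v0))" by blast
  have v0L: "v0 \<in> L2" "app E (cl v0) \<in> HV W k" using v0 E_range unfolding Sob_Dir_iff by blast+
  have ex: "strong_solution k (\<lambda>t. S t (app E (cl v0)))"
    by (rule k_Suc) (use strong_solution_exists v0L(2) in auto)
  note f = modified_flow_strong_solution[OF ex v0L(1) S_0[symmetric]]
  have "cl (u t) = S t (app E (cl v0))" for t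
    using exp_corr_E[OF f(1)[of t]] f(2)[of t] u[of t] uL[of t] by (simp flip: cl_eq_iff)
  then show "strong_solution k (\<lambda>t. cl (u t))" using ex by simp
qed

end

theorem proposition2p13:
  fixes V :: "real \<Rightarrow> real"
    and \<phi> :: "nat \<Rightarrow> real \<Rightarrow> real \<Rightarrow> real"
    and \<alpha> :: "nat \<Rightarrow> nat \<Rightarrow> real \<Rightarrow> real"
    and k :: nat
    and u :: "real \<Rightarrow> real \<Rightarrow> complex"
  assumes "smooth_on {0..1} V"
    and "boundary_cutoffs \<phi>"
    and "admissible_coeffs V \<phi> \<alpha>"
    and "k \<ge> 1"
    and "C0_curve (Sob (2 * k)) (2 * k) u"
    and "C1_curve (Sob (2 * k - 2)) (2 * k - 2) u"
  shows "dirichlet_schr_solution V k u \<longleftrightarrow>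
    (\<exists>v0 \<in> Sob_Dir k. \<forall>t. eq01 (u t) (exp_corr \<phi> \<alpha> k (modified_flow V \<phi> \<alpha> k t v0)))"
proof -
  interpret corrected_schroedinger V \<phi> \<alpha> k by unfold_locales (fact assms)+
  show ?thesis by (rule solution_correspondence[OF assms(5,6)])
qed

end
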